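(* The plethystic bialgebra in two variables $\mathcal P^2$ is isomorphic to the homotopy cardinality of the incidence bialgebra of the simplicial groupoid $\mathcal B\,\mathcal T_{\mathsf S^{\mathrm r}}(\mathsf{Sym}_2)$.
   Context: Monads and operads. $\mathbf{Grpd}$ is the category of groupoids. $\mathsf{S}^{\mathrm r}$ is the monad on $\mathbf{Grpd}$ sending $A$ to $\bigsqcup_{n\ge1}A^n/\!/\mathfrak S_n$: objects nonempty tuples, morphisms generated by componentwise morphisms and, for $\sigma\in\mathfrak S_n$, isomorphisms $(a_1,\dots,a_n)\to(a_{\sigma(1)},\dots,a_{\sigma(n)})$; unit $a\mapsto(a)$, multiplication $\mu$ concatenation. An $\mathsf S^{\mathrm r}$-operad $Q$ consists of groupoids $Q_0$ (colours), $Q_1$ (operations), functors $s\colon Q_1\to\mathsf S^{\mathrm r}Q_0$ (inputs), $t\colon Q_1\to Q_0$ (output), composition $m\colon\mathsf S^{\mathrm r}Q_1\times_{\mathsf S^{\mathrm r}Q_0}Q_1\to Q_1$ (the $Q_1$ factor being the root) and units $e$, with the usual laws. $\mathsf{Sym}_2$ is the terminal $\mathsf S^{\mathrm r}$-operad on the discrete colour set $K=\{1,2\}$: $Q_0=K$, $Q_1=\mathsf S^{\mathrm r}K\times K$, $s,t$ projections, composition induced by $\mu$. $\mathcal T$-construction. (i) For a category $C$ internal to $\mathbf{Grpd}$ with discrete $C_0$, $\mathcal T_{\mathsf S^{\mathrm r}}(C)$ is the $\mathsf S^{\mathrm r}$-operad with colours $C_0$ whose operations are the pullback of $\mathsf S^{\mathrm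 r}(\text{target})$ along $C_0\times\mathsf S^{\mathrm r}1\to\mathsf S^{\mathrm r}C_0$, $(c,(\ast,\dots,\ast))\mapsto(c,\dots,c)$: nonempty tuples $(f_1,\dots,f_n)$ of arrows of $C$ with common target $c$ (inputs the sources, output $c$), with morphisms those of $\mathsf S^{\mathrm r}C_1$; composition $(f_1,\dots,f_k)\circ((g^1_j)_j,\dots,(g^k_j)_j)=(f_1g^1_1,\dots,f_1g^1_{n_1},\dots,f_kg^k_{n_k})$; units identities. (ii) For an $\mathsf S^{\mathrm r}$-operad $Q$ with discrete $Q_0$, $\mathcal T^{\mathsf S^{\mathrm r}}(Q)$ is the category internal to $\mathbf{Grpd}$ with objects $Q_0$, arrows $c\to d$ the operations with all inputs $c$ and output $d$, composition $y\circ x=m((x,\dots,x);y)$, identities $e$. (iii) $\mathcal T_{\mathsf S^{\mathrm r}}(Q):=\mathcal T_{\mathsf S^{\mathrm r}}(\mathcal T^{\mathsf S^{\mathrm r}}(Q))$. Bar construction. For an $\mathsf S^{\mathrm r}$-operad $Q$, $Q_n:=\mathsf S^{\mathrm r}Q_{n-1}\times_{\mathsf S^{\mathrm r}Q_0}Q_1$ ($n\ge2$). $\mathcal BQ$ has $\mathcal B_nQ=\mathsf S^{\mathrm r}Q_n$; $d_0$ discards the top (leafward) level keeping outputs, $d_n$ discards the root level and flattens via $\mu$, inner faces compose adjacent levels via $m$, degeneracies insert units. Incidence bialgebra. $|G|=\sum_{[x]}1/|\mathrm{Aut}(x)|$. For $X=\mathcal BQ$, $\mathbb Q_{\pi_0X_1}$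 has basis $\delta_a$; $\Delta(\delta_f)=\sum_{a,b}\frac{|\Phi_{f;a,b}|}{|\mathrm{Aut}(a)||\mathrm{Aut}(b)|}\delta_a\otimes\delta_b$ with $\Phi_{f;a,b}$ the homotopy fibre over $(a,b)$ of $(d_2,d_0)$ restricted to the homotopy fibre of $d_1$ over $f$; $\epsilon(\delta_f)=$ cardinality of the homotopy fibre of $s_0$ over $f$; product by juxtaposition of configurations (unit adjoined). The bialgebra. $\Lambda$ is the set of sequences $(\lambda_1,\lambda_2,\dots)$ of natural numbers with $\lambda_i=0$ for $i$ large; $\mathrm{aut}(\lambda)=\prod_i i!^{\lambda_i}\lambda_i!$. For two sets of variables $\mathbf x=(x_1,x_2,\dots)$, $\mathbf y=(y_1,y_2,\dots)$ and $\lambda=(\lambda^1,\lambda^2)\in\Lambda^2$ not both zero, $\mathbf X^\lambda=\mathbf x^{\lambda^1}\mathbf y^{\lambda^2}$ and $\mathrm{aut}(\lambda)=\mathrm{aut}(\lambda^1)\mathrm{aut}(\lambda^2)$. Power series without constant term are written $F=\sum_\lambda F_\lambda\mathbf X^\lambda/\mathrm{aut}(\lambda)$. For such $F$ let $F_k(\mathbf x,\mathbf y)=F(x_k,x_{2k},\dots;y_k,y_{2k},\dots)$. Pairs form a monoid under plethystic substitution $(G^1,G^2)\circledast(F^1,F^2)=(G^1(F^1,F^2),G^2(F^1,F^2))$, where $G(F^1,F^2)$ means substituting $x_k\mapsto F^1_k$, $y_k\mapsto F^2_k$ in $G$. $\mathcal P^2$ is the polynomial algebra on the maps $A^i_\lambda(F^1,F^2)=F^i_\lambda$,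 $i=1,2$, with comultiplication $\Delta(A^i_\lambda)((F^1,F^2),(G^1,G^2))=A^i_\lambda((G^1,G^2)\circledast(F^1,F^2))$ and counit $\epsilon(A^i_\lambda)=A^i_\lambda(x_1,y_1)$. *)

theory Defs
  imports Complex_Main "HOL-Library.Poly_Mapping" "HOL-Library.Product_Plus" "HOL-Library.FuncSet"
begin

section \<open>Groupoids and functors\<close>

text \<open>Composition is written in the usual order: \<open>Cmp G g f\<close> is \<open>g\<close> after \<open>f\<close>.  The records
  in this file carry only the data; the laws hold for the structures that are constructed.\<close>

record ('o, 'a) grpd =
  Ob :: "'o set"
  Ar :: "'a set"
  Dom :: "'a \<Rightarrow> 'o"
  Cod :: "'a \<Rightarrow> 'o"
  Idn :: "'o \<Rightarrow> 'a"
  Cmp :: "'a \<Rightarrow> 'a \<Rightarrow> 'a"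

record ('o, 'a, 'p, 'b) fct =
  onOb :: "'o \<Rightarrow> 'p"
  onAr :: "'a \<Rightarrow> 'b"

definition fcomp :: "('p, 'b, 'q, 'c) fct \<Rightarrow> ('o, 'a, 'p, 'b) fct \<Rightarrow> ('o, 'a, 'q, 'c) fct" where
  "fcomp G F = \<lparr>onOb = onOb G \<circ> onOb F, onAr = onAr G \<circ> onAr F\<rparr>"

definition fpair :: "('o, 'a, 'p, 'b) fct \<Rightarrow> ('o, 'a, 'q, 'c) fct \<Rightarrow> ('o, 'a, 'p \<times> 'q, 'b \<times> 'c) fct" where
  "fpair F G = \<lparr>onOb = (\<lambda>x. (onOb F x, onOb G x)), onAr = (\<lambda>a. (onAr F a, onAr G a))\<rparr>"

definition discrete :: "'k set \<Rightarrow> ('k, 'k) grpd" where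
  "discrete K = \<lparr>Ob = K, Ar = K, Dom = id, Cod = id, Idn = id, Cmp = (\<lambda>g f. g)\<rparr>"

definition prodG :: "('o, 'a) grpd \<Rightarrow> ('p, 'b) grpd \<Rightarrow> ('o \<times> 'p, 'a \<times> 'b) grpd" where
  "prodG G H = \<lparr>Ob = Ob G \<times> Ob H, Ar = Ar G \<times> Ar H,
     Dom = map_prod (Dom G) (Dom H), Cod = map_prod (Cod G) (Cod H),
     Idn = map_prod (Idn G) (Idn H),
     Cmp = (\<lambda>(g, g') (f, f'). (Cmp G g f, Cmp H g' f'))\<rparr>"

definition fullsub :: "('o, 'a) grpd \<Rightarrow> ('o \<Rightarrow> bool) \<Rightarrow> ('o, 'a) grpd" where
  "fullsub G P = G\<lparr>Ob := {x \<in> Ob G. P x}, Ar := {a \<in> Ar G. P (Dom G a) \<and> P (Cod G a)}\<rparr>"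

text \<open>Strict pullback of \<open>F: G \<rightarrow> L\<close> and \<open>K: H \<rightarrow> L\<close>.\<close>

definition pullback ::
  "('o, 'a) grpd \<Rightarrow> ('o, 'a, 'x, 'y) fct \<Rightarrow> ('p, 'b) grpd \<Rightarrow> ('p, 'b, 'x, 'y) fct
    \<Rightarrow> ('o \<times> 'p, 'a \<times> 'b) grpd" where
  "pullback G F H K = (prodG G H)
     \<lparr>Ob := {(x, y). x \<in> Ob G \<and> y \<in> Ob H \<and> onOb F x = onOb K y},
      Ar := {(a, b). a \<in> Ar G \<and> b \<in> Ar H \<and> onAr F a = onAr K b}\<rparr>"

text \<open>Transport of a groupoid along injections \<open>i\<close> on objects and \<open>j\<close> on arrows, with left
  inverses \<open>i'\<close> and \<open>j'\<close>.\<close>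

definition relabel ::
  "('o \<Rightarrow> 'p) \<Rightarrow> ('p \<Rightarrow> 'o) \<Rightarrow> ('a \<Rightarrow> 'b) \<Rightarrow> ('b \<Rightarrow> 'a) \<Rightarrow> ('o, 'a) grpd \<Rightarrow> ('p, 'b) grpd" where
  "relabel i i' j j' G = \<lparr>Ob = i ` Ob G, Ar = j ` Ar G,
     Dom = i \<circ> Dom G \<circ> j', Cod = i \<circ> Cod G \<circ> j', Idn = j \<circ> Idn G \<circ> i',
     Cmp = (\<lambda>g f. j (Cmp G (j' g) (j' f)))\<rparr>"

section \<open>The monad \<open>S\<^sup>r\<close>\<close>

text \<open>Every morphism from \<open>(a\<^sub>0, \<dots>, a\<^sub>n\<^sub>-\<^sub>1)\<close> to \<open>(b\<^sub>0, \<dots>, b\<^sub>n\<^sub>-\<^sub>1)\<close> is uniquely a permutation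
  \<open>(a\<^sub>i)\<^sub>i \<rightarrow> (a\<^sub>\<sigma>\<^sub>i)\<^sub>i\<close> followed by a componentwise morphism \<open>\<alpha>\<^sub>i: a\<^sub>\<sigma>\<^sub>i \<rightarrow> b\<^sub>i\<close>.  It is represented by the
  nonempty list of the pairs \<open>(\<sigma> i, \<alpha>\<^sub>i)\<close>, indexed by the positions \<open>i\<close> of the target (positions
  start at 0).\<close>

definition component :: "(nat \<times> 'a) list \<Rightarrow> nat \<Rightarrow> 'a" where
  "component f p = the (map_of f p)"

definition Sr :: "('o, 'a) grpd \<Rightarrow> ('o list, (nat \<times> 'a) list) grpd" where
  "Sr G = \<lparr>Ob = {xs. xs \<noteq> [] \<and> set xs \<subseteq> Ob G},
     Ar = {f. f \<noteq> [] \<and> snd ` set f \<subseteq> Ar G \<and> distinct (map fst f) \<and> fst ` set f = {..<length f}},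
     Dom = (\<lambda>f. map (\<lambda>p. Dom G (component f p)) [0..<length f]),
     Cod = (\<lambda>f. map (\<lambda>(p, a). Cod G a) f),
     Idn = (\<lambda>xs. zip [0..<length xs] (map (Idn G) xs)),
     Cmp = (\<lambda>g f. map (\<lambda>(i, b). (fst (f ! i), Cmp G b (snd (f ! i)))) g)\<rparr>"

definition Sr_map :: "('o, 'a, 'p, 'b) fct \<Rightarrow> ('o list, (nat \<times> 'a) list, 'p list, (nat \<times> 'b) list) fct" where
  "Sr_map F = \<lparr>onOb = map (onOb F), onAr = map (apsnd (onAr F))\<rparr>"

definition Sr_eta :: "('o, 'a, 'o list, (nat \<times> 'a) list) fct" where
  "Sr_eta = \<lparr>onOb = (\<lambda>x. [x]), onAr = (\<lambda>a. [(0, a)])\<rparr>"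

text \<open>\<open>flatten\<close>, the multiplication on arrows, forms the block permutation: position \<open>j\<close> of the source block \<open>p\<close> becomes
  position \<open>block_start F p + j\<close> of the concatenation.\<close>

definition block_start :: "(nat \<times> (nat \<times> 'a) list) list \<Rightarrow> nat \<Rightarrow> nat" where
  "block_start F p = (\<Sum>q<p. length (component F q))"

definition flatten :: "(nat \<times> (nat \<times> 'a) list) list \<Rightarrow> (nat \<times> 'a) list" where
  "flatten F = concat (map (\<lambda>(p, f). map (\<lambda>(j, a). (block_start F p + j, a)) f) F)"

definition Sr_mu ::
  "('o list list, (nat \<times> (nat \<times> 'a) list) list, 'o list, (nat \<times> 'a) list) fct" where
  "Sr_mu = \<lparr>onOb = concat, onAr = flatten\<rparr>"

section \<open>\<open>S\<^sup>r\<close>-operads\<close>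

record ('c, 'ca, 'q, 'qa) operad =
  colours :: "('c, 'ca) grpd"
  opns :: "('q, 'qa) grpd"
  inp :: "('q, 'qa, 'c list, (nat \<times> 'ca) list) fct"
  outp :: "('q, 'qa, 'c, 'ca) fct"
  opcomp :: "('q list \<times> 'q, (nat \<times> 'qa) list \<times> 'qa, 'q, 'qa) fct"
  opunit :: "('c, 'ca, 'q, 'qa) fct"

text \<open>The terminal \<open>S\<^sup>r\<close>-operad on a discrete groupoid of colours.\<close>

definition Sym :: "'k set \<Rightarrow> ('k, 'k, 'k list \<times> 'k, (nat \<times> 'k) list \<times> 'k) operad" where
  "Sym K = \<lparr>colours = discrete K,
     opns = prodG (Sr (discrete K)) (discrete K),
     inp = \<lparr>onOb = fst, onAr = fst\<rparr>,
     outp = \<lparr>onOb = snd, onAr = snd\<rparr>,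
     opcomp =
       \<lparr>onOb = (\<lambda>(xs, y). (concat (map fst xs), snd y)),
        onAr = (\<lambda>(as, b). (flatten (map (apsnd fst) as), snd b))\<rparr>,
     opunit = \<lparr>onOb = (\<lambda>c. ([c], c)), onAr = (\<lambda>c. ([(0, c)], c))\<rparr>\<rparr>"

datatype two = One | Two

abbreviation Sym2 :: "(two, two, two list \<times> two, (nat \<times> two) list \<times> two) operad" where
  "Sym2 \<equiv> Sym {One, Two}"

section \<open>The \<open>T\<close>-construction\<close>

text \<open>Categories internal to groupoids.  The composition \<open>icomp\<close> is applied to pairs \<open>(g, f)\<close> with
  \<open>src g = tgt f\<close>, and gives \<open>g\<close> after \<open>f\<close>.\<close>

record ('c, 'ca, 'f, 'fa) intcat =
  iobjs :: "('c, 'ca) grpd"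
  iarrs :: "('f, 'fa) grpd"
  isrc :: "('f, 'fa, 'c, 'ca) fct"
  itgt :: "('f, 'fa, 'c, 'ca) fct"
  icomp :: "('f \<times> 'f, 'fa \<times> 'fa, 'f, 'fa) fct"
  iid :: "('c, 'ca, 'f, 'fa) fct"

text \<open>Both constructions are meant for discrete objects, resp. discrete colours.  A full
  subgroupoid is then the same as the pullback along \<open>C\<^sub>0 \<times> S\<^sup>r1 \<rightarrow> S\<^sup>rC\<^sub>0\<close>.\<close>

definition T_low :: "('c, 'ca, 'f, 'fa) intcat \<Rightarrow> ('c, 'ca, 'f list, (nat \<times> 'fa) list) operad" where
  "T_low C = \<lparr>colours = iobjs C,
     opns = fullsub (Sr (iarrs C)) (\<lambda>fs. \<exists>c. \<forall>f\<in>set fs. onOb (itgt C) f = c),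
     inp = Sr_map (isrc C),
     outp = \<lparr>onOb = (\<lambda>fs. onOb (itgt C) (hd fs)), onAr = (\<lambda>fs. onAr (itgt C) (snd (hd fs)))\<rparr>,
     opcomp =
       \<lparr>onOb = (\<lambda>(gss, fs). concat (map2 (\<lambda>gs f. map (\<lambda>g. onOb (icomp C) (f, g)) gs) gss fs)),
        onAr = (\<lambda>(gss, fs). flatten
          (map2 (\<lambda>(p, gs) (_, f). (p, map (apsnd (\<lambda>g. onAr (icomp C) (f, g))) gs)) gss fs))\<rparr>,
     opunit = fcomp Sr_eta (iid C)\<rparr>"

definition T_up :: "('c, 'ca, 'q, 'qa) operad \<Rightarrow> ('c, 'ca, 'q, 'qa) intcat" where
  "T_up Q = \<lparr>iobjs = colours Q,
     iarrs = fullsub (opns Q) (\<lambda>q. \<exists>c. \<forall>c'\<in>set (onOb (inp Q) q). c' = c),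
     isrc = \<lparr>onOb = (\<lambda>q. hd (onOb (inp Q) q)), onAr = (\<lambda>a. snd (hd (onAr (inp Q) a)))\<rparr>,
     itgt = outp Q,
     icomp =
       \<lparr>onOb = (\<lambda>(y, x). onOb (opcomp Q) (map (\<lambda>_. x) (onOb (inp Q) y), y)),
        onAr = (\<lambda>(b, a). onAr (opcomp Q) (map (apsnd (\<lambda>_. a)) (onAr (inp Q) b), b))\<rparr>,
     iid = opunit Q\<rparr>"

definition T_op :: "('c, 'ca, 'q, 'qa) operad \<Rightarrow> ('c, 'ca, 'q list, (nat \<times> 'qa) list) operad" where
  "T_op Q = T_low (T_up Q)"

section \<open>The bar construction\<close>

text \<open>The groupoids \<open>Q\<^sub>0\<close>, \<open>Q\<^sub>1\<close>, \<open>Q\<^sub>2\<close>, \<dots> have to live on one type of objects and one type of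
  arrows, so that they can form a family indexed by the natural numbers.\<close>

datatype ('c, 'q) level =
    Colour (un_Colour: 'c)
  | Oper (un_Oper: 'q)
  | Graft (un_Graft: "('c, 'q) level list \<times> 'q")

datatype ('ca, 'qa) larr =
    ColourA (un_ColourA: 'ca)
  | OperA (un_OperA: 'qa)
  | GraftA (un_GraftA: "(nat \<times> ('ca, 'qa) larr) list \<times> 'qa")

type_synonym ('c, 'ca, 'q, 'qa) levfct =
  "(('c, 'q) level, ('ca, 'qa) larr, ('c, 'q) level, ('ca, 'qa) larr) fct"

definition root_out :: "('c, 'ca, 'q, 'qa) operad \<Rightarrow> (('c, 'q) level, ('ca, 'qa) larr, 'c, 'ca) fct" where
  "root_out Q =
     \<lparr>onOb = (\<lambda>x. case x of Colour c \<Rightarrow> c | Oper q \<Rightarrow> onOb (outp Q) q | Graft (xs, q) \<Rightarrow> onOb (outp Q) q),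
      onAr = (\<lambda>a. case a of ColourA c \<Rightarrow> c | OperA q \<Rightarrow> onAr (outp Q) q | GraftA (xs, q) \<Rightarrow> onAr (outp Q) q)\<rparr>"

fun barQ :: "('c, 'ca, 'q, 'qa) operad \<Rightarrow> nat \<Rightarrow> (('c, 'q) level, ('ca, 'qa) larr) grpd" where
  "barQ Q 0 = relabel Colour un_Colour ColourA un_ColourA (colours Q)"
| "barQ Q (Suc 0) = relabel Oper un_Oper OperA un_OperA (opns Q)"
| "barQ Q (Suc (Suc n)) = relabel Graft un_Graft GraftA un_GraftA
     (pullback (Sr (barQ Q (Suc n))) (Sr_map (root_out Q)) (opns Q) (inp Q))"

text \<open>\<open>Q\<^sub>n \<rightarrow> S\<^sup>rQ\<^sub>n\<^sub>-\<^sub>1\<close>, discarding the root level (\<open>n \<ge> 1\<close>).\<close>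

fun qcut :: "('c, 'ca, 'q, 'qa) operad \<Rightarrow> nat \<Rightarrow>
    (('c, 'q) level, ('ca, 'qa) larr, ('c, 'q) level list, (nat \<times> ('ca, 'qa) larr) list) fct" where
  "qcut Q (Suc 0) =
     \<lparr>onOb = (\<lambda>x. map Colour (onOb (inp Q) (un_Oper x))),
      onAr = (\<lambda>a. map (apsnd ColourA) (onAr (inp Q) (un_OperA a)))\<rparr>"
| "qcut Q (Suc (Suc n)) = \<lparr>onOb = fst \<circ> un_Graft, onAr = fst \<circ> un_GraftA\<rparr>"

text \<open>\<open>qface Q n i: Q\<^sub>n \<rightarrow> Q\<^sub>n\<^sub>-\<^sub>1\<close> for \<open>0 \<le> i < n\<close>.  Levels are counted from the leaves, but \<open>Graft\<close> exposes
  the root level first.  Thus \<open>i = n - 1 > 0\<close> composes the root level with the level above it, and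
  a smaller \<open>i\<close> acts on the trees grafted onto the root.  In \<open>Q\<^sub>2\<close> discarding the leaf level leaves
  the root operation, whose inputs are the outputs of the discarded operations.\<close>

fun qface :: "('c, 'ca, 'q, 'qa) operad \<Rightarrow> nat \<Rightarrow> nat \<Rightarrow> ('c, 'ca, 'q, 'qa) levfct" where
  "qface Q (Suc 0) i =
     \<lparr>onOb = (\<lambda>x. Colour (onOb (outp Q) (un_Oper x))),
      onAr = (\<lambda>a. ColourA (onAr (outp Q) (un_OperA a)))\<rparr>"
| "qface Q (Suc (Suc n)) i =
     (if i = Suc n then
        (if n = 0 then
           \<lparr>onOb = (\<lambda>x. case un_Graft x of (xs, q) \<Rightarrow>
              Oper (onOb (opcomp Q) (map un_Oper xs, q))),
            onAr = (\<lambda>a. case un_GraftA a of (as, b) \<Rightarrow>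
              OperA (onAr (opcomp Q) (map (apsnd un_OperA) as, b)))\<rparr>
         else
           \<lparr>onOb = (\<lambda>x. case un_Graft x of (xs, q) \<Rightarrow>
              Graft (concat (map (fst \<circ> un_Graft) xs),
                     onOb (opcomp Q) (map (snd \<circ> un_Graft) xs, q))),
            onAr = (\<lambda>a. case un_GraftA a of (as, b) \<Rightarrow>
              GraftA (flatten (map (apsnd (fst \<circ> un_GraftA)) as),
                      onAr (opcomp Q) (map (apsnd (snd \<circ> un_GraftA)) as, b)))\<rparr>)
      else if n = 0 then
        \<lparr>onOb = Oper \<circ> snd \<circ> un_Graft, onAr = OperA \<circ> snd \<circ> un_GraftA\<rparr>
      else
        \<lparr>onOb = Graft \<circ> apfst (onOb (Sr_map (qface Q (Suc n) i))) \<circ> un_Graft,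
         onAr = GraftA \<circ> apfst (onAr (Sr_map (qface Q (Suc n) i))) \<circ> un_GraftA\<rparr>)"

text \<open>\<open>qdegen Q n i: Q\<^sub>n \<rightarrow> Q\<^sub>n\<^sub>+\<^sub>1\<close> for \<open>0 \<le> i \<le> n\<close>; the units are inserted below the root for \<open>i = n\<close>.\<close>

fun qdegen :: "('c, 'ca, 'q, 'qa) operad \<Rightarrow> nat \<Rightarrow> nat \<Rightarrow> ('c, 'ca, 'q, 'qa) levfct" where
  "qdegen Q 0 i =
     \<lparr>onOb = Oper \<circ> onOb (opunit Q) \<circ> un_Colour, onAr = OperA \<circ> onAr (opunit Q) \<circ> un_ColourA\<rparr>"
| "qdegen Q (Suc n) i =
     (if i = Suc n then
        \<lparr>onOb = (\<lambda>x. Graft ([x], onOb (opunit Q) (onOb (root_out Q) x))),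
         onAr = (\<lambda>a. GraftA ([(0, a)], onAr (opunit Q) (onAr (root_out Q) a)))\<rparr>
      else if n = 0 then
        \<lparr>onOb = (\<lambda>x. Graft (onOb (fcomp (Sr_map (qdegen Q 0 i)) (qcut Q (Suc 0))) x, un_Oper x)),
         onAr = (\<lambda>a. GraftA (onAr (fcomp (Sr_map (qdegen Q 0 i)) (qcut Q (Suc 0))) a, un_OperA a))\<rparr>
      else
        \<lparr>onOb = Graft \<circ> apfst (onOb (Sr_map (qdegen Q n i))) \<circ> un_Graft,
         onAr = GraftA \<circ> apfst (onAr (Sr_map (qdegen Q n i))) \<circ> un_GraftA\<rparr>)"

text \<open>\<open>face X n i: X\<^sub>n \<rightarrow> X\<^sub>n\<^sub>-\<^sub>1\<close> and \<open>degen X n i: X\<^sub>n \<rightarrow> X\<^sub>n\<^sub>+\<^sub>1\<close>, for \<open>0 \<le> i \<le> n\<close>.\<close>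

record ('o, 'a) sgrpd =
  simp_lev :: "nat \<Rightarrow> ('o, 'a) grpd"
  face :: "nat \<Rightarrow> nat \<Rightarrow> ('o, 'a, 'o, 'a) fct"
  degen :: "nat \<Rightarrow> nat \<Rightarrow> ('o, 'a, 'o, 'a) fct"

definition bar :: "('c, 'ca, 'q, 'qa) operad \<Rightarrow>
    (('c, 'q) level list, (nat \<times> ('ca, 'qa) larr) list) sgrpd" where
  "bar Q = \<lparr>simp_lev = (\<lambda>n. Sr (barQ Q n)),
     face = (\<lambda>n i. if i = n then fcomp Sr_mu (Sr_map (qcut Q n)) else Sr_map (qface Q n i)),
     degen = (\<lambda>n i. Sr_map (qdegen Q n i))\<rparr>"

section \<open>Homotopy cardinality\<close>

definition iso_class :: "('o, 'a) grpd \<Rightarrow> 'o \<Rightarrow> 'o set" where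
  "iso_class G x = {y \<in> Ob G. \<exists>a\<in>Ar G. Dom G a = x \<and> Cod G a = y}"

definition pi0 :: "('o, 'a) grpd \<Rightarrow> 'o set set" where
  "pi0 G = iso_class G ` Ob G"

definition rep :: "'o set \<Rightarrow> 'o" where
  "rep c = (SOME x. x \<in> c)"

definition Aut :: "('o, 'a) grpd \<Rightarrow> 'o \<Rightarrow> 'a set" where
  "Aut G x = {a \<in> Ar G. Dom G a = x \<and> Cod G a = x}"

definition finite_grpd :: "('o, 'a) grpd \<Rightarrow> bool" where
  "finite_grpd G \<longleftrightarrow> finite (pi0 G) \<and> (\<forall>x\<in>Ob G. finite (Aut G x))"

text \<open>Meaningful only for groupoids satisfying \<open>finite_grpd\<close>.\<close>

definition gcard :: "('o, 'a) grpd \<Rightarrow> rat" where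
  "gcard G = (\<Sum>c\<in>pi0 G. 1 / of_nat (card (Aut G (rep c))))"

text \<open>The homotopy fibre of \<open>F: G \<rightarrow> H\<close> over \<open>y\<close> has objects \<open>(x, h: F x \<rightarrow> y)\<close>.  An arrow \<open>a\<close> from
  \<open>(x, h)\<close> to \<open>(x', h')\<close> is represented by \<open>(h, a, h')\<close>.\<close>

definition hfib :: "('o, 'a) grpd \<Rightarrow> ('o, 'a, 'p, 'b) fct \<Rightarrow> ('p, 'b) grpd \<Rightarrow> 'p
    \<Rightarrow> ('o \<times> 'b, 'b \<times> 'a \<times> 'b) grpd" where
  "hfib G F H y = \<lparr>
     Ob = {(x, h). x \<in> Ob G \<and> h \<in> Ar H \<and> Dom H h = onOb F x \<and> Cod H h = y},
     Ar = {(h, a, h'). a \<in> Ar G \<and> h \<in> Ar H \<and> h' \<in> Ar H \<and>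
            Dom H h = onOb F (Dom G a) \<and> Dom H h' = onOb F (Cod G a) \<and>
            Cod H h = y \<and> Cod H h' = y \<and> Cmp H h' (onAr F a) = h},
     Dom = (\<lambda>(h, a, h'). (Dom G a, h)),
     Cod = (\<lambda>(h, a, h'). (Cod G a, h')),
     Idn = (\<lambda>(x, h). (h, Idn G x, h)),
     Cmp = (\<lambda>(h', b, h'') (h, a, _). (h, Cmp G b a, h''))\<rparr>"

text \<open>The forgetful functor from a homotopy fibre.\<close>

definition hfib_proj :: "('o \<times> 'b, 'b \<times> 'a \<times> 'b, 'o, 'a) fct" where
  "hfib_proj = \<lparr>onOb = fst, onAr = (\<lambda>(h, a, h'). a)\<rparr>"

section \<open>Bialgebras with a basis\<close>

text \<open>A rational bialgebra on the free vector space over the set \<open>basis\<close>; its elements are the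
  finitely supported functions \<open>x\<close> with \<open>Poly_Mapping.keys x \<subseteq> basis\<close>, and its tensor square is the free vector
  space over \<open>basis \<times> basis\<close>.\<close>

record 'b bialg =
  basis :: "'b set"
  bmult :: "('b \<Rightarrow>\<^sub>0 rat) \<Rightarrow> ('b \<Rightarrow>\<^sub>0 rat) \<Rightarrow> ('b \<Rightarrow>\<^sub>0 rat)"
  bone :: "'b \<Rightarrow>\<^sub>0 rat"
  bcomult :: "('b \<Rightarrow>\<^sub>0 rat) \<Rightarrow> ('b \<times> 'b \<Rightarrow>\<^sub>0 rat)"
  bcounit :: "('b \<Rightarrow>\<^sub>0 rat) \<Rightarrow> rat"

definition space :: "'b bialg \<Rightarrow> ('b \<Rightarrow>\<^sub>0 rat) set" where
  "space H = {x. Poly_Mapping.keys x \<subseteq> basis H}"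

definition scale :: "rat \<Rightarrow> ('b \<Rightarrow>\<^sub>0 rat) \<Rightarrow> ('b \<Rightarrow>\<^sub>0 rat)" where
  "scale c x = Poly_Mapping.map (\<lambda>d. c * d) x"

definition lin :: "('b \<Rightarrow> ('c \<Rightarrow>\<^sub>0 rat)) \<Rightarrow> ('b \<Rightarrow>\<^sub>0 rat) \<Rightarrow> ('c \<Rightarrow>\<^sub>0 rat)" where
  "lin h x = (\<Sum>b\<in>Poly_Mapping.keys x. scale (Poly_Mapping.lookup x b) (h b))"

definition tens :: "('b \<Rightarrow>\<^sub>0 rat) \<Rightarrow> ('c \<Rightarrow>\<^sub>0 rat) \<Rightarrow> ('b \<times> 'c \<Rightarrow>\<^sub>0 rat)" where
  "tens x y = (\<Sum>a\<in>Poly_Mapping.keys x. \<Sum>b\<in>Poly_Mapping.keys y. Poly_Mapping.single (a, b) (Poly_Mapping.lookup x a * Poly_Mapping.lookup y b))"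

definition tens_map :: "(('b \<Rightarrow>\<^sub>0 rat) \<Rightarrow> ('c \<Rightarrow>\<^sub>0 rat)) \<Rightarrow> ('b \<times> 'b \<Rightarrow>\<^sub>0 rat) \<Rightarrow> ('c \<times> 'c \<Rightarrow>\<^sub>0 rat)" where
  "tens_map \<phi> = lin (\<lambda>(a, b). tens (\<phi> (Poly_Mapping.single a 1)) (\<phi> (Poly_Mapping.single b 1)))"

definition bialg_iso :: "'b bialg \<Rightarrow> 'c bialg \<Rightarrow> (('b \<Rightarrow>\<^sub>0 rat) \<Rightarrow> ('c \<Rightarrow>\<^sub>0 rat)) \<Rightarrow> bool" where
  "bialg_iso H H' \<phi> \<longleftrightarrow>
     bij_betw \<phi> (space H) (space H') \<and>
     (\<forall>x\<in>space H. \<forall>y\<in>space H. \<phi> (x + y) = \<phi> x + \<phi> y) \<and>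
     (\<forall>c. \<forall>x\<in>space H. \<phi> (scale c x) = scale c (\<phi> x)) \<and>
     (\<forall>x\<in>space H. \<forall>y\<in>space H. \<phi> (bmult H x y) = bmult H' (\<phi> x) (\<phi> y)) \<and>
     \<phi> (bone H) = bone H' \<and>
     (\<forall>x\<in>space H. tens_map \<phi> (bcomult H x) = bcomult H' (\<phi> x)) \<and>
     (\<forall>x\<in>space H. bcounit H x = bcounit H' (\<phi> x))"

definition bialg_isomorphic :: "'b bialg \<Rightarrow> 'c bialg \<Rightarrow> bool" where
  "bialg_isomorphic H H' \<longleftrightarrow> (\<exists>\<phi>. bialg_iso H H' \<phi>)"

section \<open>The incidence bialgebra\<close>

text \<open>The finiteness conditions under which all the homotopy cardinalities below exist.\<close>

definition locally_finite :: "('o, 'a) sgrpd \<Rightarrow> bool" where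
  "locally_finite X \<longleftrightarrow>
     (\<forall>f\<in>Ob (simp_lev X 1). finite (Aut (simp_lev X 1) f)
        \<and> finite_grpd (hfib (simp_lev X 2) (face X 2 1) (simp_lev X 1) f)
        \<and> finite_grpd (hfib (simp_lev X 0) (degen X 0 0) (simp_lev X 1) f))"

definition Phi :: "('o, 'a) sgrpd \<Rightarrow> 'o \<Rightarrow> 'o \<Rightarrow> 'o
    \<Rightarrow> (('o \<times> 'a) \<times> 'a \<times> 'a, ('a \<times> 'a) \<times> ('a \<times> 'a \<times> 'a) \<times> 'a \<times> 'a) grpd" where
  "Phi X f a b =
     hfib (hfib (simp_lev X 2) (face X 2 1) (simp_lev X 1) f)
          (fcomp (fpair (face X 2 2) (face X 2 0)) hfib_proj)
          (prodG (simp_lev X 1) (simp_lev X 1)) (a, b)"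

definition comult_coeff :: "('o, 'a) sgrpd \<Rightarrow> 'o \<Rightarrow> 'o \<Rightarrow> 'o \<Rightarrow> rat" where
  "comult_coeff X f a b =
     gcard (Phi X f a b) / (of_nat (card (Aut (simp_lev X 1) a)) * of_nat (card (Aut (simp_lev X 1) b)))"

definition counit_coeff :: "('o, 'a) sgrpd \<Rightarrow> 'o \<Rightarrow> rat" where
  "counit_coeff X f = gcard (hfib (simp_lev X 0) (degen X 0 0) (simp_lev X 1) f)"

text \<open>The basis consists of the adjoined unit \<open>None\<close> and of \<open>\<delta>\<^sub>c = Some c\<close> for \<open>c \<in> \<pi>\<^sub>0 X\<^sub>1\<close>.\<close>

definition comult_basis :: "('o, 'a) sgrpd \<Rightarrow> 'o set option
    \<Rightarrow> ('o set option \<times> 'o set option \<Rightarrow>\<^sub>0 rat)" where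
  "comult_basis X u = (case u of
       None \<Rightarrow> Poly_Mapping.single (None, None) 1
     | Some c \<Rightarrow> Abs_poly_mapping (\<lambda>v. case v of
           (Some a, Some b) \<Rightarrow>
             if a \<in> pi0 (simp_lev X 1) \<and> b \<in> pi0 (simp_lev X 1)
             then comult_coeff X (rep c) (rep a) (rep b) else 0
         | _ \<Rightarrow> 0))"

definition counit_basis :: "('o, 'a) sgrpd \<Rightarrow> 'o set option \<Rightarrow> rat" where
  "counit_basis X u = (case u of None \<Rightarrow> 1 | Some c \<Rightarrow> counit_coeff X (rep c))"

text \<open>The product is juxtaposition, for simplicial groupoids whose objects are tuples, such as
  bar constructions.\<close>

fun juxtapose :: "('o list, 'a) sgrpd \<Rightarrow> 'o list set option \<Rightarrow> 'o list set option \<Rightarrow> 'o list set option" where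
  "juxtapose X None v = v"
| "juxtapose X u None = u"
| "juxtapose X (Some a) (Some b) = Some (iso_class (simp_lev X 1) (rep a @ rep b))"

definition incidence :: "('o list, 'a) sgrpd \<Rightarrow> 'o list set option bialg" where
  "incidence X = \<lparr>
     basis = insert None (Some ` pi0 (simp_lev X 1)),
     bmult = (\<lambda>x y. lin (\<lambda>(u, v). Poly_Mapping.single (juxtapose X u v) 1) (tens x y)),
     bone = Poly_Mapping.single None 1,
     bcomult = lin (comult_basis X),
     bcounit = (\<lambda>x. \<Sum>u\<in>Poly_Mapping.keys x. Poly_Mapping.lookup x u * counit_basis X u)\<rparr>"

section \<open>Formal power series in arbitrarily many variables\<close>

text \<open>A series is its coefficient function on monomials; the monomial with exponents \<open>\<lambda>\<close> is \<open>\<lambda>\<close> itself.\<close>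

typedef 'v mser = "UNIV :: (('v \<Rightarrow>\<^sub>0 nat) \<Rightarrow> rat) set"
  morphisms mcoeff Mser ..

setup_lifting type_definition_mser

lemma finite_add_decomp: "finite {(\<alpha>, \<beta>). \<alpha> + \<beta> = (\<nu> :: 'v \<Rightarrow>\<^sub>0 nat)}"
proof -
  let ?A = "{\<alpha>. \<forall>v. Poly_Mapping.lookup \<alpha> v \<le> Poly_Mapping.lookup \<nu> v}"
  let ?r = "\<lambda>\<alpha> :: 'v \<Rightarrow>\<^sub>0 nat. restrict (Poly_Mapping.lookup \<alpha>) (Poly_Mapping.keys \<nu>)"
  have "?r ` ?A \<subseteq> (\<Pi>\<^sub>E v\<in>Poly_Mapping.keys \<nu>. {0..Poly_Mapping.lookup \<nu> v})"
    by auto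
  then have "finite (?r ` ?A)"
    by (rule finite_subset) (auto intro!: finite_PiE)
  moreover have "inj_on ?r ?A"
  proof (rule inj_onI, rule poly_mapping_eqI)
    fix \<alpha> \<beta> v assume *: "\<alpha> \<in> ?A" "\<beta> \<in> ?A" and eq: "?r \<alpha> = ?r \<beta>"
    show "Poly_Mapping.lookup \<alpha> v = Poly_Mapping.lookup \<beta> v"
    proof (cases "v \<in> Poly_Mapping.keys \<nu>")
      case True
      then show ?thesis using fun_cong[OF eq, of v] by simp
    next
      case False
      then have "Poly_Mapping.lookup \<nu> v = 0" by (simp add: in_keys_iff)
      then show ?thesis using * by (metis (mono_tags, lifting) le_zero_eq mem_Collect_eq)
    qed
  qed
  ultimately have "finite ?A" by (rule finite_imageD)
  then have "finite (?A \<times> ?A)" by simp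
  moreover have "{(\<alpha>, \<beta>). \<alpha> + \<beta> = \<nu>} \<subseteq> ?A \<times> ?A" by (auto simp: lookup_add)
  ultimately show ?thesis by (rule rev_finite_subset)
qed

instantiation mser :: (type) comm_monoid_mult
begin

lift_definition one_mser :: "'v mser" is "\<lambda>\<nu>. if \<nu> = 0 then 1 else 0" .

lift_definition times_mser :: "'v mser \<Rightarrow> 'v mser \<Rightarrow> 'v mser" is
  "\<lambda>f g \<nu>. \<Sum>(\<alpha>, \<beta>) | \<alpha> + \<beta> = \<nu>. f \<alpha> * g \<beta>" .

instance
proof
  fix a b c :: "'v mser"
  show "a * b * c = a * (b * c)"
  proof (transfer, rule ext)
    fix f g h :: "('v \<Rightarrow>\<^sub>0 nat) \<Rightarrow> rat" and \<nu>
    let ?D = "\<lambda>\<nu> :: 'v \<Rightarrow>\<^sub>0 nat. {(\<alpha>, \<beta>). \<alpha> + \<beta> = \<nu>}"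
    note fin = finite_add_decomp
    have "(\<Sum>(\<alpha>, \<beta>)\<in>?D \<nu>. (\<Sum>(\<gamma>, \<delta>)\<in>?D \<alpha>. f \<gamma> * g \<delta>) * h \<beta>) =
        (\<Sum>p\<in>?D \<nu>. \<Sum>q\<in>?D (fst p). f (fst q) * g (snd q) * h (snd p))"
      by (simp add: case_prod_unfold sum_distrib_right)
    also have "\<dots> = (\<Sum>(p, q)\<in>Sigma (?D \<nu>) (\<lambda>p. ?D (fst p)). f (fst q) * g (snd q) * h (snd p))"
      by (rule sum.Sigma) (auto simp: fin)
    also have "\<dots> = (\<Sum>(p, q)\<in>Sigma (?D \<nu>) (\<lambda>p. ?D (snd p)). f (fst p) * (g (fst q) * h (snd q)))"
      by (rule sum.reindex_bij_witness[of _
            "\<lambda>((\<alpha>, \<beta>), (\<gamma>, \<delta>)). ((\<alpha> + \<gamma>, \<delta>), (\<alpha>, \<gamma>))"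
            "\<lambda>((\<alpha>, \<beta>), (\<gamma>, \<delta>)). ((\<gamma>, \<delta> + \<beta>), (\<delta>, \<beta>))"])
        (auto simp: add.assoc mult.assoc)
    also have "\<dots> = (\<Sum>p\<in>?D \<nu>. \<Sum>q\<in>?D (snd p). f (fst p) * (g (fst q) * h (snd q)))"
      by (rule sum.Sigma[symmetric]) (auto simp: fin)
    also have "\<dots> = (\<Sum>(\<alpha>, \<beta>)\<in>?D \<nu>. f \<alpha> * (\<Sum>(\<gamma>, \<delta>)\<in>?D \<beta>. g \<gamma> * h \<delta>))"
      by (simp add: case_prod_unfold sum_distrib_left)
    finally show "(\<Sum>(\<alpha>, \<beta>)\<in>?D \<nu>. (\<Sum>(\<gamma>, \<delta>)\<in>?D \<alpha>. f \<gamma> * g \<delta>) * h \<beta>) =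
        (\<Sum>(\<alpha>, \<beta>)\<in>?D \<nu>. f \<alpha> * (\<Sum>(\<gamma>, \<delta>)\<in>?D \<beta>. g \<gamma> * h \<delta>))" .
  qed
  show "a * b = b * a"
  proof (transfer, rule ext)
    fix f g :: "('v \<Rightarrow>\<^sub>0 nat) \<Rightarrow> rat" and \<nu>
    show "(\<Sum>(\<alpha>, \<beta>) | \<alpha> + \<beta> = \<nu>. f \<alpha> * g \<beta>) = (\<Sum>(\<alpha>, \<beta>) | \<alpha> + \<beta> = \<nu>. g \<alpha> * f \<beta>)"
      by (rule sum.reindex_bij_witness[of _ prod.swap prod.swap]) (auto simp: add.commute mult.commute)
  qed
  show "1 * a = a"
  proof (transfer, rule ext)
    fix f :: "('v \<Rightarrow>\<^sub>0 nat) \<Rightarrow> rat" and \<nu>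
    have "(\<Sum>(\<alpha>, \<beta>) | \<alpha> + \<beta> = \<nu>. (if \<alpha> = 0 then 1 else 0) * f \<beta>) =
        (\<Sum>(\<alpha>, \<beta>)\<in>{(0 :: 'v \<Rightarrow>\<^sub>0 nat, \<nu>)}. (if \<alpha> = 0 then 1 else 0) * f \<beta>)"
      by (rule sum.mono_neutral_right) (auto simp: finite_add_decomp split: if_splits)
    then show "(\<Sum>(\<alpha>, \<beta>) | \<alpha> + \<beta> = \<nu>. (if \<alpha> = 0 then 1 else 0) * f \<beta>) = f \<nu>"
      by simp
  qed
qed

end

section \<open>Plethystic substitution and the plethystic bialgebra\<close>

text \<open>The variables are \<open>x\<^sub>k = (One, k)\<close> and \<open>y\<^sub>k = (Two, k)\<close> for \<open>k \<ge> 1\<close>.  Thus \<open>\<lambda> = (\<lambda>\<^sup>1, \<lambda>\<^sup>2)\<close> is one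
  finitely supported function: \<open>\<lambda>\<^sup>1\<^sub>k = Poly_Mapping.lookup \<lambda> (One, k)\<close> and \<open>\<lambda>\<^sup>2\<^sub>k = Poly_Mapping.lookup \<lambda> (Two, k)\<close>.\<close>

type_synonym expo = "two \<times> nat \<Rightarrow>\<^sub>0 nat"

text \<open>The elements of \<open>\<Lambda>\<^sup>2\<close> other than \<open>(0, 0)\<close>.\<close>

definition Lambda2 :: "expo set" where
  "Lambda2 = {l. (\<forall>c. Poly_Mapping.lookup l (c, 0) = 0) \<and> l \<noteq> 0}"

definition aut :: "expo \<Rightarrow> nat" where
  "aut l = (\<Prod>(c, k)\<in>Poly_Mapping.keys l. fact k ^ Poly_Mapping.lookup l (c, k) * fact (Poly_Mapping.lookup l (c, k)))"

type_synonym series2 = "two \<Rightarrow> (two \<times> nat) mser"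

definition pairs :: "series2 set" where
  "pairs = {F. \<forall>i l. mcoeff (F i) l \<noteq> 0 \<longrightarrow> l \<in> Lambda2}"

text \<open>The value at \<open>F\<close> of the map \<open>A\<^sup>i\<^sub>\<lambda>\<close>; the coefficient of \<open>X\<^sup>\<lambda>\<close> in \<open>F\<^sup>i\<close> is \<open>F\<^sup>i\<^sub>\<lambda> / aut \<lambda>\<close>.\<close>

definition A_map :: "two \<Rightarrow> expo \<Rightarrow> series2 \<Rightarrow> rat" where
  "A_map i l F = of_nat (aut l) * mcoeff (F i) l"

text \<open>The exponents of the monomial obtained from \<open>X\<^sup>\<lambda>\<close> by \<open>x\<^sub>j \<mapsto> x\<^sub>k\<^sub>j\<close>, \<open>y\<^sub>j \<mapsto> y\<^sub>k\<^sub>j\<close>, and the series \<open>F\<^sub>k\<close>.\<close>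

definition dilate :: "nat \<Rightarrow> expo \<Rightarrow> expo" where
  "dilate k l = (\<Sum>(c, j)\<in>Poly_Mapping.keys l. Poly_Mapping.single (c, k * j) (Poly_Mapping.lookup l (c, j)))"

definition frob :: "nat \<Rightarrow> (two \<times> nat) mser \<Rightarrow> (two \<times> nat) mser" where
  "frob k F = Mser (\<lambda>\<nu>. Sum_any (\<lambda>l. mcoeff F l when dilate k l = \<nu>))"

text \<open>The sum over \<open>\<lambda>\<close> has finitely many nonzero terms in each coefficient, for \<open>F \<in> pairs\<close>.\<close>

definition plethysm :: "series2 \<Rightarrow> series2 \<Rightarrow> series2" where
  "plethysm G F = (\<lambda>i. Mser (\<lambda>\<nu>.
     Sum_any (\<lambda>l. mcoeff (G i) l * mcoeff (\<Prod>(c, k)\<in>Poly_Mapping.keys l. frob k (F c) ^ Poly_Mapping.lookup l (c, k)) \<nu>)))"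

text \<open>The pair \<open>(x\<^sub>1, y\<^sub>1)\<close>.\<close>

definition pair_id :: series2 where
  "pair_id = (\<lambda>i. Mser (\<lambda>\<nu>. if \<nu> = Poly_Mapping.single (i, 1) 1 then 1 else 0))"

text \<open>\<open>(i, \<lambda>)\<close> stands for the generator \<open>A\<^sup>i\<^sub>\<lambda>\<close>.\<close>

type_synonym gen = "two \<times> expo"
type_synonym mon = "gen \<Rightarrow>\<^sub>0 nat"

definition P2_monomials :: "mon set" where
  "P2_monomials = {m. Poly_Mapping.keys m \<subseteq> UNIV \<times> Lambda2}"

definition mon_eval :: "mon \<Rightarrow> series2 \<Rightarrow> rat" where
  "mon_eval m F = (\<Prod>(i, l)\<in>Poly_Mapping.keys m. A_map i l F ^ Poly_Mapping.lookup m (i, l))"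

text \<open>Elements of the tensor square as functions of two pairs.\<close>

definition tens_eval :: "(mon \<times> mon \<Rightarrow>\<^sub>0 rat) \<Rightarrow> series2 \<Rightarrow> series2 \<Rightarrow> rat" where
  "tens_eval T F G = (\<Sum>(m, n)\<in>Poly_Mapping.keys T. Poly_Mapping.lookup T (m, n) * (mon_eval m F * mon_eval n G))"

definition comult_gen :: "gen \<Rightarrow> (mon \<times> mon \<Rightarrow>\<^sub>0 rat)" where
  "comult_gen g = (THE T. Poly_Mapping.keys T \<subseteq> P2_monomials \<times> P2_monomials \<and>
     (\<forall>F\<in>pairs. \<forall>G\<in>pairs. tens_eval T F G = A_map (fst g) (snd g) (plethysm G F)))"

text \<open>The algebra structures on \<open>P\<^sup>2\<close> and on its tensor square are the convolution products of
  \<^theory>\<open>HOL-Library.Poly_Mapping\<close>; comultiplication and counit are the algebra homomorphisms with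
  the prescribed values on the generators.\<close>

definition P2 :: "mon bialg" where
  "P2 = \<lparr>
     basis = P2_monomials,
     bmult = (\<lambda>x y. x * y),
     bone = 1,
     bcomult = lin (\<lambda>m. \<Prod>g\<in>Poly_Mapping.keys m. comult_gen g ^ Poly_Mapping.lookup m g),
     bcounit = (\<lambda>x. \<Sum>m\<in>Poly_Mapping.keys x. Poly_Mapping.lookup x m * mon_eval m pair_id)\<rparr>"

end

theory Submission
  imports Defs "HOL-Combinatorics.Multiset_Permutations" "HOL-Computational_Algebra.Polynomial"
    "HOL-Computational_Algebra.Primes"
begin

text \<open>The homotopy cardinality of a groupoid with finitely many objects is the sum over its objects of
  the inverse number of outgoing arrows.  Hence the coefficient of \<open>\<delta>\<^sub>a \<otimes> \<delta>\<^sub>b\<close> in \<open>\<Delta>(\<delta>\<^sub>f)\<close> is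
  \<open>|Aut f|\<close> times the sum of these weights over the objects \<open>x\<close> of \<open>X\<^sub>2\<close> whose faces \<open>d\<^sub>1 x\<close>, \<open>d\<^sub>2 x\<close>,
  \<open>d\<^sub>0 x\<close> are isomorphic to \<open>f\<close>, \<open>a\<close>, \<open>b\<close>.

  An operation of \<open>T_op Sym2\<close> with output \<open>i\<close> is a list of variables \<open>(c, k)\<close>; up to isomorphism it is
  the generator \<open>A\<^sup>i\<^sub>\<lambda>\<close>, where \<open>\<lambda>\<close> counts the variables, and the weights of the lists with exponents
  \<open>\<lambda>\<close> add up to \<open>1 / aut \<lambda>\<close>.  Grafting an operation onto \<open>(c, k)\<close> multiplies its second indices by
  \<open>k\<close>, as substitution of \<open>F\<^sup>c\<^sub>k\<close> for the variable does.  So expanding all series of a plethysm over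
  lists instead of exponents turns its coefficients into the above sums over two-level trees.  The
  objects of \<open>X\<^sub>n\<close> are lists, and the weighted sum over all lists with a given multiset of types
  factors over the types; this makes the comultiplication multiplicative.\<close>

section \<open>Groupoids and homotopy cardinality\<close>

text \<open>Sums over objects replace sums over isomorphism classes because the automorphisms of a
  tuple depend on which of its entries are isomorphic, whereas the number of arrows leaving a tuple
  of length n is always \<open>fact n\<close> times the product of the numbers for its entries.
  Nothing is lost: a class of c objects with automorphism group of order g contributes c terms 1 /
  (c * g). The groupoids have infinitely many objects, so this needs finite strict fibres: only
  finitely many two-level trees compose to a given operation. The isomorphism sends monomials to
  basis elements without rescaling, since an operation of type (i, \<lambda>) has \<open>aut\<close>
  \<lambda> automorphisms and \<open>A_map\<close> multiplies the coefficient of the series by the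
  same number. The comultiplication of a generator of \<open>P2\<close> is a definite description,
  so a formula for it has to be complemented by uniqueness: values at pairs of series separate the
  elements of the tensor square. In that formula the grafted operations are evaluated at the inner
  series F and the root at the outer series G, which matches the faces d_2 and d_0.\<close>

definition groupoid :: "('o, 'a) grpd \<Rightarrow> bool" where
  "groupoid G \<longleftrightarrow>
     (\<forall>a\<in>Ar G. Dom G a \<in> Ob G \<and> Cod G a \<in> Ob G) \<and>
     (\<forall>x\<in>Ob G. Idn G x \<in> Ar G \<and> Dom G (Idn G x) = x \<and> Cod G (Idn G x) = x) \<and>
     (\<forall>a\<in>Ar G. \<forall>b\<in>Ar G. Dom G b = Cod G a \<longrightarrow>
        Cmp G b a \<in> Ar G \<and> Dom G (Cmp G b a) = Dom G a \<and> Cod G (Cmp G b a) = Cod G b) \<and>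
     (\<forall>a\<in>Ar G. \<forall>b\<in>Ar G. \<forall>c\<in>Ar G. Dom G b = Cod G a \<longrightarrow> Dom G c = Cod G b \<longrightarrow>
        Cmp G c (Cmp G b a) = Cmp G (Cmp G c b) a) \<and>
     (\<forall>a\<in>Ar G. Cmp G a (Idn G (Dom G a)) = a \<and> Cmp G (Idn G (Cod G a)) a = a) \<and>
     (\<forall>a\<in>Ar G. \<exists>b\<in>Ar G. Dom G b = Cod G a \<and> Cod G b = Dom G a \<and>
        Cmp G b a = Idn G (Dom G a) \<and> Cmp G a b = Idn G (Cod G a))"

text \<open>Preservation of identities is left out because it follows from that of composites when
  source and target are groupoids (\<open>functor_Idn\<close>).\<close>

definition is_functor :: "('o, 'a) grpd \<Rightarrow> ('o, 'a, 'p, 'b) fct \<Rightarrow> ('p, 'b) grpd \<Rightarrow> bool" where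
  "is_functor G F H \<longleftrightarrow>
     (\<forall>x\<in>Ob G. onOb F x \<in> Ob H) \<and>
     (\<forall>a\<in>Ar G. onAr F a \<in> Ar H \<and> Dom H (onAr F a) = onOb F (Dom G a) \<and> Cod H (onAr F a) = onOb F (Cod G a)) \<and>
     (\<forall>a\<in>Ar G. \<forall>b\<in>Ar G. Dom G b = Cod G a \<longrightarrow>
        onAr F (Cmp G b a) = Cmp H (onAr F b) (onAr F a))"

definition hom :: "('o, 'a) grpd \<Rightarrow> 'o \<Rightarrow> 'o \<Rightarrow> 'a set" where
  "hom G x y = {a \<in> Ar G. Dom G a = x \<and> Cod G a = y}"

definition outs :: "('o, 'a) grpd \<Rightarrow> 'o \<Rightarrow> 'a set" where
  "outs G x = {a \<in> Ar G. Dom G a = x}"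

text \<open>This count takes the place of the order of the automorphism group: it is that order
  times the number of objects in the isomorphism class (\<open>deg_eq\<close>).\<close>

definition deg :: "('o, 'a) grpd \<Rightarrow> 'o \<Rightarrow> nat" where
  "deg G x = card (outs G x)"

lemma groupoidD:
  assumes "groupoid G"
  shows "a \<in> Ar G \<Longrightarrow> Dom G a \<in> Ob G" "a \<in> Ar G \<Longrightarrow> Cod G a \<in> Ob G"
    and "x \<in> Ob G \<Longrightarrow> Idn G x \<in> Ar G" "x \<in> Ob G \<Longrightarrow> Dom G (Idn G x) = x" "x \<in> Ob G \<Longrightarrow> Cod G (Idn G x) = x"
    and "a \<in> Ar G \<Longrightarrow> b \<in> Ar G \<Longrightarrow> Dom G b = Cod G a \<Longrightarrow> Cmp G b a \<in> Ar G"
    and "a \<in> Ar G \<Longrightarrow> b \<in> Ar G \<Longrightarrow> Dom G b = Cod G a \<Longrightarrow> Dom G (Cmp G b a) = Dom G a"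
    and "a \<in> Ar G \<Longrightarrow> b \<in> Ar G \<Longrightarrow> Dom G b = Cod G a \<Longrightarrow> Cod G (Cmp G b a) = Cod G b"
    and "a \<in> Ar G \<Longrightarrow> b \<in> Ar G \<Longrightarrow> c \<in> Ar G \<Longrightarrow> Dom G b = Cod G a \<Longrightarrow> Dom G c = Cod G b \<Longrightarrow>
        Cmp G c (Cmp G b a) = Cmp G (Cmp G c b) a"
    and "a \<in> Ar G \<Longrightarrow> Cmp G a (Idn G (Dom G a)) = a" "a \<in> Ar G \<Longrightarrow> Cmp G (Idn G (Cod G a)) a = a"
  using assms unfolding groupoid_def by blast+

lemma groupoid_inverse:
  assumes "groupoid G" "a \<in> Ar G"
  obtains b where "b \<in> Ar G" "Dom G b = Cod G a" "Cod G b = Dom G a"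
    "Cmp G b a = Idn G (Dom G a)" "Cmp G a b = Idn G (Cod G a)"
  using assms unfolding groupoid_def by blast

lemma hom_Ob: "groupoid G \<Longrightarrow> hom G x y \<noteq> {} \<Longrightarrow> x \<in> Ob G" "groupoid G \<Longrightarrow> hom G x y \<noteq> {} \<Longrightarrow> y \<in> Ob G"
  using groupoidD(1,2)[of G] by (auto simp: hom_def)

lemma functorD:
  assumes "is_functor G F H"
  shows "x \<in> Ob G \<Longrightarrow> onOb F x \<in> Ob H" "a \<in> Ar G \<Longrightarrow> onAr F a \<in> Ar H"
    and "a \<in> Ar G \<Longrightarrow> Dom H (onAr F a) = onOb F (Dom G a)" "a \<in> Ar G \<Longrightarrow> Cod H (onAr F a) = onOb F (Cod G a)"
    and "a \<in> Ar G \<Longrightarrow> b \<in> Ar G \<Longrightarrow> Dom G b = Cod G a \<Longrightarrow> onAr F (Cmp G b a) = Cmp H (onAr F b) (onAr F a)"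
  using assms unfolding is_functor_def by blast+

text \<open>The image of an identity is idempotent, and cancelling an idempotent arrow with an
  inverse leaves an identity.\<close>

lemma functor_Idn:
  assumes G: "groupoid G" and H: "groupoid H" and F: "is_functor G F H" and x: "x \<in> Ob G"
  shows "onAr F (Idn G x) = Idn H (onOb F x)"
proof -
  let ?e = "onAr F (Idn G x)"
  note g = groupoidD[OF G] and h = groupoidD[OF H] and f = functorD[OF F]
  have e: "?e \<in> Ar H" "Dom H ?e = onOb F x" "Cod H ?e = onOb F x"
    using g f x by auto
  have idem: "Cmp H ?e ?e = ?e"
    using f(5)[of "Idn G x" "Idn G x"] g(3-5)[OF x] g(10)[of "Idn G x"] by simp
  obtain b where b: "b \<in> Ar H" "Dom H b = onOb F x" "Cod H b = onOb F x" "Cmp H b ?e = Idn H (onOb F x)"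
    using groupoid_inverse[OF H e(1)] e by metis
  have "?e = Cmp H (Cmp H b ?e) ?e" using b(4) h(11)[OF e(1)] e by simp
  also have "\<dots> = Cmp H b ?e" using h(9)[of ?e ?e b] e b idem by simp
  finally show ?thesis using b by simp
qed

lemma functor_fcomp:
  assumes "is_functor G F H" "is_functor H K L"
  shows "is_functor G (fcomp K F) L"
  using assms unfolding is_functor_def fcomp_def by simp

lemma groupoid_prodG:
  assumes G: "groupoid G" and H: "groupoid H"
  shows "groupoid (prodG G H)"
  unfolding groupoid_def prodG_def
  by (auto simp: groupoidD[OF G] groupoidD[OF H])
    (metis groupoid_inverse[OF G] groupoid_inverse[OF H])

lemma functor_fpair:
  assumes "is_functor G F H" "is_functor G K L"
  shows "is_functor G (fpair F K) (prodG H L)"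
  using assms unfolding is_functor_def fpair_def prodG_def by auto

section \<open>Hom sets and isomorphism classes\<close>

lemma hom_card:
  assumes G: "groupoid G" and c: "c \<in> hom G x y"
  shows "bij_betw (\<lambda>a. Cmp G c a) (hom G z x) (hom G z y)"
proof -
  note g = groupoidD[OF G]
  have c': "c \<in> Ar G" "Dom G c = x" "Cod G c = y" using c by (auto simp: hom_def)
  obtain b where b: "b \<in> Ar G" "Dom G b = y" "Cod G b = x" "Cmp G b c = Idn G x" "Cmp G c b = Idn G y"
    using groupoid_inverse[OF G c'(1)] c' by metis
  show ?thesis
  proof (rule bij_betw_byWitness[where f' = "\<lambda>a. Cmp G b a"])
    show "\<forall>a\<in>hom G z x. Cmp G b (Cmp G c a) = a"
      using g(9)[of _ c b] c' b g(11) by (auto simp: hom_def)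
    show "\<forall>a\<in>hom G z y. Cmp G c (Cmp G b a) = a"
      using g(9)[of _ b c] c' b g(11) by (auto simp: hom_def)
  qed (use g b c' in \<open>auto simp: hom_def\<close>)
qed

lemma hom_sym:
  assumes G: "groupoid G" and ne: "hom G x y \<noteq> {}"
  shows "hom G y x \<noteq> {}"
  using ne groupoid_inverse[OF G] by (force simp: hom_def)

lemma hom_trans:
  assumes G: "groupoid G" and "hom G x y \<noteq> {}" "hom G y z \<noteq> {}"
  shows "hom G x z \<noteq> {}"
proof -
  obtain c where "c \<in> hom G y z" using assms by blast
  from hom_card[OF G this, of x] assms(2) show ?thesis by (metis bij_betw_empty2)
qed

lemma hom_refl: "groupoid G \<Longrightarrow> x \<in> Ob G \<Longrightarrow> hom G x x \<noteq> {}"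
  using groupoidD(3-5)[of G x] by (auto simp: hom_def)

lemma Aut_eq_hom: "Aut G x = hom G x x"
  by (simp add: Aut_def hom_def)

lemma iso_class_iff: "y \<in> iso_class G x \<longleftrightarrow> y \<in> Ob G \<and> hom G x y \<noteq> {}"
  by (auto simp: iso_class_def hom_def)

text \<open>Once an arrow from x to y is fixed, composing with it on either side identifies the hom
  set with the automorphism group of each end.\<close>

lemma card_hom_eq:
  assumes G: "groupoid G" and ne: "hom G x y \<noteq> {}"
  shows "card (hom G x y) = card (Aut G x)" "card (hom G x y) = card (Aut G y)"
    "finite (hom G x y) \<longleftrightarrow> finite (Aut G x)"
proof -
  from ne obtain c where c: "c \<in> hom G x y" by blast
  from hom_sym[OF G ne] obtain d where d: "d \<in> hom G y x" by blast
  show 1: "card (hom G x y) = card (Aut G x)" "finite (hom G x y) \<longleftrightarrow> finite (Aut G x)"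
    using hom_card[OF G c, of x] by (auto simp: Aut_eq_hom bij_betw_same_card bij_betw_finite)
  note g = groupoidD[OF G]
  have c': "c \<in> Ar G" "Dom G c = x" "Cod G c = y" using c by (auto simp: hom_def)
  obtain b where b: "b \<in> Ar G" "Dom G b = y" "Cod G b = x" "Cmp G b c = Idn G x" "Cmp G c b = Idn G y"
    using groupoid_inverse[OF G c'(1)] c' by metis
  have "bij_betw (\<lambda>a. Cmp G a c) (hom G y y) (hom G x y)"
  proof (rule bij_betw_byWitness[where f' = "\<lambda>a. Cmp G a b"])
    show "\<forall>a\<in>hom G y y. Cmp G (Cmp G a c) b = a"
      using g(9)[of b c, symmetric] c' b g(10) by (auto simp: hom_def) metis
    show "\<forall>a\<in>hom G x y. Cmp G (Cmp G a b) c = a"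
      using g(9)[of c b, symmetric] c' b g(10) by (auto simp: hom_def) metis
  qed (use g b c' in \<open>auto simp: hom_def\<close>)
  then show "card (hom G x y) = card (Aut G y)" by (simp add: Aut_eq_hom bij_betw_same_card)
qed

lemma iso_class_eq:
  assumes G: "groupoid G" and "hom G x y \<noteq> {}"
  shows "iso_class G x = iso_class G y"
proof -
  have "hom G x z \<noteq> {} \<longleftrightarrow> hom G y z \<noteq> {}" for z
    using hom_trans[OF G] hom_sym[OF G] assms(2) by metis
  then show ?thesis by (intro set_eqI) (simp only: iso_class_iff)
qed

lemma rep_iso_class:
  assumes G: "groupoid G" and x: "x \<in> Ob G"
  shows "rep (iso_class G x) \<in> iso_class G x"
proof -
  have "x \<in> iso_class G x" using hom_refl[OF G x] x by (simp add: iso_class_iff)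
  then show ?thesis unfolding rep_def by (rule someI)
qed

lemma rep_pi0:
  assumes G: "groupoid G" and c: "c \<in> pi0 G"
  shows "rep c \<in> Ob G" "iso_class G (rep c) = c"
proof -
  obtain x where x: "x \<in> Ob G" "c = iso_class G x" using c by (auto simp: pi0_def)
  have "rep c \<in> iso_class G x" using rep_iso_class[OF G x(1)] x(2) by simp
  then show "rep c \<in> Ob G" "iso_class G (rep c) = c"
    using iso_class_eq[OF G, of x "rep c"] x(2) by (auto simp: iso_class_iff)
qed

lemma Aut_subset_outs: "Aut G x \<subseteq> outs G x"
  by (auto simp: Aut_def outs_def)

text \<open>Sort the arrows out of x by codomain: each object of the class receives as many of them
  as x has automorphisms.\<close>

lemma deg_eq:
  assumes G: "groupoid G" and x: "x \<in> Ob G" and fin: "finite (outs G x)"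
  shows "deg G x = card (iso_class G x) * card (Aut G x)" "finite (iso_class G x)" "0 < deg G x" "0 < card (Aut G x)"
proof -
  have "iso_class G x = Cod G ` outs G x"
    using groupoidD(2)[OF G] by (auto simp: iso_class_def outs_def)
  then show fic: "finite (iso_class G x)" using fin by simp
  have U: "outs G x = (\<Union>y\<in>iso_class G x. hom G x y)"
    using groupoidD(2)[OF G] by (auto simp: iso_class_iff outs_def hom_def)
  have "finite (hom G x y)" for y
    by (rule finite_subset[OF _ fin]) (auto simp: hom_def outs_def)
  then have "card (outs G x) = (\<Sum>y\<in>iso_class G x. card (hom G x y))"
    unfolding U using fic by (intro card_UN_disjoint) (auto simp: hom_def)
  also have "\<dots> = (\<Sum>y\<in>iso_class G x. card (Aut G x))"
    by (intro sum.cong refl) (simp add: iso_class_iff card_hom_eq[OF G])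
  finally show "deg G x = card (iso_class G x) * card (Aut G x)" by (simp add: deg_def)
  show "0 < card (Aut G x)"
    using hom_refl[OF G x] finite_subset[OF Aut_subset_outs fin] by (simp add: card_gt_0_iff Aut_eq_hom)
  moreover have "iso_class G x \<noteq> {}" using rep_iso_class[OF G x] by blast
  ultimately show "0 < deg G x"
    using \<open>deg G x = _\<close> fic by (simp add: card_gt_0_iff)
qed

lemma iso_class_in_pi0: "x \<in> Ob G \<Longrightarrow> iso_class G x \<in> pi0 G"
  by (simp add: pi0_def)

lemma mem_pi0_class:
  assumes G: "groupoid G" and c: "c \<in> pi0 G" and x: "x \<in> Ob G"
  shows "x \<in> c \<longleftrightarrow> iso_class G x = c"
proof
  assume "x \<in> c"
  then have "hom G (rep c) x \<noteq> {}" using rep_pi0[OF G c] iso_class_iff by metis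
  then show "iso_class G x = c" using iso_class_eq[OF G] rep_pi0[OF G c] by metis
next
  assume "iso_class G x = c"
  then show "x \<in> c" using hom_refl[OF G x] x iso_class_iff by metis
qed

text \<open>All objects of a class have the same degree, the size of the class times the number of
  automorphisms, so the size cancels.\<close>

lemma sum_over_classes:
  assumes G: "groupoid G" and fin: "\<And>x. x \<in> Ob G \<Longrightarrow> finite (outs G x)" and c: "c \<in> pi0 G"
  shows "(\<Sum>x | x \<in> Ob G \<and> iso_class G x = c. 1 / of_nat (deg G x)) = (1 / of_nat (card (Aut G (rep c))) :: rat)"
proof -
  let ?r = "rep c"
  note r = rep_pi0[OF G c]
  have S: "{x. x \<in> Ob G \<and> iso_class G x = c} = iso_class G ?r"
    using r mem_pi0_class[OF G c] by (auto simp: iso_class_def)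
  have d: "deg G x = card (iso_class G ?r) * card (Aut G ?r)" if "x \<in> iso_class G ?r" for x
  proof -
    from that have x: "x \<in> Ob G" "hom G ?r x \<noteq> {}" by (auto simp: iso_class_iff)
    have "card (Aut G x) = card (Aut G ?r)" using card_hom_eq[OF G x(2)] by simp
    then show ?thesis using deg_eq(1)[OF G x(1) fin[OF x(1)]] iso_class_eq[OF G x(2)] by simp
  qed
  have "?r \<in> iso_class G ?r" using r(1) hom_refl[OF G r(1)] by (simp add: iso_class_iff)
  moreover have "finite (iso_class G ?r)" using deg_eq(2)[OF G r(1) fin[OF r(1)]] .
  ultimately have "card (iso_class G ?r) \<noteq> 0" by auto
  then show ?thesis unfolding S by (simp add: d)
qed

lemma gcard_eq_sum:
  assumes G: "groupoid G" and fo: "finite (Ob G)" and fin: "\<And>x. x \<in> Ob G \<Longrightarrow> finite (outs G x)"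
  shows "gcard G = (\<Sum>x\<in>Ob G. 1 / of_nat (deg G x))" "finite_grpd G"
proof -
  have "(\<Sum>x\<in>Ob G. 1 / of_nat (deg G x)) = (\<Sum>c\<in>pi0 G. \<Sum>x | x \<in> Ob G \<and> iso_class G x = c. 1 / of_nat (deg G x) :: rat)"
    by (rule sum.group[symmetric]) (auto simp: fo pi0_def)
  also have "\<dots> = gcard G" unfolding gcard_def
    by (intro sum.cong refl sum_over_classes[OF G fin])
  finally show "gcard G = (\<Sum>x\<in>Ob G. 1 / of_nat (deg G x))" by simp
  show "finite_grpd G" unfolding finite_grpd_def
    using fo fin by (auto simp: pi0_def intro: finite_subset[OF Aut_subset_outs])
qed

subsection \<open>Homotopy fibres\<close>

lemma groupoid_hfib:
  assumes G: "groupoid G" and H: "groupoid H" and F: "is_functor G F H"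
  shows "groupoid (hfib G F H y)"
proof -
  note g = groupoidD[OF G] and h = groupoidD[OF H] and f = functorD[OF F]
  let ?K = "hfib G F H y"
  have inv: "\<exists>b\<in>Ar ?K. Dom ?K b = Cod ?K a \<and> Cod ?K b = Dom ?K a \<and>
        Cmp ?K b a = Idn ?K (Dom ?K a) \<and> Cmp ?K a b = Idn ?K (Cod ?K a)" if "a \<in> Ar ?K" for a
  proof -
    obtain k c k' where a: "a = (k, c, k')" by (cases a)
    have c: "c \<in> Ar G" "k \<in> Ar H" "k' \<in> Ar H" "Dom H k = onOb F (Dom G c)" "Dom H k' = onOb F (Cod G c)"
      "Cod H k = y" "Cod H k' = y" "Cmp H k' (onAr F c) = k"
      using that by (auto simp: a hfib_def)
    obtain b where b: "b \<in> Ar G" "Dom G b = Cod G c" "Cod G b = Dom G c"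
      "Cmp G b c = Idn G (Dom G c)" "Cmp G c b = Idn G (Cod G c)"
      by (rule groupoid_inverse[OF G c(1)])
    have "Cmp H k (onAr F b) = Cmp H k' (Cmp H (onAr F c) (onAr F b))"
      using h(9)[of "onAr F b" "onAr F c" k'] c b f by auto
    also have "\<dots> = k'"
      using f(5)[OF b(1) c(1)] b c functor_Idn[OF G H F] g(2) h(10)[OF c(3)] by simp
    finally have "(k', b, k) \<in> Ar ?K" using b c by (auto simp: hfib_def)
    then show ?thesis using b by (intro bexI[of _ "(k', b, k)"]) (auto simp: a hfib_def)
  qed
  have cmp: "Cmp ?K b a \<in> Ar ?K \<and> Dom ?K (Cmp ?K b a) = Dom ?K a \<and> Cod ?K (Cmp ?K b a) = Cod ?K b"
    if "a \<in> Ar ?K" "b \<in> Ar ?K" "Dom ?K b = Cod ?K a" for a b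
  proof -
    obtain k c k' where a: "a = (k, c, k')" by (cases a)
    obtain l d l' where b: "b = (l, d, l')" by (cases b)
    have c: "c \<in> Ar G" "k \<in> Ar H" "k' \<in> Ar H" "Dom H k = onOb F (Dom G c)" "Dom H k' = onOb F (Cod G c)"
      "Cod H k = y" "Cod H k' = y" "Cmp H k' (onAr F c) = k"
      and d: "d \<in> Ar G" "l' \<in> Ar H" "Dom H l' = onOb F (Cod G d)" "Cod H l' = y" "Cmp H l' (onAr F d) = k'"
      and m: "l = k'" "Dom G d = Cod G c"
      using that by (auto simp: a b hfib_def)
    have "Cmp H l' (onAr F (Cmp G d c)) = k"
      using f(5)[OF c(1) d(1) m(2)] h(9)[of "onAr F c" "onAr F d" l'] c d m f by auto
    then show ?thesis using c d m g by (auto simp: a b hfib_def)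
  qed
  have one: "Idn ?K x \<in> Ar ?K \<and> Dom ?K (Idn ?K x) = x \<and> Cod ?K (Idn ?K x) = x" if "x \<in> Ob ?K" for x
    using that g f functor_Idn[OF G H F] h(10)[of "snd x"] by (auto simp: hfib_def)
  have ends: "Dom ?K a \<in> Ob ?K \<and> Cod ?K a \<in> Ob ?K" if "a \<in> Ar ?K" for a
    using that g(1,2) by (auto simp: hfib_def)
  have assoc: "Cmp ?K c (Cmp ?K b a) = Cmp ?K (Cmp ?K c b) a"
    if "a \<in> Ar ?K" "b \<in> Ar ?K" "c \<in> Ar ?K" "Dom ?K b = Cod ?K a" "Dom ?K c = Cod ?K b" for a b c
    using that g(9) by (auto simp: hfib_def)
  have units: "Cmp ?K a (Idn ?K (Dom ?K a)) = a \<and> Cmp ?K (Idn ?K (Cod ?K a)) a = a" if "a \<in> Ar ?K" for a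
    using that g(10,11) by (auto simp: hfib_def)
  show ?thesis unfolding groupoid_def
    by (intro conjI ballI impI; (rule inv, assumption)?) (simp_all only: cmp one ends assoc units)
qed

lemma functor_hfib_proj: "is_functor (hfib G F H y) hfib_proj G"
  if "groupoid G" "groupoid H" "is_functor G F H"
  unfolding is_functor_def hfib_def hfib_proj_def by auto

text \<open>An arrow a out of x lifts uniquely to the object (x, k): the structure arrow at its
  other end has to be k composed with the inverse of F a. Right cancellation in H gives the
  uniqueness.\<close>

lemma outs_hfib:
  assumes G: "groupoid G" and H: "groupoid H" and F: "is_functor G F H" and p: "(x, k) \<in> Ob (hfib G F H y)"
  shows "bij_betw (\<lambda>(h, a, h'). a) (outs (hfib G F H y) (x, k)) (outs G x)"
proof (rule bij_betwI')
  note g = groupoidD[OF G] and h = groupoidD[OF H] and f = functorD[OF F]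
  have k: "x \<in> Ob G" "k \<in> Ar H" "Dom H k = onOb F x" "Cod H k = y" using p by (auto simp: hfib_def)
  have right_cancel: "l = l'"
    if *: "c \<in> Ar H" "l \<in> Ar H" "l' \<in> Ar H" "Dom H l = Cod H c" "Dom H l' = Cod H c" "Cmp H l c = Cmp H l' c" for c l l'
  proof -
    obtain b where b: "b \<in> Ar H" "Dom H b = Cod H c" "Cod H b = Dom H c" "Cmp H c b = Idn H (Cod H c)"
      using groupoid_inverse[OF H *(1)] by metis
    have "l = Cmp H (Cmp H l c) b" using h(9)[of b c l] that b h(10)[of l] by simp
    also have "\<dots> = l'" using h(9)[of b c l'] that b h(10)[of l'] by simp
    finally show ?thesis .
  qed
  show "((\<lambda>(h, a, h'). a) u = (\<lambda>(h, a, h'). a) v) = (u = v)"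
    if "u \<in> outs (hfib G F H y) (x, k)" "v \<in> outs (hfib G F H y) (x, k)" for u v
    using that right_cancel f by (auto simp: outs_def hfib_def) metis
  show "(\<lambda>(h, a, h'). a) u \<in> outs G x" if "u \<in> outs (hfib G F H y) (x, k)" for u
    using that by (auto simp: outs_def hfib_def)
  fix a assume "a \<in> outs G x"
  then have a: "a \<in> Ar G" "Dom G a = x" by (auto simp: outs_def)
  obtain b where b: "b \<in> Ar G" "Dom G b = Cod G a" "Cod G b = Dom G a" "Cmp G b a = Idn G (Dom G a)"
    by (rule groupoid_inverse[OF G a(1)])
  let ?l = "Cmp H k (onAr F b)"
  have l: "?l \<in> Ar H" "Dom H ?l = onOb F (Cod G a)" "Cod H ?l = y" using k a b f h by auto
  have "Cmp H ?l (onAr F a) = Cmp H k (onAr F (Cmp G b a))"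
    using h(9)[of "onAr F a" "onAr F b" k] k a b f(2-4) f(5)[OF a(1) b(1) b(2), symmetric] by simp
  also have "\<dots> = k" using functor_Idn[OF G H F] a b k h(10)[of k] by simp
  finally have "(k, a, ?l) \<in> outs (hfib G F H y) (x, k)" using a k l by (auto simp: outs_def hfib_def)
  then show "\<exists>u\<in>outs (hfib G F H y) (x, k). a = (\<lambda>(h, a, h'). a) u" by force
qed

lemma deg_hfib:
  assumes "groupoid G" "groupoid H" "is_functor G F H" "(x, k) \<in> Ob (hfib G F H y)"
  shows "deg (hfib G F H y) (x, k) = deg G x"
    "finite (outs (hfib G F H y) (x, k)) \<longleftrightarrow> finite (outs G x)"
  using outs_hfib[OF assms] by (auto simp: deg_def bij_betw_same_card bij_betw_finite)

lemma Ob_hfib: "Ob (hfib G F H y) = (SIGMA x:Ob G. hom H (onOb F x) y)"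
  by (auto simp: hfib_def hom_def)

lemma finite_ins:
  assumes G: "groupoid G" and y: "y \<in> Ob G" and fin: "\<And>x. x \<in> Ob G \<Longrightarrow> finite (outs G x)"
  shows "finite {x \<in> Ob G. hom G x y \<noteq> {}}" "finite (hom G x y)"
proof -
  show "finite {x \<in> Ob G. hom G x y \<noteq> {}}"
    by (intro finite_subset[OF _ deg_eq(2)[OF G y fin[OF y]]] subsetI)
      (use hom_sym[OF G] in \<open>simp add: iso_class_iff\<close>)
  show "finite (hom G x y)"
  proof (cases "x \<in> Ob G")
    case True
    then show ?thesis by (intro finite_subset[OF _ fin[OF True]]) (auto simp: hom_def outs_def)
  next
    case False
    then have "hom G x y = {}" using groupoidD(1)[OF G] by (auto simp: hom_def)
    then show ?thesis by simp
  qed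
qed

text \<open>The class of y is finite because y has finitely many outgoing arrows. An object of the
  fibre lies over one of its members, so finiteness of each strict fibre of F suffices.\<close>

lemma finite_Ob_hfib:
  assumes G: "groupoid G" and H: "groupoid H" and F: "is_functor G F H" and y: "y \<in> Ob H"
    and fH: "\<And>x. x \<in> Ob H \<Longrightarrow> finite (outs H x)"
    and fF: "\<And>z. z \<in> Ob H \<Longrightarrow> finite {x \<in> Ob G. onOb F x = z}"
  shows "finite (Ob (hfib G F H y))"
proof -
  have "Ob (hfib G F H y) \<subseteq>
      (SIGMA x:(\<Union>z\<in>{z \<in> Ob H. hom H z y \<noteq> {}}. {x \<in> Ob G. onOb F x = z}). hom H (onOb F x) y)"
    using functorD(1)[OF F] by (auto simp: Ob_hfib)
  moreover have "finite \<dots>"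
    using finite_ins[OF H y fH] fF by (intro finite_SigmaI finite_UN_I) auto
  ultimately show ?thesis by (rule finite_subset)
qed

text \<open>Each x with F x isomorphic to y occurs in the fibre once for every arrow from F x to y,
  that is, as often as y has automorphisms, and always with the degree it has in G.\<close>

lemma finite_grpd_hfib:
  assumes G: "groupoid G" and H: "groupoid H" and F: "is_functor G F H" and y: "y \<in> Ob H"
    and fG: "\<And>x. x \<in> Ob G \<Longrightarrow> finite (outs G x)"
    and fH: "\<And>x. x \<in> Ob H \<Longrightarrow> finite (outs H x)"
    and fF: "\<And>z. z \<in> Ob H \<Longrightarrow> finite {x \<in> Ob G. onOb F x = z}"
  shows "finite_grpd (hfib G F H y)"
    "gcard (hfib G F H y) = (\<Sum>x | x \<in> Ob G \<and> hom H (onOb F x) y \<noteq> {}. of_nat (card (Aut H y)) / of_nat (deg G x))"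
proof -
  let ?K = "hfib G F H y"
  note fO = finite_Ob_hfib[OF G H F y fH fF]
  have fo: "finite (outs ?K u)" if "u \<in> Ob ?K" for u
    using that deg_hfib(2)[OF G H F, of "fst u" "snd u" y] fG by (auto simp: Ob_hfib)
  show "finite_grpd ?K" using gcard_eq_sum(2)[OF groupoid_hfib[OF G H F] fO fo] .
  let ?S = "{x. x \<in> Ob G \<and> hom H (onOb F x) y \<noteq> {}}"
  have fS: "finite ?S"
    by (rule finite_subset[OF _ finite_imageI[OF fO, of fst]]) (force simp: Ob_hfib)
  have K: "Ob ?K = (SIGMA x:?S. hom H (onOb F x) y)" by (auto simp: Ob_hfib)
  have "gcard ?K = (\<Sum>u\<in>Ob ?K. 1 / of_nat (deg ?K u))"
    using gcard_eq_sum(1)[OF groupoid_hfib[OF G H F] fO fo] .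
  also have "\<dots> = (\<Sum>(x, k)\<in>Ob ?K. 1 / of_nat (deg G x))"
    by (intro sum.cong refl) (auto simp: deg_hfib[OF G H F])
  also have "\<dots> = (\<Sum>x\<in>?S. \<Sum>k\<in>hom H (onOb F x) y. 1 / of_nat (deg G x))"
    unfolding K using fS finite_ins(2)[OF H y fH] by (intro sum.Sigma[symmetric]) auto
  also have "\<dots> = (\<Sum>x\<in>?S. of_nat (card (Aut H y)) / of_nat (deg G x))"
    by (intro sum.cong refl) (simp add: card_hom_eq(2)[OF H])
  finally show "gcard ?K = \<dots>" .
qed

text \<open>Both fibre formations keep the degree of the underlying object of X, and they repeat it
  once for every arrow to y and to z respectively. The inner fibre already has finitely many
  objects, so E needs no finiteness of its own.\<close>

lemma gcard_double_hfib:
  assumes X: "groupoid X" and H: "groupoid H" and L: "groupoid L"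
    and D: "is_functor X D H" and E: "is_functor X E L" and y: "y \<in> Ob H" and z: "z \<in> Ob L"
    and fX: "\<And>x. x \<in> Ob X \<Longrightarrow> finite (outs X x)"
    and fH: "\<And>x. x \<in> Ob H \<Longrightarrow> finite (outs H x)"
    and fL: "\<And>x. x \<in> Ob L \<Longrightarrow> finite (outs L x)"
    and fD: "\<And>z. z \<in> Ob H \<Longrightarrow> finite {x \<in> Ob X. onOb D x = z}"
  shows "gcard (hfib (hfib X D H y) (fcomp E hfib_proj) L z) =
     of_nat (card (Aut H y)) * of_nat (card (Aut L z)) *
     (\<Sum>x | x \<in> Ob X \<and> hom H (onOb D x) y \<noteq> {} \<and> hom L (onOb E x) z \<noteq> {}. 1 / of_nat (deg X x))"
proof -
  let ?K = "hfib X D H y"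
  note fO = finite_Ob_hfib[OF X H D y fH fD]
  have fo: "finite (outs ?K u)" if "u \<in> Ob ?K" for u
    using that deg_hfib(2)[OF X H D, of "fst u" "snd u" y] fX by (auto simp: Ob_hfib)
  note F = functor_fcomp[OF functor_hfib_proj[OF X H D, of y] E]
  let ?S = "{x. x \<in> Ob X \<and> hom H (onOb D x) y \<noteq> {} \<and> hom L (onOb E x) z \<noteq> {}}"
  have fS: "finite ?S"
    by (rule finite_subset[OF _ finite_imageI[OF fO, of fst]]) (force simp: Ob_hfib)
  have "gcard (hfib ?K (fcomp E hfib_proj) L z) =
      (\<Sum>u | u \<in> Ob ?K \<and> hom L (onOb (fcomp E hfib_proj) u) z \<noteq> {}. of_nat (card (Aut L z)) / of_nat (deg ?K u))"
    using fO by (intro finite_grpd_hfib(2)[OF groupoid_hfib[OF X H D] L F z fo fL]) auto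
  also have "\<dots> = (\<Sum>(x, k)\<in>(SIGMA x:?S. hom H (onOb D x) y). of_nat (card (Aut L z)) / of_nat (deg X x))"
    by (intro sum.cong) (auto simp: Ob_hfib fcomp_def hfib_proj_def deg_hfib[OF X H D])
  also have "\<dots> = (\<Sum>x\<in>?S. \<Sum>k\<in>hom H (onOb D x) y. of_nat (card (Aut L z)) / of_nat (deg X x))"
    using fS finite_ins(2)[OF H y fH] by (intro sum.Sigma[symmetric]) auto
  also have "\<dots> = (\<Sum>x\<in>?S. of_nat (card (Aut H y)) * of_nat (card (Aut L z)) * (1 / of_nat (deg X x)))"
    by (intro sum.cong refl) (simp add: card_hom_eq(2)[OF H])
  finally show ?thesis by (simp add: sum_distrib_left)
qed

section \<open>Closure properties of groupoids and functors\<close>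

lemma groupoid_discrete: "groupoid (discrete K)"
  by (auto simp: groupoid_def discrete_def)

lemma groupoid_fullsub:
  assumes G: "groupoid G"
  shows "groupoid (fullsub G P)"
proof -
  note g = groupoidD[OF G]
  have inv: "\<exists>b\<in>Ar (fullsub G P). Dom (fullsub G P) b = Cod (fullsub G P) a \<and> Cod (fullsub G P) b = Dom (fullsub G P) a \<and>
        Cmp (fullsub G P) b a = Idn (fullsub G P) (Dom (fullsub G P) a) \<and>
        Cmp (fullsub G P) a b = Idn (fullsub G P) (Cod (fullsub G P) a)" if "a \<in> Ar (fullsub G P)" for a
  proof -
    from that have a: "a \<in> Ar G" "P (Dom G a)" "P (Cod G a)" by (auto simp: fullsub_def)
    obtain b where "b \<in> Ar G" "Dom G b = Cod G a" "Cod G b = Dom G a"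
      "Cmp G b a = Idn G (Dom G a)" "Cmp G a b = Idn G (Cod G a)"
      by (rule groupoid_inverse[OF G a(1)])
    then show ?thesis using a by (intro bexI[of _ b]) (auto simp: fullsub_def)
  qed
  show ?thesis unfolding groupoid_def
    by (intro conjI ballI impI; (rule inv, assumption)?) (use g in \<open>auto simp: fullsub_def\<close>)
qed

lemma groupoid_relabel:
  assumes G: "groupoid G" and i: "\<And>x. i' (i x) = x" and j: "\<And>a. j' (j a) = a"
  shows "groupoid (relabel i i' j j' G)"
proof -
  note g = groupoidD[OF G]
  let ?K = "relabel i i' j j' G"
  have inj: "i x = i y \<longleftrightarrow> x = y" for x y using i by metis
  have inv: "\<exists>b\<in>Ar ?K. Dom ?K b = Cod ?K a \<and> Cod ?K b = Dom ?K a \<and>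
        Cmp ?K b a = Idn ?K (Dom ?K a) \<and> Cmp ?K a b = Idn ?K (Cod ?K a)" if "a \<in> Ar ?K" for a
  proof -
    from that obtain c where c: "a = j c" "c \<in> Ar G" by (auto simp: relabel_def)
    obtain b where "b \<in> Ar G" "Dom G b = Cod G c" "Cod G b = Dom G c"
      "Cmp G b c = Idn G (Dom G c)" "Cmp G c b = Idn G (Cod G c)"
      by (rule groupoid_inverse[OF G c(2)])
    then show ?thesis by (intro bexI[of _ "j b"]) (auto simp: relabel_def i j c)
  qed
  show ?thesis unfolding groupoid_def
    by (intro conjI ballI impI; (rule inv, assumption)?) (use g in \<open>auto simp: relabel_def i j inj\<close>)
qed

text \<open>The componentwise inverse of an arrow stays in the pullback: its two images invert the
  same arrow of L, and inverses in L are unique.\<close>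

lemma groupoid_pullback:
  assumes G: "groupoid G" and H: "groupoid H" and L: "groupoid L"
    and F: "is_functor G F L" and K: "is_functor H K L"
  shows "groupoid (pullback G F H K)"
proof -
  note g = groupoidD[OF G] and h = groupoidD[OF H] and l = groupoidD[OF L]
    and f = functorD[OF F] and k = functorD[OF K]
  let ?P = "pullback G F H K"
  have inv_unique: "u = v" if "c \<in> Ar L" "u \<in> Ar L" "v \<in> Ar L" "Dom L u = Cod L c" "Dom L v = Cod L c"
    "Cod L u = Dom L c" "Cod L v = Dom L c" "Cmp L u c = Idn L (Dom L c)" "Cmp L c v = Idn L (Cod L c)" for c u v
    using l(9)[of v c u] l(10)[of u] l(11)[of v] that by simp
  have inv: "\<exists>b\<in>Ar ?P. Dom ?P b = Cod ?P a \<and> Cod ?P b = Dom ?P a \<and>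
        Cmp ?P b a = Idn ?P (Dom ?P a) \<and> Cmp ?P a b = Idn ?P (Cod ?P a)" if "a \<in> Ar ?P" for a
  proof -
    from that obtain a1 a2 where a: "a = (a1, a2)" "a1 \<in> Ar G" "a2 \<in> Ar H" "onAr F a1 = onAr K a2"
      by (auto simp: pullback_def)
    obtain b1 where b1: "b1 \<in> Ar G" "Dom G b1 = Cod G a1" "Cod G b1 = Dom G a1"
      "Cmp G b1 a1 = Idn G (Dom G a1)" "Cmp G a1 b1 = Idn G (Cod G a1)"
      by (rule groupoid_inverse[OF G a(2)])
    obtain b2 where b2: "b2 \<in> Ar H" "Dom H b2 = Cod H a2" "Cod H b2 = Dom H a2"
      "Cmp H b2 a2 = Idn H (Dom H a2)" "Cmp H a2 b2 = Idn H (Cod H a2)"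
      by (rule groupoid_inverse[OF H a(3)])
    have "Cmp L (onAr F b1) (onAr F a1) = Idn L (Dom L (onAr F a1))"
      using f(5)[OF a(2) b1(1) b1(2)] b1(4) functor_Idn[OF G L F g(1)[OF a(2)]] f(3)[OF a(2)] by simp
    moreover have "Cmp L (onAr K a2) (onAr K b2) = Idn L (Cod L (onAr K a2))"
      using k(5)[OF b2(1) a(3) b2(3)[symmetric]] b2(5) functor_Idn[OF H L K h(2)[OF a(3)]] k(4)[OF a(3)] by simp
    moreover have "onOb F (Dom G a1) = onOb K (Dom H a2)" "onOb F (Cod G a1) = onOb K (Cod H a2)"
      using f(3,4)[OF a(2)] k(3,4)[OF a(3)] a(4) by simp_all
    ultimately have "onAr F b1 = onAr K b2"
      using inv_unique[of "onAr F a1" "onAr F b1" "onAr K b2"] a(2-4) b1(1-3) b2(1-3)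
      by (simp add: f(2-4) k(2-4))
    then show ?thesis using a b1 b2 by (intro bexI[of _ "(b1, b2)"]) (auto simp: pullback_def prodG_def)
  qed
  have ends: "onOb F (Dom G a) = onOb K (Dom H b)" "onOb F (Cod G a) = onOb K (Cod H b)"
    if "a \<in> Ar G" "b \<in> Ar H" "onAr F a = onAr K b" for a b
    using f(3,4)[OF that(1)] k(3,4)[OF that(2)] that(3) by simp_all
  have unit: "onAr F (Idn G x) = onAr K (Idn H y)" if "x \<in> Ob G" "y \<in> Ob H" "onOb F x = onOb K y" for x y
    using functor_Idn[OF G L F that(1)] functor_Idn[OF H L K that(2)] that(3) by simp
  have cmp: "onAr F (Cmp G b a) = onAr K (Cmp H b' a')"
    if "a \<in> Ar G" "b \<in> Ar G" "Dom G b = Cod G a" "a' \<in> Ar H" "b' \<in> Ar H" "Dom H b' = Cod H a'"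
      "onAr F a = onAr K a'" "onAr F b = onAr K b'" for a a' b b'
    using f(5)[OF that(1-3)] k(5)[OF that(4-6)] that(7,8) by simp
  show ?thesis unfolding groupoid_def
    by (intro conjI ballI impI; (rule inv, assumption)?)
      (use ends unit cmp in \<open>auto simp: pullback_def prodG_def g h\<close>)
qed

section \<open>Complete isomorphism invariants\<close>

text \<open>With such an invariant, conditions on isomorphism classes become equations between
  values.\<close>

definition classifies :: "('o, 'a) grpd \<Rightarrow> ('o \<Rightarrow> 't) \<Rightarrow> bool" where
  "classifies G ty \<longleftrightarrow> (\<forall>x\<in>Ob G. \<forall>y\<in>Ob G. hom G x y \<noteq> {} \<longleftrightarrow> ty x = ty y)"

lemma classifiesD: "classifies G ty \<Longrightarrow> x \<in> Ob G \<Longrightarrow> y \<in> Ob G \<Longrightarrow> hom G x y \<noteq> {} \<longleftrightarrow> ty x = ty y"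
  by (simp add: classifies_def)

lemma classifies_cong:
  assumes "classifies G ty" "\<And>x y. x \<in> Ob G \<Longrightarrow> y \<in> Ob G \<Longrightarrow> ty x = ty y \<longleftrightarrow> ty' x = ty' y"
  shows "classifies G ty'"
  using assms by (simp add: classifies_def)

lemma hom_discrete: "hom (discrete K) x y = (if x = y \<and> x \<in> K then {x} else {})"
  by (auto simp: hom_def discrete_def)

lemma outs_discrete: "x \<in> K \<Longrightarrow> outs (discrete K) x = {x}"
  by (auto simp: outs_def discrete_def)

lemma classifies_discrete: "classifies (discrete K) id"
  unfolding classifies_def hom_discrete by (simp add: discrete_def)

lemma hom_prodG: "hom (prodG G H) x y = hom G (fst x) (fst y) \<times> hom H (snd x) (snd y)"
  by (cases x; cases y) (auto simp: hom_def prodG_def)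

lemma outs_prodG: "outs (prodG G H) x = outs G (fst x) \<times> outs H (snd x)"
  by (cases x) (auto simp: outs_def prodG_def)

lemma hom_fullsub: "P x \<Longrightarrow> P y \<Longrightarrow> hom (fullsub G P) x y = hom G x y"
  by (auto simp: hom_def fullsub_def)

text \<open>If the predicate also holds at every object reached from x, restriction to the
  subgroupoid loses no arrow out of x.\<close>

lemma outs_fullsub: "P x \<Longrightarrow> (\<And>y. hom G x y \<noteq> {} \<Longrightarrow> P y) \<Longrightarrow> outs (fullsub G P) x = outs G x"
  by (auto simp: outs_def hom_def fullsub_def)

lemma hom_relabel:
  assumes i: "\<And>x. i' (i x) = x" and j: "\<And>a. j' (j a) = a"
  shows "hom (relabel i i' j j' G) (i x) (i y) = j ` hom G x y"
proof -
  have inj: "i x = i y \<longleftrightarrow> x = y" for x y using i by metis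
  show ?thesis by (auto simp: hom_def relabel_def i j inj)
qed

lemma outs_relabel:
  assumes i: "\<And>x. i' (i x) = x" and j: "\<And>a. j' (j a) = a"
  shows "outs (relabel i i' j j' G) (i x) = j ` outs G x"
proof -
  have inj: "i x = i y \<longleftrightarrow> x = y" for x y using i by metis
  show ?thesis by (auto simp: outs_def relabel_def i j inj)
qed

section \<open>The groupoid of tuples\<close>

definition perm_ok :: "(nat \<times> 'a) list \<Rightarrow> bool" where
  "perm_ok f \<longleftrightarrow> distinct (map fst f) \<and> fst ` set f = {..<length f}"

text \<open>A list of length n whose entries take n values has no repetition.\<close>

lemma perm_okI:
  assumes "fst ` set f = {..<length f}"
  shows "perm_ok f"
  using assms by (simp add: perm_ok_def card_distinct)

lemma perm_ok_less: "perm_ok f \<Longrightarrow> i < length f \<Longrightarrow> fst (f ! i) < length f"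
  unfolding perm_ok_def using nth_mem[of i f] by (metis imageI lessThan_iff)

lemma perm_ok_surj: "perm_ok f \<Longrightarrow> p < length f \<Longrightarrow> \<exists>i<length f. fst (f ! i) = p"
  unfolding perm_ok_def by (metis (no_types, lifting) imageE in_set_conv_nth lessThan_iff)

lemma perm_ok_inj: "perm_ok f \<Longrightarrow> i < length f \<Longrightarrow> j < length f \<Longrightarrow> fst (f ! i) = fst (f ! j) \<Longrightarrow> i = j"
  unfolding perm_ok_def using nth_eq_iff_index_eq[of "map fst f" i j] by simp

lemma perm_ok_bij: "perm_ok f \<Longrightarrow> bij_betw (\<lambda>i. fst (f ! i)) {..<length f} {..<length f}"
  unfolding bij_betw_def inj_on_def using perm_ok_inj[of f] perm_ok_less[of f] perm_ok_surj[of f]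
  by (fastforce simp: image_iff)

lemma perm_ok_mset: "perm_ok f \<Longrightarrow> mset (map fst f) = mset [0..<length f]"
  unfolding perm_ok_def by (metis atLeast0LessThan distinct_upt list.set_map set_eq_iff_mset_eq_distinct set_upt)

lemma component_nth: "perm_ok f \<Longrightarrow> i < length f \<Longrightarrow> component f (fst (f ! i)) = snd (f ! i)"
  unfolding component_def perm_ok_def using nth_mem[of i f]
  by (metis map_of_is_SomeI option.sel prod.collapse)

text \<open>Domains of arrows of \<open>Sr G\<close> are indexed by source positions, while the
  arrows are listed by target positions. The permutation reaches every source position, so equality
  can be tested along it.\<close>

lemma perm_eqI:
  assumes "perm_ok f" "length xs = length f" "length ys = length f"
    "\<And>i. i < length f \<Longrightarrow> xs ! fst (f ! i) = ys ! fst (f ! i)"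
  shows "xs = ys"
  using assms(2-4) perm_ok_surj[OF assms(1)] by (intro nth_equalityI) (simp, metis)

lemma Ar_Sr: "f \<in> Ar (Sr G) \<longleftrightarrow> f \<noteq> [] \<and> perm_ok f \<and> (\<forall>i<length f. snd (f ! i) \<in> Ar G)"
  by (auto simp: Sr_def perm_ok_def all_set_conv_all_nth image_subset_iff)

lemma Ob_Sr: "Ob (Sr G) = {xs. xs \<noteq> [] \<and> set xs \<subseteq> Ob G}"
  by (simp add: Sr_def)

lemma length_Dom_Sr [simp]: "length (Dom (Sr G) f) = length f"
  and length_Cod_Sr [simp]: "length (Cod (Sr G) f) = length f"
  and length_Cmp_Sr [simp]: "length (Cmp (Sr G) g f) = length g"
  and length_Idn_Sr [simp]: "length (Idn (Sr G) xs) = length xs"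
  by (simp_all add: Sr_def)

lemma nth_Dom_Sr: "perm_ok f \<Longrightarrow> i < length f \<Longrightarrow> Dom (Sr G) f ! fst (f ! i) = Dom G (snd (f ! i))"
  using perm_ok_less[of f i] by (simp add: Sr_def component_nth)

lemma nth_Cod_Sr: "i < length f \<Longrightarrow> Cod (Sr G) f ! i = Cod G (snd (f ! i))"
  by (simp add: Sr_def case_prod_unfold)

lemma nth_Cmp_Sr: "i < length g \<Longrightarrow>
    Cmp (Sr G) g f ! i = (fst (f ! fst (g ! i)), Cmp G (snd (g ! i)) (snd (f ! fst (g ! i))))"
  by (simp add: Sr_def case_prod_unfold)

lemma nth_Idn_Sr: "i < length xs \<Longrightarrow> Idn (Sr G) xs ! i = (i, Idn G (xs ! i))"
  by (simp add: Sr_def)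

lemma Dom_Sr_eqI:
  assumes "perm_ok f" "length xs = length f" "\<And>i. i < length f \<Longrightarrow> xs ! fst (f ! i) = Dom G (snd (f ! i))"
  shows "Dom (Sr G) f = xs"
  using assms by (intro perm_eqI[OF assms(1)]) (simp_all add: nth_Dom_Sr)

lemma Cod_Sr_eqI:
  assumes "length xs = length f" "\<And>i. i < length f \<Longrightarrow> xs ! i = Cod G (snd (f ! i))"
  shows "Cod (Sr G) f = xs"
  using assms by (intro nth_equalityI) (simp_all add: nth_Cod_Sr)

lemma Sr_composable:
  assumes g: "g \<in> Ar (Sr G)" and f: "f \<in> Ar (Sr G)" and d: "Dom (Sr G) g = Cod (Sr G) f"
  shows "length g = length f"
    and "i < length g \<Longrightarrow> fst (g ! i) < length f"
    and "i < length g \<Longrightarrow> Dom G (snd (g ! i)) = Cod G (snd (f ! fst (g ! i)))"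
proof -
  show l: "length g = length f" using arg_cong[OF d, of length] by simp
  show less: "fst (g ! i) < length f" if "i < length g" for i
    using perm_ok_less[of g i] that g l by (simp add: Ar_Sr)
  show "Dom G (snd (g ! i)) = Cod G (snd (f ! fst (g ! i)))" if "i < length g" for i
    using nth_Dom_Sr[of g i G] nth_Cod_Sr[of "fst (g ! i)" f G] g d less[OF that] that by (simp add: Ar_Sr)
qed

lemma perm_ok_Cmp:
  assumes g: "perm_ok g" and f: "perm_ok f" and l: "length g = length f"
  shows "perm_ok (Cmp (Sr G) g f)"
proof (rule perm_okI, intro set_eqI iffI)
  fix p assume "p \<in> fst ` set (Cmp (Sr G) g f)"
  then obtain i where "i < length g" "p = fst (f ! fst (g ! i))"
    by (auto simp: in_set_conv_nth nth_Cmp_Sr)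
  then show "p \<in> {..<length (Cmp (Sr G) g f)}"
    using perm_ok_less[OF g, of i] perm_ok_less[OF f, of "fst (g ! i)"] l by simp
next
  fix p assume "p \<in> {..<length (Cmp (Sr G) g f)}"
  then obtain k where k: "k < length f" "fst (f ! k) = p" using perm_ok_surj[OF f, of p] l by auto
  then obtain i where i: "i < length g" "fst (g ! i) = k" using perm_ok_surj[OF g, of k] l by auto
  then have "p = fst (Cmp (Sr G) g f ! i)" using k by (simp add: nth_Cmp_Sr)
  then show "p \<in> fst ` set (Cmp (Sr G) g f)" using i by (metis imageI length_Cmp_Sr nth_mem)
qed

lemma groupoid_Sr:
  assumes G: "groupoid G"
  shows "groupoid (Sr G)"
proof -
  note g = groupoidD[OF G]
  let ?S = "Sr G"
  have ends: "Dom ?S a \<in> Ob ?S \<and> Cod ?S a \<in> Ob ?S" if a: "a \<in> Ar ?S" for a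
  proof -
    have "Dom ?S a ! p \<in> Ob G" if "p < length a" for p
      using perm_ok_surj[of a p] a that g(1) nth_Dom_Sr[of a _ G] by (auto simp: Ar_Sr)
    moreover have "Cod ?S a ! p \<in> Ob G" if "p < length a" for p
      using a that g(2) nth_Cod_Sr[of p a G] by (auto simp: Ar_Sr)
    moreover have "Dom ?S a \<noteq> []" "Cod ?S a \<noteq> []"
      using a length_Dom_Sr[of G a] length_Cod_Sr[of G a] by (auto simp: Ar_Sr simp del: length_Dom_Sr length_Cod_Sr)
    ultimately show ?thesis unfolding Ob_Sr by (auto simp: in_set_conv_nth)
  qed
  have Ob: "xs \<noteq> [] \<and> (\<forall>i<length xs. xs ! i \<in> Ob G)" if "xs \<in> Ob ?S" for xs
    using that by (auto simp: Sr_def)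
  have one: "Idn ?S xs \<in> Ar ?S \<and> Dom ?S (Idn ?S xs) = xs \<and> Cod ?S (Idn ?S xs) = xs" if "xs \<in> Ob ?S" for xs
  proof -
    have "map fst (Idn ?S xs) = [0..<length xs]" by (simp add: Sr_def)
    then have "fst ` set (Idn ?S xs) = {..<length xs}" by (metis atLeast0LessThan list.set_map set_upt)
    then have p: "perm_ok (Idn ?S xs)" by (intro perm_okI) simp
    have "Idn ?S xs \<noteq> []" using Ob[OF that] length_Idn_Sr[of G xs] by (auto simp del: length_Idn_Sr)
    then have "Idn ?S xs \<in> Ar ?S" using p Ob[OF that] g by (simp add: Ar_Sr nth_Idn_Sr)
    then show ?thesis using p Ob[OF that] g
      by (auto intro!: Dom_Sr_eqI Cod_Sr_eqI simp: nth_Idn_Sr)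
  qed
  have cmp: "Cmp ?S b a \<in> Ar ?S \<and> Dom ?S (Cmp ?S b a) = Dom ?S a \<and> Cod ?S (Cmp ?S b a) = Cod ?S b"
    if a: "a \<in> Ar ?S" and b: "b \<in> Ar ?S" and d: "Dom ?S b = Cod ?S a" for a b
  proof -
    note c = Sr_composable[OF b a d]
    have p: "perm_ok (Cmp ?S b a)" using a b c by (intro perm_ok_Cmp) (auto simp: Ar_Sr)
    have "Cmp ?S b a \<noteq> []" using b length_Cmp_Sr[of G b a] by (auto simp: Ar_Sr simp del: length_Cmp_Sr)
    then have 1: "Cmp ?S b a \<in> Ar ?S" using p a b c g by (auto simp: Ar_Sr nth_Cmp_Sr)
    have 2: "Dom ?S (Cmp ?S b a) = Dom ?S a"
      using p a b c g by (intro Dom_Sr_eqI) (auto simp: Ar_Sr nth_Cmp_Sr nth_Dom_Sr)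
    have 3: "Cod ?S (Cmp ?S b a) = Cod ?S b"
      using p a b c g by (intro Cod_Sr_eqI) (auto simp: Ar_Sr nth_Cmp_Sr nth_Cod_Sr)
    show ?thesis using 1 2 3 by simp
  qed
  have assoc: "Cmp ?S c (Cmp ?S b a) = Cmp ?S (Cmp ?S c b) a"
    if "a \<in> Ar ?S" "b \<in> Ar ?S" "c \<in> Ar ?S" "Dom ?S b = Cod ?S a" "Dom ?S c = Cod ?S b" for a b c
    using Sr_composable[OF that(2,1,4)] Sr_composable[OF that(3,2,5)] that g(9)
    by (intro nth_equalityI) (auto simp: nth_Cmp_Sr Ar_Sr)
  have units: "Cmp ?S a (Idn ?S (Dom ?S a)) = a \<and> Cmp ?S (Idn ?S (Cod ?S a)) a = a" if "a \<in> Ar ?S" for a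
    using that perm_ok_less[of a] g(10,11)
    by (auto intro!: nth_equalityI simp: nth_Cmp_Sr Ar_Sr nth_Idn_Sr nth_Dom_Sr nth_Cod_Sr)
  have inv: "\<exists>b\<in>Ar ?S. Dom ?S b = Cod ?S a \<and> Cod ?S b = Dom ?S a \<and>
        Cmp ?S b a = Idn ?S (Dom ?S a) \<and> Cmp ?S a b = Idn ?S (Cod ?S a)" if a: "a \<in> Ar ?S" for a
  proof -
    have pa: "perm_ok a" using a by (simp add: Ar_Sr)
    obtain q where q: "\<And>p. p < length a \<Longrightarrow> q p < length a \<and> fst (a ! q p) = p"
      using perm_ok_surj[OF pa] by metis
    have q2: "q (fst (a ! i)) = i" if "i < length a" for i
      using q[OF perm_ok_less[OF pa that]] perm_ok_inj[OF pa] that by blast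
    have "\<forall>i<length a. \<exists>b. b \<in> Ar G \<and> Dom G b = Cod G (snd (a ! i)) \<and> Cod G b = Dom G (snd (a ! i)) \<and>
        Cmp G b (snd (a ! i)) = Idn G (Dom G (snd (a ! i))) \<and> Cmp G (snd (a ! i)) b = Idn G (Cod G (snd (a ! i)))"
      using a groupoid_inverse[OF G] by (metis Ar_Sr)
    then obtain v where v: "\<And>i. i < length a \<Longrightarrow> v i \<in> Ar G \<and> Dom G (v i) = Cod G (snd (a ! i)) \<and> Cod G (v i) = Dom G (snd (a ! i)) \<and>
        Cmp G (v i) (snd (a ! i)) = Idn G (Dom G (snd (a ! i))) \<and> Cmp G (snd (a ! i)) (v i) = Idn G (Cod G (snd (a ! i)))"
      by metis
    \<comment> \<open>The function q inverts the permutation of a. Position p of the target of the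
      inverse arrow therefore comes from position \<open>q p\<close>, with the inverse of the
      component of a listed there.\<close>
    define b where "b = map (\<lambda>p. (q p, v (q p))) [0..<length a]"
    have lb: "length b = length a" by (simp add: b_def)
    have nb: "b ! p = (q p, v (q p))" if "p < length a" for p using that by (simp add: b_def)
    have pb: "perm_ok b"
    proof (rule perm_okI, intro set_eqI iffI)
      fix p assume "p \<in> fst ` set b" then show "p \<in> {..<length b}" using q by (auto simp: b_def)
    next
      fix p assume p: "p \<in> {..<length b}"
      then have "fst (b ! fst (a ! p)) = p" using nb q2 perm_ok_less[OF pa, of p] lb by simp
      moreover have "fst (a ! p) < length b" using perm_ok_less[OF pa, of p] p lb by simp
      ultimately show "p \<in> fst ` set b" by (metis imageI nth_mem)
    qed
    have bA: "b \<in> Ar ?S" using pb a lb q v by (auto simp: Ar_Sr nb)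
    have nD: "Dom ?S a ! p = Dom G (snd (a ! q p))" if "p < length a" for p
      using nth_Dom_Sr[OF pa, of "q p" G] q[OF that] by simp
    have "Dom ?S b = Cod ?S a" using q v lb by (intro Dom_Sr_eqI[OF pb]) (auto simp: nb nth_Cod_Sr)
    moreover have "Cod ?S b = Dom ?S a" using q v lb nD by (intro Cod_Sr_eqI) (auto simp: nb)
    moreover have "Cmp ?S b a = Idn ?S (Dom ?S a)"
      using q v lb nD by (intro nth_equalityI) (auto simp: nth_Cmp_Sr nb nth_Idn_Sr)
    moreover have "Cmp ?S a b = Idn ?S (Cod ?S a)"
      using q2 v lb perm_ok_less[OF pa] by (intro nth_equalityI) (auto simp: nth_Cmp_Sr nb nth_Idn_Sr nth_Cod_Sr)
    ultimately show ?thesis using bA by blast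
  qed
  show ?thesis unfolding groupoid_def
    by (intro conjI ballI impI; (rule inv, assumption)?) (simp_all only: cmp one ends assoc units)
qed

lemma functor_Sr_map:
  assumes F: "is_functor G F H"
  shows "is_functor (Sr G) (Sr_map F) (Sr H)"
proof -
  note f = functorD[OF F]
  have nm: "onAr (Sr_map F) a ! i = (fst (a ! i), onAr F (snd (a ! i)))" if "i < length a" for a i
    using that by (simp add: Sr_map_def apsnd_def map_prod_def case_prod_unfold)
  have lm: "length (onAr (Sr_map F) a) = length a" for a by (simp add: Sr_map_def)
  have pm: "perm_ok (onAr (Sr_map F) a) = perm_ok a" for a
    by (simp add: perm_ok_def lm) (simp add: Sr_map_def image_image comp_def)
  have ar: "onAr (Sr_map F) a \<in> Ar (Sr H)" if "a \<in> Ar (Sr G)" for a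
    using that f(2) by (auto simp: Ar_Sr pm lm nm) (simp add: Sr_map_def)
  have dom: "Dom (Sr H) (onAr (Sr_map F) a) = onOb (Sr_map F) (Dom (Sr G) a)" if "a \<in> Ar (Sr G)" for a
    using that f(3) perm_ok_less[of a]
    by (intro Dom_Sr_eqI) (auto simp: Ar_Sr pm lm nm Sr_map_def[of F, THEN arg_cong[of _ _ onOb]] nth_Dom_Sr)
  have cod: "Cod (Sr H) (onAr (Sr_map F) a) = onOb (Sr_map F) (Cod (Sr G) a)" if "a \<in> Ar (Sr G)" for a
    using that f(4)
    by (intro Cod_Sr_eqI) (auto simp: Ar_Sr lm nm Sr_map_def[of F, THEN arg_cong[of _ _ onOb]] nth_Cod_Sr)
  have cmp: "onAr (Sr_map F) (Cmp (Sr G) b a) = Cmp (Sr H) (onAr (Sr_map F) b) (onAr (Sr_map F) a)"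
    if "a \<in> Ar (Sr G)" "b \<in> Ar (Sr G)" "Dom (Sr G) b = Cod (Sr G) a" for a b
    using Sr_composable[OF that(2,1,3)] that f(5)
    by (intro nth_equalityI) (auto simp: lm nm nth_Cmp_Sr Ar_Sr)
  have ob: "onOb (Sr_map F) x \<in> Ob (Sr H)" if "x \<in> Ob (Sr G)" for x
    using that f(1) by (auto simp: Sr_def Sr_map_def)
  show ?thesis unfolding is_functor_def using ob ar dom cod cmp by simp
qed

section \<open>Flattening\<close>

lemma concat_block:
  assumes "p < length xss" "j < length (xss ! p)"
  shows "(\<Sum>q<p. length (xss ! q)) + j < length (concat xss)"
    and "concat xss ! ((\<Sum>q<p. length (xss ! q)) + j) = xss ! p ! j"
  using assms
proof (induction xss arbitrary: p)
  case (Cons xs xss)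
  {
    case 1
    then show ?case using Cons.IH(1)
      by (cases p) (auto simp: sum.lessThan_Suc_shift add.assoc simp del: sum.lessThan_Suc)
  next
    case 2
    then show ?case using Cons.IH(2)
      by (cases p) (auto simp: sum.lessThan_Suc_shift add.assoc nth_append simp del: sum.lessThan_Suc)
  }
qed auto

lemma concat_block_index:
  assumes "k < length (concat xss)"
  obtains p j where "p < length xss" "j < length (xss ! p)" "k = (\<Sum>q<p. length (xss ! q)) + j"
  using assms
proof (induction xss arbitrary: k thesis)
  case (Cons xs xss)
  show ?case
  proof (cases "k < length xs")
    case True
    then show ?thesis using Cons.prems(1)[of 0 k] by simp
  next
    case False
    then have "k - length xs < length (concat xss)" using Cons.prems(2) by simp
    then obtain p j where "p < length xss" "j < length (xss ! p)" "k - length xs = (\<Sum>q<p. length (xss ! q)) + j"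
      using Cons.IH[of "k - length xs"] by metis
    then show ?thesis using Cons.prems(1)[of "Suc p" j] False
      by (simp add: sum.lessThan_Suc_shift del: sum.lessThan_Suc)
  qed
qed simp

definition shift_block :: "nat \<Rightarrow> (nat \<times> 'a) list \<Rightarrow> (nat \<times> 'a) list" where
  "shift_block b f = map (\<lambda>(j, a). (b + j, a)) f"

lemma length_shift_block [simp]: "length (shift_block b f) = length f"
  by (simp add: shift_block_def)

lemma nth_shift_block: "j < length f \<Longrightarrow> shift_block b f ! j = (b + fst (f ! j), snd (f ! j))"
  by (simp add: shift_block_def case_prod_unfold)

lemma flatten_eq: "flatten F = concat (map (\<lambda>(p, f). shift_block (block_start F p) f) F)"
  by (simp add: flatten_def shift_block_def)

text \<open>The offset depends only on the lengths of the source blocks. It may thus be read off any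
  list of blocks with these lengths, such as the domain of the arrow, which is shared with its
  composites.\<close>

lemma block_start_eq:
  assumes "perm_ok F" "p \<le> length F" "length xss = length F"
    "\<And>i. i < length F \<Longrightarrow> length (xss ! fst (F ! i)) = length (snd (F ! i))"
  shows "block_start F p = (\<Sum>q<p. length (xss ! q))"
  unfolding block_start_def
proof (rule sum.cong)
  fix q assume "q \<in> {..<p}"
  then obtain i where "i < length F" "fst (F ! i) = q" using perm_ok_surj[OF assms(1), of q] assms(2) by auto
  then show "length (component F q) = length (xss ! q)"
    using component_nth[OF assms(1), of i] assms(4)[of i] by auto
qed simp

text \<open>An arrow of \<open>S\<^sup>rG\<close> acts on lists of labelled arrows by \<open>Cmp (Sr G)\<close>, and flattening is
  compatible with this action; functoriality of \<open>flatten\<close> is the case where the lists \<open>mss ! p\<close> are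
  the shifted blocks of an arrow.\<close>

lemma Cmp_flatten:
  assumes P: "perm_ok K" and l: "length mss = length K"
    and len: "\<And>i. i < length K \<Longrightarrow> length (mss ! fst (K ! i)) = length (snd (K ! i))"
    and ok: "\<And>i. i < length K \<Longrightarrow> perm_ok (snd (K ! i))"
  shows "Cmp (Sr G) (flatten K) (concat mss) = concat (map (\<lambda>(p, k). Cmp (Sr G) k (mss ! p)) K)"
proof -
  have A: "Cmp (Sr G) (concat ls) ms = concat (map (\<lambda>f. Cmp (Sr G) f ms) ls)" for ls ms
    by (simp add: Sr_def map_concat comp_def)
  have "Cmp (Sr G) (shift_block (block_start K (fst (K ! i))) (snd (K ! i))) (concat mss) =
      Cmp (Sr G) (snd (K ! i)) (mss ! fst (K ! i))" if i: "i < length K" for i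
  proof (rule nth_equalityI)
    let ?p = "fst (K ! i)" and ?k = "snd (K ! i)"
    fix j assume "j < length (Cmp (Sr G) (shift_block (block_start K ?p) ?k) (concat mss))"
    then have j: "j < length ?k" by simp
    have p: "?p < length mss" using perm_ok_less[OF P i] l by simp
    have "concat mss ! (block_start K ?p + fst (?k ! j)) = mss ! ?p ! fst (?k ! j)"
      using concat_block(2)[OF p, of "fst (?k ! j)"] perm_ok_less[OF ok[OF i] j] len[OF i]
        block_start_eq[OF P _ l len, of ?p] p l by simp
    then show "Cmp (Sr G) (shift_block (block_start K ?p) ?k) (concat mss) ! j =
        Cmp (Sr G) ?k (mss ! ?p) ! j"
      using j by (simp add: nth_Cmp_Sr nth_shift_block)
  qed simp
  then have M: "map (\<lambda>f. Cmp (Sr G) f (concat mss)) (map (\<lambda>(p, f). shift_block (block_start K p) f) K) =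
      map (\<lambda>(p, k). Cmp (Sr G) k (mss ! p)) K"
    by (intro nth_equalityI) (auto simp: case_prod_unfold)
  show ?thesis unfolding flatten_eq A M ..
qed

lemma functor_Sr_mu:
  fixes G :: "('o, 'a) grpd"
  shows "is_functor (Sr (Sr G)) Sr_mu (Sr G)"
proof -
  let ?S = "Sr G" and ?T = "Sr (Sr G)"
  have T: "F \<noteq> [] \<and> perm_ok F \<and> (\<forall>i<length F. snd (F ! i) \<noteq> [] \<and> perm_ok (snd (F ! i)) \<and>
      (\<forall>j<length (snd (F ! i)). snd (snd (F ! i) ! j) \<in> Ar G))" if "F \<in> Ar ?T" for F
    using that by (auto simp: Ar_Sr)
  have dlen: "length (Dom ?T F ! fst (F ! i)) = length (snd (F ! i))" if "F \<in> Ar ?T" "i < length F" for F i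
    using T[OF that(1)] nth_Dom_Sr[of F i ?S] that(2) by simp
  have bs: "block_start F p = (\<Sum>q<p. length (Dom ?T F ! q))" if "F \<in> Ar ?T" "p \<le> length F" for F p
    using T[OF that(1)] dlen[OF that(1)] that(2) by (intro block_start_eq) auto
  have elem: "\<exists>i<length F. \<exists>j<length (snd (F ! i)). x = (block_start F (fst (F ! i)) + fst (snd (F ! i) ! j), snd (snd (F ! i) ! j))"
    if "x \<in> set (flatten F)" for x and F :: "(nat \<times> (nat \<times> 'a) list) list"
  proof -
    from that obtain i where i: "i < length F" "x \<in> set (shift_block (block_start F (fst (F ! i))) (snd (F ! i)))"
      by (auto simp: flatten_eq in_set_conv_nth[of _ F] case_prod_unfold)
    then obtain j where "j < length (snd (F ! i))" "x = shift_block (block_start F (fst (F ! i))) (snd (F ! i)) ! j"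
      by (auto simp: in_set_conv_nth)
    then show ?thesis using i by (auto simp: nth_shift_block)
  qed
  have elem': "(block_start F (fst (F ! i)) + fst (snd (F ! i) ! j), snd (snd (F ! i) ! j)) \<in> set (flatten F)"
    if "i < length F" "j < length (snd (F ! i))" for i j and F :: "(nat \<times> (nat \<times> 'a) list) list"
  proof -
    have "shift_block (block_start F (fst (F ! i))) (snd (F ! i)) ! j \<in> set (shift_block (block_start F (fst (F ! i))) (snd (F ! i)))"
      using that by simp
    then have "shift_block (block_start F (fst (F ! i))) (snd (F ! i)) ! j \<in> set (flatten F)"
      using that(1) by (force simp: flatten_eq)
    then show ?thesis using that by (simp add: nth_shift_block)
  qed
  \<comment> \<open>Blocks are listed in target order on the left and in source order on the right;
    the total length does not change under reindexing by the permutation.\<close>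
  have len: "length (flatten F) = length (concat (Dom ?T F))" if F: "F \<in> Ar ?T" for F
  proof -
    have "length (flatten F) = (\<Sum>i<length F. length (snd (F ! i)))"
      by (simp add: flatten_eq length_concat comp_def case_prod_unfold sum_list_sum_nth atLeast0LessThan)
    also have "\<dots> = (\<Sum>i<length F. length (Dom ?T F ! fst (F ! i)))"
      using dlen[OF F] by simp
    also have "\<dots> = (\<Sum>p<length F. length (Dom ?T F ! p))"
      using T[OF F] by (intro sum.reindex_bij_betw perm_ok_bij) simp
    finally show ?thesis by (simp add: length_concat sum_list_sum_nth atLeast0LessThan)
  qed
  have pos: "block_start F (fst (F ! i)) + fst (snd (F ! i) ! j) < length (concat (Dom ?T F)) \<and>
      concat (Dom ?T F) ! (block_start F (fst (F ! i)) + fst (snd (F ! i) ! j)) = Dom G (snd (snd (F ! i) ! j))"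
    if F: "F \<in> Ar ?T" and i: "i < length F" and j: "j < length (snd (F ! i))" for F i j
  proof -
    let ?p = "fst (F ! i)" and ?q = "fst (snd (F ! i) ! j)"
    have ok: "perm_ok F" "perm_ok (snd (F ! i))" using T[OF F] i by auto
    have p: "?p < length (Dom ?T F)" using perm_ok_less[OF ok(1) i] by simp
    have q: "?q < length (Dom ?T F ! ?p)" using perm_ok_less[OF ok(2) j] dlen[OF F i] by simp
    have "block_start F ?p = (\<Sum>q<?p. length (Dom ?T F ! q))" using bs[OF F] p by simp
    then show ?thesis
      using concat_block[OF p q] nth_Dom_Sr[OF ok(1) i, of ?S] nth_Dom_Sr[OF ok(2) j, of G] by simp
  qed
  \<comment> \<open>Surjectivity is enough: a position of the concatenated domain splits into a
    block and an offset, which the outer and the inner permutations reach.\<close>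
  have ok: "perm_ok (flatten F)" if F: "F \<in> Ar ?T" for F
  proof (rule perm_okI, intro set_eqI iffI)
    fix k assume "k \<in> fst ` set (flatten F)"
    then show "k \<in> {..<length (flatten F)}" using elem pos[OF F] len[OF F] by fastforce
  next
    fix k assume "k \<in> {..<length (flatten F)}"
    then have "k < length (concat (Dom ?T F))" using len[OF F] by simp
    then obtain p j where pj: "p < length (Dom ?T F)" "j < length (Dom ?T F ! p)"
      "k = (\<Sum>q<p. length (Dom ?T F ! q)) + j" by (rule concat_block_index)
    then obtain i where i: "i < length F" "fst (F ! i) = p" using T[OF F] perm_ok_surj[of F p] by auto
    then obtain l where l: "l < length (snd (F ! i))" "fst (snd (F ! i) ! l) = j"
      using T[OF F] perm_ok_surj[of "snd (F ! i)" j] dlen[OF F i(1)] pj(2) by auto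
    have "k = block_start F (fst (F ! i)) + fst (snd (F ! i) ! l)" using bs[OF F] pj i l by simp
    then show "k \<in> fst ` set (flatten F)" using elem'[OF i(1) l(1)] by (metis fst_conv imageI)
  qed
  have ob: "concat xss \<in> Ob ?S" if "xss \<in> Ob ?T" for xss
    using that by (cases xss) (auto simp: Ob_Sr)
  have ar: "flatten F \<in> Ar ?S" if F: "F \<in> Ar ?T" for F
  proof -
    have "0 < length F" using T[OF F] by simp
    moreover from this have "0 < length (snd (F ! 0))" using T[OF F] by simp
    ultimately have "flatten F \<noteq> []" using elem'[of 0 F 0] by force
    moreover have "snd x \<in> Ar G" if "x \<in> set (flatten F)" for x
      using elem[OF that] T[OF F] by auto
    ultimately show ?thesis using ok[OF F] by (simp add: Ar_Sr)
  qed
  have dom: "Dom ?S (flatten F) = concat (Dom ?T F)" if F: "F \<in> Ar ?T" for F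
  proof (rule Dom_Sr_eqI[OF ok[OF F]])
    fix i assume "i < length (flatten F)"
    then show "concat (Dom ?T F) ! fst (flatten F ! i) = Dom G (snd (flatten F ! i))"
      using elem[of "flatten F ! i" F] pos[OF F] by force
  qed (simp add: len[OF F])
  have cod: "Cod ?S (flatten F) = concat (Cod ?T F)" for F
    by (simp add: Sr_def flatten_def map_concat comp_def case_prod_unfold)
  have cmp: "flatten (Cmp ?T K F) = Cmp ?S (flatten K) (flatten F)"
    if F: "F \<in> Ar ?T" and K: "K \<in> Ar ?T" and d: "Dom ?T K = Cod ?T F" for F K
  proof -
    note c = Sr_composable[OF K F d]
    let ?KF = "Cmp ?T K F"
    have klen: "length (snd (F ! fst (K ! i))) = length (snd (K ! i))" if "i < length K" for i
      using arg_cong[OF c(3)[OF that], of length] by simp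
    have okF: "perm_ok F" and okK: "perm_ok K" using T[OF F] T[OF K] by auto
    have okKF: "perm_ok ?KF" using perm_ok_Cmp[OF okK okF c(1)] .
    \<comment> \<open>The composite has the same domain as F, hence the same offsets, although its
      blocks are listed in another order.\<close>
    have bsKF: "block_start ?KF p = block_start F p" if "p \<le> length F" for p
    proof -
      have "block_start ?KF p = (\<Sum>q<p. length (Dom ?T F ! q))"
        using okKF that c dlen[OF F] klen by (intro block_start_eq) (auto simp: nth_Cmp_Sr)
      then show ?thesis using bs[OF F that] by simp
    qed
    let ?mss = "map (\<lambda>(p, f). shift_block (block_start F p) f) F"
    have "Cmp ?S (flatten K) (flatten F) = concat (map (\<lambda>(p, k). Cmp ?S k (?mss ! p)) K)"
      unfolding flatten_eq[of F] using okK c klen T[OF K]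
      by (intro Cmp_flatten) (auto simp: case_prod_unfold)
    moreover have "map (\<lambda>(p, f). shift_block (block_start ?KF p) f) ?KF = map (\<lambda>(p, k). Cmp ?S k (?mss ! p)) K"
    proof (rule nth_equalityI)
      fix i assume "i < length (map (\<lambda>(p, f). shift_block (block_start ?KF p) f) ?KF)"
      then have i: "i < length K" by simp
      let ?f = "F ! fst (K ! i)"
      have "fst ?f < length F" using perm_ok_less[OF okF c(2)[OF i]] .
      then have b: "block_start ?KF (fst ?f) = block_start F (fst ?f)" by (intro bsKF) simp
      have "shift_block (block_start F (fst ?f)) (Cmp ?S (snd (K ! i)) (snd ?f)) =
          Cmp ?S (snd (K ! i)) (shift_block (block_start F (fst ?f)) (snd ?f))"
        using perm_ok_less[of "snd (K ! i)"] T[OF K] i klen[OF i]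
        by (intro nth_equalityI) (auto simp: nth_Cmp_Sr nth_shift_block)
      then show "map (\<lambda>(p, f). shift_block (block_start ?KF p) f) ?KF ! i = map (\<lambda>(p, k). Cmp ?S k (?mss ! p)) K ! i"
        using i c(2)[OF i] b by (simp add: nth_Cmp_Sr case_prod_unfold)
    qed simp
    ultimately show ?thesis unfolding flatten_eq[of ?KF] by simp
  qed
  show ?thesis unfolding is_functor_def Sr_mu_def using ob ar dom cod cmp by simp
qed

section \<open>Degrees and isomorphism classes of tuples\<close>

lemma list_all2_Cons_image:
  "{as. list_all2 (\<lambda>a x. a \<in> A x) as (x # xs)} =
      (\<lambda>(a, as). a # as) ` (A x \<times> {as. list_all2 (\<lambda>a x. a \<in> A x) as xs})"
  by (auto simp: list_all2_Cons2 image_iff)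

lemma finite_list_all2:
  "(\<And>x. x \<in> set xs \<Longrightarrow> finite (A x)) \<Longrightarrow> finite {as. list_all2 (\<lambda>a x. a \<in> A x) as xs}"
  by (induction xs) (simp_all add: list_all2_Cons_image)

lemma card_list_all2:
  "card {as. list_all2 (\<lambda>a x. a \<in> A x) as xs} = prod_list (map (\<lambda>x. card (A x)) xs)"
proof (induction xs)
  case (Cons x xs)
  have "inj_on (\<lambda>(a, as). a # as) (A x \<times> {as. list_all2 (\<lambda>a x. a \<in> A x) as xs})"
    by (auto simp: inj_on_def)
  then show ?case
    unfolding list_all2_Cons_image by (simp add: card_image card_cartesian_product Cons.IH)
qed simp

text \<open>The codomain is free, so an arrow out of a tuple is a free choice of a permutation and
  of one arrow out of each entry. The list \<open>as\<close> is indexed by source positions, while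
  \<sigma> lists the source positions in target order.\<close>

lemma outs_Sr:
  assumes "xs \<noteq> []"
  shows "bij_betw (\<lambda>(\<sigma>, as). map (\<lambda>p. (p, as ! p)) \<sigma>)
    (permutations_of_set {..<length xs} \<times> {as. list_all2 (\<lambda>a x. a \<in> outs G x) as xs}) (outs (Sr G) xs)"
proof -
  let ?n = "length xs"
  let ?A = "permutations_of_set {..<?n} \<times> {as. list_all2 (\<lambda>a x. a \<in> outs G x) as xs}"
  let ?h = "\<lambda>(\<sigma>, as). map (\<lambda>p. (p, as ! p)) \<sigma>"
  have len: "length \<sigma> = ?n" "set \<sigma> = {..<?n}" "distinct \<sigma>" if "\<sigma> \<in> permutations_of_set {..<?n}" for \<sigma>
    using permutations_of_setD[OF that] distinct_card[of \<sigma>] by simp_all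
  have okh: "perm_ok (map (\<lambda>p. (p, as ! p)) \<sigma>)" if "\<sigma> \<in> permutations_of_set {..<?n}" for \<sigma> and as :: "'b list"
    using len[OF that] by (simp add: perm_ok_def comp_def image_image)
  show ?thesis
  proof (rule bij_betw_byWitness[where f' = "\<lambda>f. (map fst f, map (component f) [0..<?n])"])
    show "\<forall>u\<in>?A. (map fst (?h u), map (component (?h u)) [0..<?n]) = u"
    proof
      fix u assume "u \<in> ?A"
      then obtain \<sigma> as where u: "u = (\<sigma>, as)" and 1: "\<sigma> \<in> permutations_of_set {..<?n}"
        "list_all2 (\<lambda>a x. a \<in> outs G x) as xs" by auto
      have "component (?h (\<sigma>, as)) p = as ! p" if "p < ?n" for p
      proof -
        have "p \<in> set \<sigma>" using len(2)[OF 1(1)] that by simp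
        then obtain i where "i < length \<sigma>" "\<sigma> ! i = p" unfolding in_set_conv_nth by blast
        then show ?thesis using component_nth[OF okh[OF 1(1), of as], of i] by simp
      qed
      then have "map (component (?h (\<sigma>, as))) [0..<?n] = map (\<lambda>p. as ! p) [0..<length as]"
        using list_all2_lengthD[OF 1(2)] by simp
      then show "(map fst (?h u), map (component (?h u)) [0..<?n]) = u"
        unfolding u by (simp add: comp_def map_nth)
    qed
    show "\<forall>f\<in>outs (Sr G) xs. ?h (map fst f, map (component f) [0..<?n]) = f"
    proof
      fix f assume "f \<in> outs (Sr G) xs"
      then have f: "perm_ok f" "length f = ?n" by (auto simp: outs_def Ar_Sr)
      then show "?h (map fst f, map (component f) [0..<?n]) = f"
        using perm_ok_less[OF f(1)] by (intro nth_equalityI) (auto simp: component_nth)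
    qed
    show "?h ` ?A \<subseteq> outs (Sr G) xs"
    proof (safe, goal_cases)
      case (1 _ \<sigma> as)
      note l = len[OF 1(1)]
      have as: "length as = ?n" "\<And>p. p < ?n \<Longrightarrow> as ! p \<in> outs G (xs ! p)"
        using 1(2) by (auto simp: list_all2_conv_all_nth)
      have s: "\<sigma> ! i < ?n" if "i < ?n" for i using nth_mem[of i \<sigma>] l that by simp
      have "map (\<lambda>p. (p, as ! p)) \<sigma> \<in> Ar (Sr G)"
        using okh[OF 1(1), of as] l as s assms by (auto simp: Ar_Sr outs_def)
      moreover have "Dom (Sr G) (map (\<lambda>p. (p, as ! p)) \<sigma>) = xs"
        using okh[OF 1(1), of as] l as s by (intro Dom_Sr_eqI) (auto simp: outs_def)
      ultimately show ?case by (simp add: outs_def)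
    qed
    show "(\<lambda>f. (map fst f, map (component f) [0..<?n])) ` outs (Sr G) xs \<subseteq> ?A"
    proof (safe, goal_cases)
      case (1 _ _ f)
      then have "perm_ok f" "length f = ?n" by (auto simp: outs_def Ar_Sr)
      then show ?case by (auto simp: permutations_of_set_def perm_ok_def)
    next
      case (2 _ _ f)
      then have f: "perm_ok f" "length f = ?n" "Dom (Sr G) f = xs" "\<forall>i<length f. snd (f ! i) \<in> Ar G"
        by (auto simp: outs_def Ar_Sr)
      show ?case unfolding list_all2_conv_all_nth
      proof (intro conjI allI impI)
        fix p assume "p < length (map (component f) [0..<?n])"
        then have p: "p < ?n" by simp
        then obtain i where i: "i < length f" "fst (f ! i) = p" using perm_ok_surj[OF f(1), of p] f(2) by auto
        then show "map (component f) [0..<?n] ! p \<in> outs G (xs ! p)"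
          using component_nth[OF f(1) i(1)] nth_Dom_Sr[OF f(1) i(1), of G] f(3,4) p by (simp add: outs_def)
      qed simp
    qed
  qed
qed

lemma deg_Sr:
  assumes "xs \<noteq> []"
  shows "deg (Sr G) xs = fact (length xs) * prod_list (map (deg G) xs)"
    and "(\<And>x. x \<in> set xs \<Longrightarrow> finite (outs G x)) \<Longrightarrow> finite (outs (Sr G) xs)"
proof -
  show "deg (Sr G) xs = fact (length xs) * prod_list (map (deg G) xs)"
    using bij_betw_same_card[OF outs_Sr[OF assms, of G]] card_list_all2[of "outs G" xs]
    by (simp add: deg_def[abs_def] card_cartesian_product)
  show "(\<And>x. x \<in> set xs \<Longrightarrow> finite (outs G x)) \<Longrightarrow> finite (outs (Sr G) xs)"
    using bij_betw_finite[OF outs_Sr[OF assms, of G]] finite_list_all2[of xs "outs G"]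
    by auto
qed

text \<open>Arrows match entries of equal type up to a permutation. Conversely, equal multisets of
  types give a permutation aligning the types, and the isomorphisms between aligned entries form an
  arrow.\<close>

lemma classifies_Sr:
  assumes c: "classifies G ty"  and G: "groupoid G"
  shows "classifies (Sr G) (\<lambda>xs. mset (map ty xs))"
  unfolding classifies_def
proof (intro ballI iffI)
  fix xs ys assume "hom (Sr G) xs ys \<noteq> {}"
  then obtain f where f: "f \<in> Ar (Sr G)" "Dom (Sr G) f = xs" "Cod (Sr G) f = ys" by (auto simp: hom_def)
  have ok: "perm_ok f" using f(1) by (simp add: Ar_Sr)
  have l: "length xs = length f" "length ys = length f" using f by auto
  have "ty (ys ! i) = ty (xs ! fst (f ! i))" if "i < length f" for i
  proof -
    have a: "snd (f ! i) \<in> Ar G" "Dom G (snd (f ! i)) = xs ! fst (f ! i)" "Cod G (snd (f ! i)) = ys ! i"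
      using f that nth_Dom_Sr[OF ok that, of G] nth_Cod_Sr[OF that, of G] by (auto simp: Ar_Sr)
    then have "snd (f ! i) \<in> hom G (xs ! fst (f ! i)) (ys ! i)" by (simp add: hom_def)
    then show ?thesis using classifiesD[OF c, of "xs ! fst (f ! i)" "ys ! i"] a groupoidD(1,2)[OF G a(1)] by auto
  qed
  then have "map ty ys = map (\<lambda>p. ty (xs ! p)) (map fst f)"
    using l by (intro nth_equalityI) auto
  then have "mset (map ty ys) = image_mset (\<lambda>p. ty (xs ! p)) (mset (map fst f))" by (simp add: multiset.map_comp)
  also have "\<dots> = image_mset (\<lambda>p. ty (xs ! p)) (mset [0..<length xs])"
    using perm_ok_mset[OF ok] l by simp
  also have "\<dots> = mset (map (\<lambda>p. ty (xs ! p)) [0..<length xs])" by simp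
  also have "map (\<lambda>p. ty (xs ! p)) [0..<length xs] = map ty xs" by (intro nth_equalityI) auto
  finally show "mset (map ty xs) = mset (map ty ys)" by simp
next
  fix xs ys assume xs: "xs \<in> Ob (Sr G)" and ys: "ys \<in> Ob (Sr G)" and m: "mset (map ty xs) = mset (map ty ys)"
  let ?n = "length xs"
  obtain q where q: "q permutes {..<length (map ty xs)}" "permute_list q (map ty xs) = map ty ys"
    using m by (metis mset_eq_permutation)
  have l: "length ys = ?n" using arg_cong[OF q(2), of length] by simp
  have qn: "q i < ?n" if "i < ?n" for i using q(1) that by (simp add: permutes_in_image[of q "{..<?n}" i, simplified])
  have "ty (xs ! q i) = ty (ys ! i)" if "i < ?n" for i
    using permute_list_nth[OF q(1), of i] q(2) qn[OF that] that l by simp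
  moreover have "xs ! q i \<in> Ob G" "ys ! i \<in> Ob G" if "i < ?n" for i
    using xs ys qn[OF that] that l by (auto simp: Ob_Sr)
  ultimately have "\<forall>i<?n. \<exists>a. a \<in> hom G (xs ! q i) (ys ! i)"
    using classifiesD[OF c] by blast
  then obtain a where a: "\<And>i. i < ?n \<Longrightarrow> a i \<in> hom G (xs ! q i) (ys ! i)" by metis
  let ?f = "map (\<lambda>i. (q i, a i)) [0..<?n]"
  have "fst ` set ?f = q ` {..<?n}" by (auto simp: image_image)
  also have "\<dots> = {..<?n}" using q(1) by (simp add: permutes_image)
  finally have ok: "perm_ok ?f" by (intro perm_okI) simp
  then have "?f \<in> Ar (Sr G)" using a xs by (auto simp: Ar_Sr hom_def Ob_Sr)
  moreover have "Dom (Sr G) ?f = xs" using a ok by (intro Dom_Sr_eqI) (auto simp: hom_def)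
  moreover have "Cod (Sr G) ?f = ys" using a l by (intro Cod_Sr_eqI) (auto simp: hom_def)
  ultimately show "hom (Sr G) xs ys \<noteq> {}" by (auto simp: hom_def)
qed

section \<open>Functors into and out of subgroupoids\<close>

text \<open>Domain, codomain and composition agree as total functions, since \<open>fullsub\<close>
  and \<open>pullback\<close> shrink only the two carrier sets. Functoriality then restricts once
  membership is checked (\<open>functor_sub\<close>).\<close>

definition subgrpd :: "('o, 'a) grpd \<Rightarrow> ('o, 'a) grpd \<Rightarrow> bool" where
  "subgrpd H G \<longleftrightarrow> Ob H \<subseteq> Ob G \<and> Ar H \<subseteq> Ar G \<and> Dom H = Dom G \<and> Cod H = Cod G \<and> Cmp H = Cmp G"

lemma subgrpd_refl: "subgrpd G G"
  by (simp add: subgrpd_def)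

lemma subgrpd_fullsub: "subgrpd (fullsub G P) G"
  by (auto simp: subgrpd_def fullsub_def)

lemma subgrpd_pullback: "subgrpd (pullback G F H K) (prodG G H)"
  by (auto simp: subgrpd_def pullback_def prodG_def)

lemma subgrpd_Sr: "subgrpd H G \<Longrightarrow> subgrpd (Sr H) (Sr G)"
  by (auto simp: subgrpd_def Sr_def)

lemma functor_sub:
  assumes "is_functor G F H" "subgrpd G' G" "subgrpd H' H"
    "\<And>x. x \<in> Ob G' \<Longrightarrow> onOb F x \<in> Ob H'" "\<And>a. a \<in> Ar G' \<Longrightarrow> onAr F a \<in> Ar H'"
  shows "is_functor G' F H'"
proof -
  have "x \<in> Ob G" if "x \<in> Ob G'" for x using assms(2) that by (auto simp: subgrpd_def)
  moreover have "a \<in> Ar G" if "a \<in> Ar G'" for a using assms(2) that by (auto simp: subgrpd_def)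
  moreover have "Dom G' = Dom G" "Cod G' = Cod G" "Cmp G' = Cmp G" "Dom H' = Dom H" "Cod H' = Cod H" "Cmp H' = Cmp H"
    using assms(2,3) by (simp_all add: subgrpd_def)
  ultimately show ?thesis using functorD[OF assms(1)] assms(4,5) by (simp add: is_functor_def)
qed

text \<open>The face and degeneracy maps are written with selectors such as \<open>un_Graft\<close>;
  composing with the injection of the constructor removes them and leaves a map on the original
  groupoid.\<close>

lemma functor_relabel_dom:
  assumes F: "is_functor G \<lparr>onOb = onOb F \<circ> i, onAr = onAr F \<circ> j\<rparr> H"
    and i: "\<And>x. i' (i x) = x" and j: "\<And>a. j' (j a) = a"
  shows "is_functor (relabel i i' j j' G) F H"
proof -
  have inj: "i x = i y \<longleftrightarrow> x = y" for x y using i by metis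
  show ?thesis using F by (auto simp: is_functor_def relabel_def i j inj)
qed

lemma functor_relabel_cod:
  assumes F: "is_functor G F H" and i: "\<And>x. i' (i x) = x" and j: "\<And>a. j' (j a) = a"
  shows "is_functor G \<lparr>onOb = i \<circ> onOb F, onAr = j \<circ> onAr F\<rparr> (relabel i i' j j' H)"
  using F by (auto simp: is_functor_def relabel_def i j)

lemma functor_fst: "is_functor (prodG G H) \<lparr>onOb = fst, onAr = fst\<rparr> G"
  and functor_snd: "is_functor (prodG G H) \<lparr>onOb = snd, onAr = snd\<rparr> H"
  by (auto simp: is_functor_def prodG_def)

lemma functor_prod:
  assumes "is_functor G F H" "is_functor G' F' H'"
  shows "is_functor (prodG G G') \<lparr>onOb = map_prod (onOb F) (onOb F'), onAr = map_prod (onAr F) (onAr F')\<rparr> (prodG H H')"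
  using assms by (auto simp: is_functor_def prodG_def)

text \<open>This is the strength of the monad of tuples. Grafting an operation onto one arrow pairs
  that arrow with all arrows of the operation.\<close>

lemma functor_strength:
  fixes A :: "('o, 'a) grpd" and B :: "('p, 'b) grpd"
  shows "is_functor (prodG A (Sr B)) \<lparr>onOb = (\<lambda>(x, ys). map (Pair x) ys), onAr = (\<lambda>(a, bs). map (apsnd (Pair a)) bs)\<rparr>
    (Sr (prodG A B))"
proof -
  let ?h = "\<lambda>(a, bs). map (apsnd (Pair a)) bs"
  have nth: "?h (a, bs) ! i = (fst (bs ! i), a, snd (bs ! i))" if "i < length bs" for i and a :: 'a and bs :: "(nat \<times> 'b) list"
    using that by (simp add: apsnd_def map_prod_def case_prod_unfold)
  have len: "length (?h (a, bs)) = length bs" for a :: 'a and bs :: "(nat \<times> 'b) list" by simp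
  have ok: "perm_ok (?h (a, bs)) = perm_ok bs" for a :: 'a and bs :: "(nat \<times> 'b) list"
    by (simp add: perm_ok_def image_image comp_def)
  have 1: "?h (a, bs) \<in> Ar (Sr (prodG A B))" if "a \<in> Ar A" "bs \<in> Ar (Sr B)" for a bs
    using that ok[of a bs] nth[of _ bs a] by (auto simp: Ar_Sr prodG_def)
  have 2: "Dom (Sr (prodG A B)) (?h (a, bs)) = map (Pair (Dom A a)) (Dom (Sr B) bs)" if "bs \<in> Ar (Sr B)" for a bs
  proof (rule Dom_Sr_eqI)
    show "perm_ok (?h (a, bs))" using that ok by (simp add: Ar_Sr)
    fix i assume "i < length (?h (a, bs))"
    then show "map (Pair (Dom A a)) (Dom (Sr B) bs) ! fst (?h (a, bs) ! i) = Dom (prodG A B) (snd (?h (a, bs) ! i))"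
      using that nth[of i bs a] perm_ok_less[of bs i] by (simp add: Ar_Sr nth_Dom_Sr prodG_def)
  qed simp
  have 3: "Cod (Sr (prodG A B)) (?h (a, bs)) = map (Pair (Cod A a)) (Cod (Sr B) bs)" for a bs
    using nth by (intro Cod_Sr_eqI) (auto simp: nth_Cod_Sr prodG_def)
  have 4: "?h (Cmp A a' a, Cmp (Sr B) bs' bs) = Cmp (Sr (prodG A B)) (?h (a', bs')) (?h (a, bs))"
    if "bs \<in> Ar (Sr B)" "bs' \<in> Ar (Sr B)" "Dom (Sr B) bs' = Cod (Sr B) bs" for a a' bs bs'
  proof (rule nth_equalityI)
    fix i assume "i < length (?h (Cmp A a' a, Cmp (Sr B) bs' bs))"
    then have i: "i < length bs'" by simp
    then show "?h (Cmp A a' a, Cmp (Sr B) bs' bs) ! i = Cmp (Sr (prodG A B)) (?h (a', bs')) (?h (a, bs)) ! i"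
      using nth[of i "Cmp (Sr B) bs' bs" "Cmp A a' a"] nth[of i bs' a'] nth[of "fst (bs' ! i)" bs a]
        Sr_composable(2)[OF that(2,1,3) i]
      by (simp add: nth_Cmp_Sr prodG_def)
  qed simp
  have 0: "map (Pair x) ys \<in> Ob (Sr (prodG A B))" if "x \<in> Ob A" "ys \<in> Ob (Sr B)" for x ys
    using that by (auto simp: Ob_Sr prodG_def)
  show ?thesis unfolding is_functor_def using 0 1 2 3 4 by (auto simp: prodG_def[of A "Sr B"])
qed

text \<open>The strength followed by a projection makes one copy of x for each entry of the tuple.
  The composite of y after x in \<open>T_up\<close> needs these copies, one per input of y.\<close>

lemma functor_const_strength:
  "is_functor (prodG (Sr B) A) \<lparr>onOb = (\<lambda>(ys, x). map (\<lambda>_. x) ys), onAr = (\<lambda>(bs, a). map (apsnd (\<lambda>_. a)) bs)\<rparr> (Sr A)"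
proof -
  have sw: "is_functor (prodG (Sr B) A) \<lparr>onOb = prod.swap, onAr = prod.swap\<rparr> (prodG A (Sr B))"
    by (auto simp: is_functor_def prodG_def)
  from functor_fcomp[OF functor_fcomp[OF sw functor_strength] functor_Sr_map[OF functor_fst]]
  show ?thesis
    by (simp add: fcomp_def Sr_map_def comp_def case_prod_unfold apsnd_def map_prod_def)
qed

text \<open>\<open>Sr_map\<close> keeps the position labels of an arrow, so two arrows of tuples
  with equal images carry the same permutation and can be zipped, keeping the labels of the
  first.\<close>

lemma functor_zip:
  fixes A :: "('o, 'a) grpd" and B :: "('p, 'b) grpd"
  shows "is_functor (pullback (Sr A) (Sr_map F) (Sr B) (Sr_map H))
    \<lparr>onOb = (\<lambda>(xs, ys). zip xs ys), onAr = (\<lambda>(as, bs). map2 (\<lambda>(p, a) (_, b). (p, a, b)) as bs)\<rparr>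
    (Sr (pullback A F B H))"
proof -
  let ?P = "pullback (Sr A) (Sr_map F) (Sr B) (Sr_map H)" and ?S = "Sr (pullback A F B H)"
  let ?h = "\<lambda>(as, bs). map2 (\<lambda>(p, a) (_, b). (p, a, b)) as bs"
  have P: "as \<in> Ar (Sr A) \<and> bs \<in> Ar (Sr B) \<and> length bs = length as \<and>
      (\<forall>i<length as. fst (bs ! i) = fst (as ! i) \<and> onAr F (snd (as ! i)) = onAr H (snd (bs ! i)))"
    if "(as, bs) \<in> Ar ?P" for as bs
  proof -
    from that have e: "map (apsnd (onAr F)) as = map (apsnd (onAr H)) bs" and
      ar: "as \<in> Ar (Sr A)" "bs \<in> Ar (Sr B)" by (auto simp: pullback_def Sr_map_def)
    have l: "length bs = length as" using arg_cong[OF e, of length] by simp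
    have "apsnd (onAr F) (as ! i) = apsnd (onAr H) (bs ! i)" if "i < length as" for i
      using arg_cong[OF e, of "\<lambda>l. l ! i"] that l by simp
    then have "fst (bs ! i) = fst (as ! i) \<and> onAr F (snd (as ! i)) = onAr H (snd (bs ! i))" if "i < length as" for i
      using that by (cases "as ! i"; cases "bs ! i") fastforce
    then show ?thesis using ar l by blast
  qed
  have nth: "?h (as, bs) ! i = (fst (as ! i), snd (as ! i), snd (bs ! i))"
    if "i < length as" "length bs = length as" for i and as :: "(nat \<times> 'a) list" and bs :: "(nat \<times> 'b) list"
    using that by (simp add: case_prod_unfold)
  have ok: "perm_ok (?h (as, bs))" if "perm_ok as" "length bs = length as"
    for as :: "(nat \<times> 'a) list" and bs :: "(nat \<times> 'b) list"
  proof -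
    have "map fst (?h (as, bs)) = map fst as"
      using that nth[of _ as bs] by (intro nth_equalityI) auto
    moreover from this have "fst ` set (?h (as, bs)) = fst ` set as" by (simp only: set_map[symmetric])
    ultimately show ?thesis using that unfolding perm_ok_def by simp
  qed
  have ob: "zip xs ys \<in> Ob ?S" if "(xs, ys) \<in> Ob ?P" for xs ys
  proof -
    from that have e: "map (onOb F) xs = map (onOb H) ys" and
      o: "xs \<in> Ob (Sr A)" "ys \<in> Ob (Sr B)" by (auto simp: pullback_def Sr_map_def)
    have l: "length ys = length xs" using arg_cong[OF e, of length] by simp
    have "onOb F (xs ! i) = onOb H (ys ! i)" if "i < length xs" for i
      using arg_cong[OF e, of "\<lambda>l. l ! i"] that l by simp
    then show ?thesis using o l by (auto simp: Ob_Sr pullback_def set_zip subset_iff)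
  qed
  have ar: "?h (as, bs) \<in> Ar ?S" if "(as, bs) \<in> Ar ?P" for as bs
    using P[OF that] ok[of as bs] nth[of _ as bs] by (auto simp: Ar_Sr pullback_def)
  have dom: "Dom ?S (?h (as, bs)) = zip (Dom (Sr A) as) (Dom (Sr B) bs)" if "(as, bs) \<in> Ar ?P" for as bs
  proof (rule Dom_Sr_eqI)
    show "perm_ok (?h (as, bs))" using P[OF that] ok[of as bs] by (simp add: Ar_Sr)
    fix i assume "i < length (?h (as, bs))"
    then have i: "i < length as" "i < length bs" using P[OF that] by auto
    have f: "fst (bs ! i) = fst (as ! i)" and okab: "perm_ok as" "perm_ok bs" using P[OF that] i by (auto simp: Ar_Sr)
    show "zip (Dom (Sr A) as) (Dom (Sr B) bs) ! fst (?h (as, bs) ! i) = Dom (pullback A F B H) (snd (?h (as, bs) ! i))"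
      using P[OF that] perm_ok_less[OF okab(1) i(1)] nth_Dom_Sr[OF okab(1) i(1), of A] nth_Dom_Sr[OF okab(2) i(2), of B] f nth[OF i(1), of bs]
      by (simp add: pullback_def prodG_def)
  qed (use P[OF that] in simp)
  have cod: "Cod ?S (?h (as, bs)) = zip (Cod (Sr A) as) (Cod (Sr B) bs)" if "(as, bs) \<in> Ar ?P" for as bs
    using P[OF that] nth[of _ as bs] by (intro Cod_Sr_eqI) (auto simp: nth_Cod_Sr pullback_def prodG_def)
  have cmp: "?h (Cmp (Sr A) as' as, Cmp (Sr B) bs' bs) = Cmp ?S (?h (as', bs')) (?h (as, bs))"
    if "(as, bs) \<in> Ar ?P" "(as', bs') \<in> Ar ?P" "Dom (Sr A) as' = Cod (Sr A) as" for as as' bs bs'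
  proof (rule nth_equalityI)
    show "length (?h (Cmp (Sr A) as' as, Cmp (Sr B) bs' bs)) = length (Cmp ?S (?h (as', bs')) (?h (as, bs)))" by simp
    fix i assume "i < length (?h (Cmp (Sr A) as' as, Cmp (Sr B) bs' bs))"
    then have i: "i < length as'" by simp
    have p: "fst (as' ! i) < length as" using Sr_composable(2)[of as' A as i] P[OF that(1)] P[OF that(2)] that(3) i by simp
    show "?h (Cmp (Sr A) as' as, Cmp (Sr B) bs' bs) ! i = Cmp ?S (?h (as', bs')) (?h (as, bs)) ! i"
      using P[OF that(1)] P[OF that(2)] i p nth[of i as' bs'] nth[of "fst (as' ! i)" as bs]
        nth[of i "Cmp (Sr A) as' as" "Cmp (Sr B) bs' bs"]
      by (simp add: nth_Cmp_Sr pullback_def prodG_def)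
  qed
  have cmp': "onAr \<lparr>onOb = (\<lambda>(xs, ys). zip xs ys), onAr = ?h\<rparr> (Cmp ?P v u) = Cmp ?S (?h v) (?h u)"
    if "u \<in> Ar ?P" "v \<in> Ar ?P" "Dom ?P v = Cod ?P u" for u v
    using cmp[of "fst u" "snd u" "fst v" "snd v"] that by (cases u; cases v) (simp add: pullback_def[of "Sr A"] prodG_def[of "Sr A"])
  have dom': "Dom ?S (?h u) = (\<lambda>(xs, ys). zip xs ys) (Dom ?P u)"
    and cod': "Cod ?S (?h u) = (\<lambda>(xs, ys). zip xs ys) (Cod ?P u)" if "u \<in> Ar ?P" for u
    using dom[of "fst u" "snd u"] cod[of "fst u" "snd u"] that
    by (cases u, simp add: pullback_def[of "Sr A"] prodG_def[of "Sr A"])+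
  show ?thesis unfolding is_functor_def
  proof (intro conjI ballI impI)
    fix x assume "x \<in> Ob ?P" then show "onOb \<lparr>onOb = (\<lambda>(xs, ys). zip xs ys), onAr = ?h\<rparr> x \<in> Ob ?S"
      using ob[of "fst x" "snd x"] by (cases x) simp
  next
    fix u assume "u \<in> Ar ?P" then show "onAr \<lparr>onOb = (\<lambda>(xs, ys). zip xs ys), onAr = ?h\<rparr> u \<in> Ar ?S"
      using ar[of "fst u" "snd u"] by (cases u) simp
  qed (use dom' cod' cmp' in simp_all)
qed

section \<open>The operad \<open>T_op Sym2\<close>\<close>

lemma UNIV_two: "{One, Two} = (UNIV :: two set)"
  using two.exhaust by auto

text \<open>This and the next definitions are the pieces of the T-construction for
  \<open>Sym2\<close> in explicit form; \<open>T_up_Sym2\<close> and \<open>T_op_Sym2\<close> make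
  the identification.\<close>

definition colG :: "(two, two) grpd" where
  "colG = discrete UNIV"

definition arrG :: "(two list \<times> two, (nat \<times> two) list \<times> two) grpd" where
  "arrG = fullsub (prodG (Sr colG) colG) (\<lambda>q. \<exists>c. \<forall>c'\<in>set (fst q). c' = c)"

definition opG :: "((two list \<times> two) list, (nat \<times> (nat \<times> two) list \<times> two) list) grpd" where
  "opG = fullsub (Sr arrG) (\<lambda>fs. \<exists>c. \<forall>f\<in>set fs. snd f = c)"

definition srcF :: "(two list \<times> two, (nat \<times> two) list \<times> two, two, two) fct" where
  "srcF = \<lparr>onOb = (\<lambda>q. hd (fst q)), onAr = (\<lambda>a. snd (hd (fst a)))\<rparr>"

definition tgtF :: "(two list \<times> two, (nat \<times> two) list \<times> two, two, two) fct" where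
  "tgtF = \<lparr>onOb = snd, onAr = snd\<rparr>"

definition outF :: "((two list \<times> two) list, (nat \<times> (nat \<times> two) list \<times> two) list, two, two) fct" where
  "outF = \<lparr>onOb = (\<lambda>fs. snd (hd fs)), onAr = (\<lambda>fs. snd (snd (hd fs)))\<rparr>"

definition arr_comp :: "((two list \<times> two) \<times> two list \<times> two,
    ((nat \<times> two) list \<times> two) \<times> (nat \<times> two) list \<times> two, two list \<times> two, (nat \<times> two) list \<times> two) fct" where
  "arr_comp = \<lparr>onOb = (\<lambda>(y, x). (concat (map (\<lambda>_. fst x) (fst y)), snd y)),
     onAr = (\<lambda>(b, a). (flatten (map (apsnd (\<lambda>_. fst a)) (fst b)), snd b))\<rparr>"

lemma T_up_Sym2:
  "iobjs (T_up Sym2) = colG" "iarrs (T_up Sym2) = arrG" "isrc (T_up Sym2) = srcF" "itgt (T_up Sym2) = tgtF"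
  "icomp (T_up Sym2) = arr_comp" "iid (T_up Sym2) = \<lparr>onOb = (\<lambda>c. ([c], c)), onAr = (\<lambda>c. ([(0, c)], c))\<rparr>"
  by (simp_all add: T_up_def Sym_def UNIV_two colG_def arrG_def srcF_def tgtF_def arr_comp_def
      comp_def fun_eq_iff apsnd_def map_prod_def case_prod_unfold)

lemma groupoid_colG: "groupoid colG"
  by (simp add: colG_def groupoid_discrete)

lemma groupoid_arrG: "groupoid arrG"
  unfolding arrG_def by (intro groupoid_fullsub groupoid_prodG groupoid_Sr groupoid_colG)

lemma groupoid_opG: "groupoid opG"
  unfolding opG_def by (intro groupoid_fullsub groupoid_Sr groupoid_arrG)

lemma subgrpd_opG: "subgrpd opG (Sr arrG)"
  unfolding opG_def by (rule subgrpd_fullsub)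

text \<open>Into a discrete groupoid a functor is a function on objects that is constant along
  arrows.\<close>

lemma functor_discrete:
  assumes "\<And>x. x \<in> Ob G \<Longrightarrow> onOb F x \<in> K"
    and "\<And>a. a \<in> Ar G \<Longrightarrow> onAr F a = onOb F (Dom G a) \<and> onAr F a = onOb F (Cod G a)"
    and G: "groupoid G"
  shows "is_functor G F (discrete K)"
  unfolding is_functor_def discrete_def
proof (simp, intro conjI ballI impI)
  fix a b assume "a \<in> Ar G" "b \<in> Ar G" "Dom G b = Cod G a"
  then show "onAr F (Cmp G b a) = onAr F b" using assms(2) groupoidD(6,8)[OF G] by metis
qed (use assms groupoidD(1,2)[OF G] in metis)+

lemma functor_tgtF: "is_functor arrG tgtF colG"
  unfolding tgtF_def arrG_def
  by (rule functor_sub[OF functor_snd[of "Sr colG" colG] subgrpd_fullsub subgrpd_refl])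
    (auto simp: fullsub_def prodG_def)

lemma set_Dom_Sr: "f \<in> Ar (Sr G) \<Longrightarrow> set (Dom (Sr G) f) = Dom G ` snd ` set f"
proof (intro set_eqI iffI)
  assume f: "f \<in> Ar (Sr G)"
  then have ok: "perm_ok f" by (simp add: Ar_Sr)
  {
    fix x assume "x \<in> set (Dom (Sr G) f)"
    then obtain p where p: "p < length f" "x = Dom (Sr G) f ! p" by (auto simp: in_set_conv_nth)
    then obtain i where "i < length f" "fst (f ! i) = p" using perm_ok_surj[OF ok] by blast
    then show "x \<in> Dom G ` snd ` set f" using p nth_Dom_Sr[OF ok, of i G] by simp
  next
    fix x assume "x \<in> Dom G ` snd ` set f"
    then obtain i where i: "i < length f" "x = Dom G (snd (f ! i))" by (auto simp: in_set_conv_nth)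
    then have "x = Dom (Sr G) f ! fst (f ! i)" using nth_Dom_Sr[OF ok, of i G] by simp
    then show "x \<in> set (Dom (Sr G) f)" using perm_ok_less[OF ok i(1)] by simp
  }
qed

lemma set_Cod_Sr: "set (Cod (Sr G) f) = Cod G ` snd ` set f"
  by (auto simp: Sr_def image_iff case_prod_unfold)

text \<open>Colours are discrete, so an arrow between constant tuples of colours only permutes
  positions. Its single colour can be read off the head of the arrow, of its domain or of its
  codomain.\<close>

lemma Ar_arrG:
  assumes "a \<in> Ar arrG"
  shows "fst a \<in> Ar (Sr colG)" "x \<in> set (fst a) \<Longrightarrow> snd x = snd (hd (fst a))"
    and "Dom arrG a = (Dom (Sr colG) (fst a), snd a)" "Cod arrG a = (Cod (Sr colG) (fst a), snd a)"
    and "hd (Dom (Sr colG) (fst a)) = snd (hd (fst a))" "hd (Cod (Sr colG) (fst a)) = snd (hd (fst a))"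
proof -
  show f: "fst a \<in> Ar (Sr colG)" using assms by (auto simp: arrG_def fullsub_def prodG_def)
  show "Dom arrG a = (Dom (Sr colG) (fst a), snd a)" "Cod arrG a = (Cod (Sr colG) (fst a), snd a)"
    by (cases a; simp add: arrG_def fullsub_def prodG_def colG_def discrete_def)+
  have D: "set (Dom (Sr colG) (fst a)) = snd ` set (fst a)" "set (Cod (Sr colG) (fst a)) = snd ` set (fst a)"
    using set_Dom_Sr[OF f] set_Cod_Sr[of colG "fst a"] by (simp_all add: colG_def discrete_def image_image)
  obtain c where c: "\<forall>c'\<in>snd ` set (fst a). c' = c"
    using assms D by (cases a) (auto simp: arrG_def fullsub_def prodG_def)
  have ne: "fst a \<noteq> []" using f by (simp add: Ar_Sr)
  then have h: "snd (hd (fst a)) = c" using c by simp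
  show "x \<in> set (fst a) \<Longrightarrow> snd x = snd (hd (fst a))" using c h by simp
  have "Dom (Sr colG) (fst a) \<noteq> []" "Cod (Sr colG) (fst a) \<noteq> []"
    using ne by (metis length_Dom_Sr length_0_conv, metis length_Cod_Sr length_0_conv)
  then show "hd (Dom (Sr colG) (fst a)) = snd (hd (fst a))" "hd (Cod (Sr colG) (fst a)) = snd (hd (fst a))"
    using c h D hd_in_set by metis+
qed

lemma functor_srcF: "is_functor arrG srcF colG"
  unfolding colG_def
proof (rule functor_discrete)
  show "groupoid arrG" by (rule groupoid_arrG)
  fix a assume "a \<in> Ar arrG"
  from Ar_arrG[OF this] show "onAr srcF a = onOb srcF (Dom arrG a) \<and> onAr srcF a = onOb srcF (Cod arrG a)"
    by (simp add: srcF_def)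
qed simp

text \<open>The arrows of an operation share one output colour, and discreteness of the colours
  carries it over to the morphisms, so \<open>outF\<close> may look at the head only.\<close>

lemma Ar_opG:
  assumes "fs \<in> Ar opG"
  shows "fs \<in> Ar (Sr arrG)" "x \<in> set fs \<Longrightarrow> snd (snd x) = snd (snd (hd fs))"
    and "Dom opG fs = Dom (Sr arrG) fs" "Cod opG fs = Cod (Sr arrG) fs"
    and "snd (hd (Dom opG fs)) = snd (snd (hd fs))" "snd (hd (Cod opG fs)) = snd (snd (hd fs))"
proof -
  show f: "fs \<in> Ar (Sr arrG)" using assms by (auto simp: opG_def fullsub_def)
  show E: "Dom opG fs = Dom (Sr arrG) fs" "Cod opG fs = Cod (Sr arrG) fs"
    by (simp_all add: opG_def fullsub_def)
  have s: "snd (Dom arrG a) = snd a" "snd (Cod arrG a) = snd a" for a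
    by (cases a; simp add: arrG_def fullsub_def prodG_def colG_def discrete_def)+
  have D: "snd ` set (Dom (Sr arrG) fs) = snd ` snd ` set fs" "snd ` set (Cod (Sr arrG) fs) = snd ` snd ` set fs"
    using set_Dom_Sr[OF f] set_Cod_Sr[of arrG fs] by (simp_all add: image_image s)
  obtain c where c: "\<forall>f\<in>set (Dom (Sr arrG) fs). snd f = c"
    using assms by (auto simp: opG_def fullsub_def)
  then have c': "\<forall>y\<in>snd ` set (Dom (Sr arrG) fs). y = c" by blast
  have ne: "fs \<noteq> []" using f by (simp add: Ar_Sr)
  have h: "snd (snd x) = c" if "x \<in> set fs" for x using c' that unfolding D by blast
  then show "x \<in> set fs \<Longrightarrow> snd (snd x) = snd (snd (hd fs))" using ne by simp
  have hh: "y = snd (snd (hd fs))" if "y \<in> snd ` snd ` set fs" for y using that h ne by auto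
  have "Dom (Sr arrG) fs \<noteq> []" "Cod (Sr arrG) fs \<noteq> []"
    using ne by (metis length_Dom_Sr length_0_conv, metis length_Cod_Sr length_0_conv)
  then have "snd (hd (Dom (Sr arrG) fs)) \<in> snd ` set (Dom (Sr arrG) fs)"
    "snd (hd (Cod (Sr arrG) fs)) \<in> snd ` set (Cod (Sr arrG) fs)" by simp_all
  note m = this[unfolded D]
  show "snd (hd (Dom opG fs)) = snd (snd (hd fs))" "snd (hd (Cod opG fs)) = snd (snd (hd fs))"
    unfolding E by (rule hh[OF m(1)], rule hh[OF m(2)])
qed

lemma functor_outF: "is_functor opG outF colG"
  unfolding colG_def
proof (rule functor_discrete)
  show "groupoid opG" by (rule groupoid_opG)
  fix a assume "a \<in> Ar opG"
  from Ar_opG[OF this] show "onAr outF a = onOb outF (Dom opG a) \<and> onAr outF a = onOb outF (Cod opG a)"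
    by (simp add: outF_def)
qed simp

text \<open>On the product groupoid the composition is assembled from projections, copying and
  flattening, hence functorial. What remains is that it stays in \<open>arrG\<close>, a full
  subgroupoid, where membership of an arrow follows from that of its ends.\<close>

lemma functor_arr_comp: "is_functor (pullback arrG srcF arrG tgtF) arr_comp arrG"
proof -
  let ?A = "prodG (Sr colG) colG"
  let ?f1 = "\<lparr>onOb = fst, onAr = fst\<rparr>" and ?f2 = "\<lparr>onOb = snd, onAr = snd\<rparr>"
  have 1: "is_functor (prodG ?A ?A) (fcomp (fcomp Sr_mu \<lparr>onOb = (\<lambda>(ys, x). map (\<lambda>_. x) ys), onAr = (\<lambda>(bs, a). map (apsnd (\<lambda>_. a)) bs)\<rparr>)
      \<lparr>onOb = map_prod fst fst, onAr = map_prod fst fst\<rparr>) (Sr colG)"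
    using functor_fcomp[OF functor_prod[OF functor_fst functor_fst] functor_fcomp[OF functor_const_strength functor_Sr_mu]]
    by simp
  have 2: "is_functor (prodG ?A ?A) arr_comp ?A"
    using functor_fpair[OF 1 functor_fcomp[OF functor_fst functor_snd]]
    by (simp add: fcomp_def fpair_def Sr_mu_def comp_def case_prod_unfold arr_comp_def)
  have sub: "subgrpd (pullback arrG srcF arrG tgtF) (prodG ?A ?A)"
    by (auto simp: subgrpd_def pullback_def prodG_def arrG_def fullsub_def)
  have G: "groupoid (pullback arrG srcF arrG tgtF)"
    by (intro groupoid_pullback[where L = colG] groupoid_arrG groupoid_colG functor_srcF functor_tgtF)
  have ob: "onOb arr_comp x \<in> Ob arrG" if "x \<in> Ob (pullback arrG srcF arrG tgtF)" for x
    using that by (cases x) (fastforce simp: arr_comp_def pullback_def arrG_def fullsub_def prodG_def Ob_Sr colG_def discrete_def)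
  have ar: "onAr arr_comp a \<in> Ar arrG" if a: "a \<in> Ar (pullback arrG srcF arrG tgtF)" for a
  proof -
    let ?P = "pullback arrG srcF arrG tgtF"
    have a': "a \<in> Ar (prodG ?A ?A)" using a sub by (auto simp: subgrpd_def)
    have "Dom ?A (onAr arr_comp a) = onOb arr_comp (Dom ?P a)" "Cod ?A (onAr arr_comp a) = onOb arr_comp (Cod ?P a)"
      using functorD(3,4)[OF 2 a'] sub by (simp_all add: subgrpd_def)
    moreover have "onOb arr_comp (Dom ?P a) \<in> Ob arrG" "onOb arr_comp (Cod ?P a) \<in> Ob arrG"
      using ob groupoidD(1,2)[OF G a] by blast+
    ultimately show ?thesis using functorD(2)[OF 2 a'] unfolding arrG_def fullsub_def by auto
  qed
  show ?thesis
    by (rule functor_sub[OF 2 sub]) (use ob ar in \<open>auto simp: arrG_def subgrpd_fullsub\<close>)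
qed

text \<open>This is one block of the operadic composition: the operation \<open>gs\<close> grafted
  onto the arrow f of the root.\<close>

definition graft_arr :: "((two list \<times> two) \<times> (two list \<times> two) list,
    ((nat \<times> two) list \<times> two) \<times> (nat \<times> (nat \<times> two) list \<times> two) list,
    (two list \<times> two) list, (nat \<times> (nat \<times> two) list \<times> two) list) fct" where
  "graft_arr = \<lparr>onOb = (\<lambda>(f, gs). map (\<lambda>g. onOb arr_comp (f, g)) gs),
     onAr = (\<lambda>(f, gs). map (apsnd (\<lambda>g. onAr arr_comp (f, g))) gs)\<rparr>"

lemma functor_graft_arr: "is_functor (pullback arrG srcF opG outF) graft_arr (Sr arrG)"
proof -
  let ?P = "pullback arrG srcF opG outF" and ?Q = "pullback arrG srcF arrG tgtF"
  let ?T = "\<lparr>onOb = (\<lambda>(x, ys). map (Pair x) ys), onAr = (\<lambda>(a, bs). map (apsnd (Pair a)) bs)\<rparr>"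
  have ob: "onOb ?T x \<in> Ob (Sr ?Q)" if "x \<in> Ob ?P" for x
  proof -
    obtain f gs where x: "x = (f, gs)" by (cases x)
    have f: "f \<in> Ob arrG" "gs \<noteq> []" "set gs \<subseteq> Ob arrG" "onOb srcF f = snd (hd gs)" and
      gs: "\<exists>c. \<forall>g\<in>set gs. snd g = c" using that by (auto simp: x pullback_def opG_def fullsub_def Ob_Sr outF_def)
    have "onOb srcF f = snd g" if "g \<in> set gs" for g using gs f(2,4) that hd_in_set by metis
    then have "(f, g) \<in> Ob ?Q" if "g \<in> set gs" for g
      using f(1,3) that by (auto simp: pullback_def tgtF_def)
    then show ?thesis using f(2) by (auto simp: x Ob_Sr)
  qed
  have ar: "onAr ?T a \<in> Ar (Sr ?Q)" if "a \<in> Ar ?P" for a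
  proof -
    obtain f gs where a: "a = (f, gs)" by (cases a)
    have f: "f \<in> Ar arrG" "gs \<in> Ar opG" "onAr srcF f = snd (snd (hd gs))"
      using that by (auto simp: a pullback_def outF_def)
    have e: "onAr srcF f = snd (snd (gs ! i))" if "i < length gs" for i
      using Ar_opG(2)[OF f(2), of "gs ! i"] that f(3) by simp
    have "perm_ok (map (apsnd (Pair f)) gs) = perm_ok gs"
      by (simp add: perm_ok_def image_image comp_def)
    then show ?thesis using Ar_opG(1)[OF f(2)] f(1) e by (simp add: a Ar_Sr pullback_def tgtF_def)
  qed
  have sub: "subgrpd ?P (prodG arrG (Sr arrG))"
    using subgrpd_opG by (auto simp: subgrpd_def pullback_def prodG_def)
  have "is_functor ?P ?T (Sr ?Q)"
    using functor_sub[OF functor_strength[of arrG arrG] sub subgrpd_Sr[OF subgrpd_pullback]] ob ar by blast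
  from functor_fcomp[OF this functor_Sr_map[OF functor_arr_comp]]
  show ?thesis by (simp add: fcomp_def Sr_map_def graft_arr_def comp_def case_prod_unfold apsnd_def map_prod_def)
qed

lemma T_op_Sym2:
  "colours (T_op Sym2) = colG" "opns (T_op Sym2) = opG" "inp (T_op Sym2) = Sr_map srcF" "outp (T_op Sym2) = outF"
  "opunit (T_op Sym2) = \<lparr>onOb = (\<lambda>c. [([c], c)]), onAr = (\<lambda>c. [(0, [(0, c)], c)])\<rparr>"
  by (simp_all add: T_op_def T_low_def T_up_Sym2 opG_def tgtF_def outF_def fcomp_def Sr_eta_def comp_def)

lemma opcomp_T_op_Sym2:
  "opcomp (T_op Sym2) =
     \<lparr>onOb = (\<lambda>(gss, fs). concat (map2 (\<lambda>gs f. onOb graft_arr (f, gs)) gss fs)),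
      onAr = (\<lambda>(gss, fs). flatten (map2 (\<lambda>(p, gs) (_, f). (p, onAr graft_arr (f, gs))) gss fs))\<rparr>"
  by (simp add: T_op_def T_low_def T_up_Sym2 graft_arr_def)

lemma functor_inp: "is_functor opG (Sr_map srcF) (Sr colG)"
  using subgrpd_opG functorD(1,2)[OF functor_Sr_map[OF functor_srcF]]
  by (intro functor_sub[OF functor_Sr_map[OF functor_srcF] subgrpd_opG subgrpd_refl]) (auto simp: subgrpd_def)

text \<open>The composition pairs each root arrow with the operation grafted onto it, applies
  \<open>graft_arr\<close> to every pair and flattens; each stage is functorial. Fullness of
  \<open>opG\<close> reduces membership of arrows to membership of objects.\<close>

lemma functor_opcomp:
  "is_functor (pullback (Sr opG) (Sr_map outF) opG (Sr_map srcF)) (opcomp (T_op Sym2)) opG"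
proof -
  let ?P = "pullback (Sr opG) (Sr_map outF) opG (Sr_map srcF)"
  \<comment> \<open>Zipping needs tuples in both factors, so the common output condition on the root
    operation is dropped until the end.\<close>
  let ?P' = "pullback (Sr opG) (Sr_map outF) (Sr arrG) (Sr_map srcF)"
  have sub: "subgrpd ?P ?P'" using subgrpd_opG by (auto simp: subgrpd_def pullback_def prodG_def)
  have G: "groupoid ?P"
    by (intro groupoid_pullback[where L = "Sr colG"] groupoid_Sr groupoid_opG groupoid_colG functor_Sr_map functor_outF)
      (rule functor_inp)
  have sw: "is_functor (pullback opG outF arrG srcF) \<lparr>onOb = prod.swap, onAr = prod.swap\<rparr> (pullback arrG srcF opG outF)"
    by (auto simp: is_functor_def pullback_def prodG_def)
  have "is_functor ?P' (fcomp Sr_mu (fcomp (Sr_map (fcomp graft_arr \<lparr>onOb = prod.swap, onAr = prod.swap\<rparr>))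
      \<lparr>onOb = (\<lambda>(xs, ys). zip xs ys), onAr = (\<lambda>(as, bs). map2 (\<lambda>(p, a) (_, b). (p, a, b)) as bs)\<rparr>)) (Sr arrG)"
    by (rule functor_fcomp[OF functor_fcomp[OF functor_zip functor_Sr_map[OF functor_fcomp[OF sw functor_graft_arr]]] functor_Sr_mu])
  then have 1: "is_functor ?P' (opcomp (T_op Sym2)) (Sr arrG)"
    by (simp add: opcomp_T_op_Sym2 prod.swap_def fcomp_def Sr_mu_def Sr_map_def comp_def case_prod_unfold apsnd_def map_prod_def)
  have ob: "onOb (opcomp (T_op Sym2)) x \<in> Ob opG" if xP: "x \<in> Ob ?P" for x
  proof -
    obtain gss fs where x: "x = (gss, fs)" by (cases x)
    have 2: "onOb (opcomp (T_op Sym2)) x \<in> Ob (Sr arrG)"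
      using functorD(1)[OF 1, of x] sub xP by (auto simp: subgrpd_def)
    obtain c where c: "\<forall>f\<in>set fs. snd f = c" using xP by (auto simp: x pullback_def opG_def fullsub_def)
    have "snd y = c" if y: "y \<in> set (onOb (opcomp (T_op Sym2)) x)" for y
    proof -
      from y obtain gs f where "(gs, f) \<in> set (zip gss fs)" "y \<in> set (onOb graft_arr (f, gs))"
        by (auto simp: x opcomp_T_op_Sym2)
      then show ?thesis using c by (auto simp: graft_arr_def arr_comp_def dest!: set_zip_rightD)
    qed
    then show ?thesis using 2 by (auto simp: opG_def fullsub_def)
  qed
  have ar: "onAr (opcomp (T_op Sym2)) a \<in> Ar opG" if a: "a \<in> Ar ?P" for a
  proof -
    have a': "a \<in> Ar ?P'" using a sub by (auto simp: subgrpd_def)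
    have "Dom (Sr arrG) (onAr (opcomp (T_op Sym2)) a) = onOb (opcomp (T_op Sym2)) (Dom ?P a)"
      "Cod (Sr arrG) (onAr (opcomp (T_op Sym2)) a) = onOb (opcomp (T_op Sym2)) (Cod ?P a)"
      using functorD(3,4)[OF 1 a'] sub by (simp_all add: subgrpd_def)
    moreover have "onOb (opcomp (T_op Sym2)) (Dom ?P a) \<in> Ob opG" "onOb (opcomp (T_op Sym2)) (Cod ?P a) \<in> Ob opG"
      using ob groupoidD(1,2)[OF G a] by blast+
    ultimately show ?thesis using functorD(2)[OF 1 a'] unfolding opG_def fullsub_def by auto
  qed
  show ?thesis by (rule functor_sub[OF 1 sub]) (use ob ar in \<open>auto simp: opG_def subgrpd_fullsub\<close>)
qed

section \<open>The low levels of the bar construction\<close>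

abbreviation T2 where "T2 \<equiv> T_op Sym2"

type_synonym lev = "(two, (two list \<times> two) list) level"
type_synonym lar = "(two, (nat \<times> (nat \<times> two) list \<times> two) list) larr"

definition barG0 :: "(lev, lar) grpd" where "barG0 = relabel Colour un_Colour ColourA un_ColourA colG"
definition barG1 :: "(lev, lar) grpd" where "barG1 = relabel Oper un_Oper OperA un_OperA opG"
definition prebarG2 :: "(lev list \<times> (two list \<times> two) list, (nat \<times> lar) list \<times> (nat \<times> (nat \<times> two) list \<times> two) list) grpd" where
  "prebarG2 = pullback (Sr barG1) (Sr_map (root_out T2)) opG (Sr_map srcF)"
definition barG2 :: "(lev, lar) grpd" where "barG2 = relabel Graft un_Graft GraftA un_GraftA prebarG2"

lemma barQ_T2: "barQ T2 0 = barG0" "barQ T2 1 = barG1" "barQ T2 (Suc 0) = barG1" "barQ T2 2 = barG2"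
  by (simp_all add: barG0_def barG1_def barG2_def prebarG2_def T_op_Sym2 numeral_2_eq_2)

lemma subgrpd_prebarG2: "subgrpd prebarG2 (prodG (Sr barG1) opG)"
  unfolding prebarG2_def by (rule subgrpd_pullback)

lemma functor_root: "is_functor barG1 (root_out T2) colG"
  unfolding barG1_def
  by (rule functor_relabel_dom) (use functor_outF in \<open>simp_all add: root_out_def T_op_Sym2 outF_def comp_def\<close>)

lemma groupoid_barG0: "groupoid barG0"
  unfolding barG0_def by (rule groupoid_relabel) (simp_all add: groupoid_colG)

lemma groupoid_barG1: "groupoid barG1"
  unfolding barG1_def by (rule groupoid_relabel) (simp_all add: groupoid_opG)

lemma groupoid_prebarG2: "groupoid prebarG2"
  unfolding prebarG2_def
  by (intro groupoid_pullback[where L = "Sr colG"] groupoid_Sr groupoid_barG1 groupoid_opG groupoid_colG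
      functor_Sr_map functor_root functor_inp)

lemma groupoid_barG2: "groupoid barG2"
  unfolding barG2_def by (rule groupoid_relabel) (simp_all add: groupoid_prebarG2)

lemma functor_un_Oper: "is_functor barG1 \<lparr>onOb = un_Oper, onAr = un_OperA\<rparr> opG"
  unfolding barG1_def
  by (rule functor_relabel_dom) (auto simp: is_functor_def)

lemma functor_face_comp: "is_functor barG2 (qface T2 2 1) barG1"
proof -
  \<comment> \<open>Strips the constructor \<open>Oper\<close> from the grafted operations, leading
    to the pullback on which the operadic composition is a functor.\<close>
  let ?M = "\<lparr>onOb = map_prod (map un_Oper) (\<lambda>x. x), onAr = map_prod (map (apsnd un_OperA)) (\<lambda>x. x)\<rparr>"
  let ?P = "pullback (Sr opG) (Sr_map outF) opG (Sr_map srcF)"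
  have I: "is_functor opG \<lparr>onOb = (\<lambda>x. x), onAr = (\<lambda>x. x)\<rparr> opG" by (simp add: is_functor_def)
  have "is_functor (prodG (Sr barG1) opG) ?M (prodG (Sr opG) opG)"
    using functor_prod[OF functor_Sr_map[OF functor_un_Oper] I] by (simp add: Sr_map_def)
  moreover have ob: "onOb ?M x \<in> Ob ?P" if x: "x \<in> Ob prebarG2" for x
  proof -
    obtain xs fs where xx: "x = (xs, fs)" by (cases x)
    have "\<forall>y\<in>set xs. \<exists>q. y = Oper q \<and> q \<in> Ob opG"
      using x by (auto simp: xx prebarG2_def pullback_def barG1_def relabel_def Ob_Sr)
    then have e: "map (onOb outF) (map un_Oper xs) = map (onOb (root_out T2)) xs" and o: "set (map un_Oper xs) \<subseteq> Ob opG"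
      by (auto simp: root_out_def T_op_Sym2)
    have "map (onOb (root_out T2)) xs = map (onOb srcF) fs"
      using x by (simp add: xx prebarG2_def pullback_def Sr_map_def)
    from trans[OF e this] o show ?thesis using x by (auto simp: xx prebarG2_def pullback_def Ob_Sr Sr_map_def)
  qed
  moreover have ar: "onAr ?M a \<in> Ar ?P" if a: "a \<in> Ar prebarG2" for a
  proof -
    obtain xs fs where xx: "a = (xs, fs)" by (cases a)
    have s: "xs \<in> Ar (Sr barG1)" using a by (auto simp: xx prebarG2_def pullback_def)
    have "\<forall>y\<in>set xs. \<exists>q. snd y = OperA q"
      using s by (auto simp: Ar_Sr barG1_def relabel_def in_set_conv_nth) (metis imageE snd_conv)
    then have "onAr (Sr_map outF) (map (apsnd un_OperA) xs) = onAr (Sr_map (root_out T2)) xs"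
      by (auto simp: root_out_def T_op_Sym2 Sr_map_def apsnd_def map_prod_def)
    also have "\<dots> = onAr (Sr_map srcF) fs" using a by (simp add: xx prebarG2_def pullback_def)
    finally have "onAr (Sr_map outF) (map (apsnd un_OperA) xs) = onAr (Sr_map srcF) fs" .
    moreover have "map (apsnd un_OperA) xs \<in> Ar (Sr opG)"
      using functorD(2)[OF functor_Sr_map[OF functor_un_Oper] s] by (simp add: Sr_map_def)
    ultimately show ?thesis using a by (simp add: xx prebarG2_def pullback_def)
  qed
  ultimately have "is_functor prebarG2 ?M ?P"
    by (intro functor_sub[OF _ subgrpd_prebarG2 subgrpd_pullback]) auto
  from functor_fcomp[OF this functor_opcomp]
  have "is_functor prebarG2 (fcomp (opcomp T2) ?M) opG" .
  from functor_relabel_cod[OF this, where i = Oper and i' = un_Oper and j = OperA and j' = un_OperA]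
  have "is_functor prebarG2 \<lparr>onOb = Oper \<circ> (onOb (opcomp T2) \<circ> map_prod (map un_Oper) (\<lambda>x. x)),
      onAr = OperA \<circ> (onAr (opcomp T2) \<circ> map_prod (map (apsnd un_OperA)) (\<lambda>x. x))\<rparr> barG1"
    by (simp add: barG1_def fcomp_def)
  then show ?thesis unfolding barG2_def
    by (intro functor_relabel_dom) (simp_all add: numeral_2_eq_2 fcomp_def comp_def Sr_map_def case_prod_unfold map_prod_def)
qed

lemma functor_face_root: "is_functor barG2 (qface T2 2 0) barG1"
proof -
  have "is_functor (prodG (Sr barG1) opG) \<lparr>onOb = snd, onAr = snd\<rparr> opG" by (rule functor_snd)
  then have "is_functor prebarG2 \<lparr>onOb = snd, onAr = snd\<rparr> opG"
    by (rule functor_sub[OF _ subgrpd_prebarG2 subgrpd_refl]) (auto simp: prebarG2_def pullback_def)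
  from functor_relabel_cod[OF this, where i = Oper and i' = un_Oper and j = OperA and j' = un_OperA]
  have "is_functor prebarG2 \<lparr>onOb = Oper \<circ> snd, onAr = OperA \<circ> snd\<rparr> barG1"
    by (simp add: barG1_def)
  then show ?thesis unfolding barG2_def
    by (intro functor_relabel_dom) (simp_all add: numeral_2_eq_2 comp_def)
qed

lemma functor_cut: "is_functor barG2 (qcut T2 2) (Sr barG1)"
proof -
  have "is_functor (prodG (Sr barG1) opG) \<lparr>onOb = fst, onAr = fst\<rparr> (Sr barG1)" by (rule functor_fst)
  then have "is_functor prebarG2 \<lparr>onOb = fst, onAr = fst\<rparr> (Sr barG1)"
    by (rule functor_sub[OF _ subgrpd_prebarG2 subgrpd_refl]) (auto simp: prebarG2_def pullback_def)
  then show ?thesis unfolding barG2_def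
    by (intro functor_relabel_dom) (simp_all add: numeral_2_eq_2 comp_def)
qed

lemma functor_unit: "is_functor barG0 (qdegen T2 0 0) barG1"
proof -
  have a: "([(0, c)], c) \<in> Ar arrG" "([c], c) \<in> Ob arrG"
    "Dom arrG ([(0, c)], c) = ([c], c)" "Cod arrG ([(0, c)], c) = ([c], c)"
    "Cmp arrG ([(0, c)], c) ([(0, c)], c) = ([(0, c)], c)" for c
    by (auto simp: arrG_def fullsub_def prodG_def colG_def discrete_def Sr_def component_def)
  have o: "[(0, ([(0, c)], c))] \<in> Ar opG" "[([c], c)] \<in> Ob opG"
    "Dom opG [(0, ([(0, c)], c))] = [([c], c)]" "Cod opG [(0, ([(0, c)], c))] = [([c], c)]"
    "Cmp opG [(0, ([(0, c)], c))] [(0, ([(0, c)], c))] = [(0, ([(0, c)], c))]" for c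
    using a[of c] by (auto simp: opG_def fullsub_def Sr_def component_def)
  have "is_functor colG (opunit T2) opG"
    using o by (auto simp: T_op_Sym2 is_functor_def colG_def discrete_def)
  then have "is_functor colG \<lparr>onOb = Oper \<circ> onOb (opunit T2), onAr = OperA \<circ> onAr (opunit T2)\<rparr> barG1"
    unfolding barG1_def by (rule functor_relabel_cod) simp_all
  then show ?thesis unfolding barG0_def by (intro functor_relabel_dom) (simp_all add: comp_def)
qed

section \<open>Operations as lists of variables\<close>

text \<open>The list \<open>[(c\<^sub>1, k\<^sub>1), \<dots>]\<close> encodes the operation of \<open>T_op Sym2\<close> with output \<open>i\<close> whose \<open>j\<close>-th arrow
  is the operation of \<open>Sym2\<close> with \<open>k\<^sub>j\<close> inputs of colour \<open>c\<^sub>j\<close>.\<close>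

definition posl :: "(two \<times> nat) list set" where
  "posl = {ks. ks \<noteq> [] \<and> (\<forall>(c, k)\<in>set ks. 0 < k)}"

definition enc_op :: "two \<Rightarrow> (two \<times> nat) list \<Rightarrow> (two list \<times> two) list" where
  "enc_op i ks = map (\<lambda>(c, k). (replicate k c, i)) ks"

definition dec_op :: "(two list \<times> two) list \<Rightarrow> two \<times> (two \<times> nat) list" where
  "dec_op fs = (snd (hd fs), map (\<lambda>(cs, y). (hd cs, length cs)) fs)"

text \<open>The number of arrows of \<open>opG\<close> out of the encoded operation
  (\<open>deg_opG\<close>): permutations of its entries and, for each entry (c, k), permutations of
  its k inputs.\<close>

definition wt :: "(two \<times> nat) list \<Rightarrow> nat" where
  "wt ks = fact (length ks) * prod_list (map (\<lambda>(c, k). fact k) ks)"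

lemma dec_enc_op: "ks \<in> posl \<Longrightarrow> dec_op (enc_op i ks) = (i, ks)"
  by (cases ks) (auto simp: dec_op_def enc_op_def posl_def case_prod_unfold intro!: map_idI)

lemma Ob_colG: "Ob (Sr colG) = {xs. xs \<noteq> []}"
  by (simp add: Ob_Sr colG_def discrete_def)

lemma Ob_arrG: "Ob arrG = {(cs, y). cs \<noteq> [] \<and> (\<exists>c. \<forall>c'\<in>set cs. c' = c)}"
  by (auto simp: arrG_def fullsub_def prodG_def Ob_colG) (auto simp: colG_def discrete_def)

lemma Ob_opG: "Ob opG = {fs. fs \<noteq> [] \<and> set fs \<subseteq> Ob arrG \<and> (\<exists>c. \<forall>f\<in>set fs. snd f = c)}"
  by (auto simp: opG_def fullsub_def Ob_Sr)

lemma enc_op_Ob: "ks \<in> posl \<Longrightarrow> enc_op i ks \<in> Ob opG"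
  by (fastforce simp: Ob_opG Ob_arrG enc_op_def posl_def)

lemma enc_dec_op:
  assumes "fs \<in> Ob opG"
  shows "enc_op (fst (dec_op fs)) (snd (dec_op fs)) = fs" "snd (dec_op fs) \<in> posl"
proof -
  obtain c where c: "fs \<noteq> []" "set fs \<subseteq> Ob arrG" "\<And>f. f \<in> set fs \<Longrightarrow> snd f = c" using assms by (auto simp: Ob_opG)
  have r: "replicate (length cs) (hd cs) = cs" if "(cs, y) \<in> Ob arrG" for cs y
  proof -
    obtain d where "cs \<noteq> []" "\<forall>c'\<in>set cs. c' = d" using \<open>(cs, y) \<in> Ob arrG\<close> by (auto simp: Ob_arrG)
    then have "replicate (length cs) d = cs" "hd cs = d" by (simp_all add: replicate_length_same)
    then show ?thesis by simp
  qed
  have "(\<lambda>(cs, y). (replicate (length cs) (hd cs), snd (hd fs))) f = f" if "f \<in> set fs" for f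
    using r[of "fst f" "snd f"] c that by (cases f) auto
  then show "enc_op (fst (dec_op fs)) (snd (dec_op fs)) = fs"
    by (simp add: enc_op_def dec_op_def comp_def case_prod_unfold map_idI)
  show "snd (dec_op fs) \<in> posl"
    using c by (auto simp: posl_def dec_op_def Ob_arrG subset_iff)
qed

lemma deg_colG: "deg colG c = 1" "finite (outs colG c)"
  by (simp_all add: deg_def colG_def outs_discrete)

lemma prod_list_one: "(\<And>x. x \<in> set xs \<Longrightarrow> f x = 1) \<Longrightarrow> prod_list (map f xs) = (1 :: nat)"
  by (induction xs) auto

lemma classifies_prodG:
  assumes G: "classifies G t" and H: "classifies H u"
  shows "classifies (prodG G H) (map_prod t u)"
proof -
  have "Ob (prodG G H) = Ob G \<times> Ob H" by (simp add: prodG_def)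
  then show ?thesis using assms unfolding classifies_def hom_prodG by auto
qed

lemma deg_arrG:
  assumes "f \<in> Ob arrG"
  shows "deg arrG f = fact (length (fst f))" "finite (outs arrG f)"
proof -
  obtain cs y where f: "f = (cs, y)" by (cases f)
  have cs: "cs \<noteq> []" "\<exists>c. \<forall>c'\<in>set cs. c' = c" using assms by (auto simp: f Ob_arrG)
  \<comment> \<open>Having constant colour is invariant under isomorphism, so the arrows out of f in
    the full subgroupoid are all those in the product.\<close>
  have const: "\<exists>c. \<forall>c'\<in>set (fst z). c' = c" if "hom (prodG (Sr colG) colG) f z \<noteq> {}" for z
  proof -
    have ne: "hom (Sr colG) cs (fst z) \<noteq> {}" using that by (auto simp: hom_prodG f)
    then have "fst z \<in> Ob (Sr colG)"
      by (rule hom_Ob(2)[OF groupoid_Sr[OF groupoid_colG]])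
    moreover have "cs \<in> Ob (Sr colG)" using cs by (simp add: Ob_colG)
    ultimately have "mset cs = mset (fst z)"
      using ne classifiesD[OF classifies_Sr[OF classifies_discrete[of UNIV] groupoid_discrete], of cs "fst z"]
      by (simp add: colG_def)
    then show ?thesis using cs(2) mset_eq_setD by metis
  qed
  have "outs arrG f = outs (prodG (Sr colG) colG) f"
    unfolding arrG_def by (rule outs_fullsub) (use cs const in \<open>simp_all add: f\<close>)
  then have o: "outs arrG f = outs (Sr colG) cs \<times> outs colG y" by (simp add: outs_prodG f)
  have "deg (Sr colG) cs = fact (length cs)"
    using deg_Sr(1)[OF cs(1), of colG] prod_list_one[of cs "deg colG"] deg_colG by simp
  then show "deg arrG f = fact (length (fst f))"
    using deg_colG(1)[of y] unfolding deg_def o card_cartesian_product by (simp add: f)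
  show "finite (outs arrG f)" using o deg_Sr(2)[OF cs(1), of colG] deg_colG by simp
qed

text \<open>Input tuples are classified by their multisets of colours, and for a constant tuple the
  multiset amounts to the colour and the length.\<close>

lemma classifies_arrG: "classifies arrG (\<lambda>(cs, y). ((hd cs, length cs), y))"
proof -
  have 1: "classifies (prodG (Sr colG) colG) (\<lambda>(cs, y). (mset cs, y))"
    using classifies_prodG[OF classifies_Sr[OF classifies_discrete[of "UNIV :: two set"] groupoid_discrete]
        classifies_discrete[of "UNIV :: two set"]]
    by (simp add: colG_def map_prod_def)
  have "classifies arrG (\<lambda>(cs, y). (mset cs, y))"
    using 1 unfolding classifies_def arrG_def
    by (auto simp: fullsub_def[THEN arg_cong[of _ _ Ob]] hom_fullsub)
  then show ?thesis
  proof (rule classifies_cong)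
    fix p q assume pq: "p \<in> Ob arrG" "q \<in> Ob arrG"
    obtain cs y ds y' where p: "p = (cs, y)" and q: "q = (ds, y')" by (cases p; cases q)
    obtain c d where c: "cs \<noteq> []" "\<forall>c'\<in>set cs. c' = c" and d: "ds \<noteq> []" "\<forall>c'\<in>set ds. c' = d"
      using pq by (auto simp: p q Ob_arrG)
    then have e: "cs = replicate (length cs) c" "ds = replicate (length ds) d" by (simp_all add: replicate_length_same)
    have h: "hd cs = c" "hd ds = d" using c d by simp_all
    have "mset cs = mset ds \<longleftrightarrow> c = d \<and> length cs = length ds"
      using c d e by (metis hd_in_set mset_eq_length mset_eq_setD)
    then show "((case p of (cs, y) \<Rightarrow> (mset cs, y)) = (case q of (cs, y) \<Rightarrow> (mset cs, y))) =
      ((case p of (cs, y) \<Rightarrow> ((hd cs, length cs), y)) = (case q of (cs, y) \<Rightarrow> ((hd cs, length cs), y)))"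
      by (simp add: h p q)
  qed
qed

text \<open>The monomial of a word. It serves for words in the variables (c, k) and for words in the
  generators alike, and equality of monomials is equality of multisets
  (\<open>monl_eq_iff\<close>).\<close>

definition monl :: "'v list \<Rightarrow> ('v \<Rightarrow>\<^sub>0 nat)" where
  "monl xs = sum_list (map (\<lambda>v. Poly_Mapping.single v 1) xs)"

lemma lookup_monl: "Poly_Mapping.lookup (monl xs) v = count (mset xs) v"
  by (induction xs) (auto simp: monl_def lookup_add lookup_single when_def)

lemma monl_eq_iff: "monl xs = monl ys \<longleftrightarrow> mset xs = mset ys"
  by (simp add: poly_mapping_eq_iff multiset_eq_iff fun_eq_iff lookup_monl)

definition op_type :: "(two list \<times> two) list \<Rightarrow> gen" where
  "op_type fs = (fst (dec_op fs), monl (snd (dec_op fs)))"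

lemma op_type_enc: "ks \<in> posl \<Longrightarrow> op_type (enc_op i ks) = (i, monl ks)"
  by (simp add: op_type_def dec_enc_op)

lemma opG_hom: "x \<in> Ob opG \<Longrightarrow> y \<in> Ob opG \<Longrightarrow> hom opG x y = hom (Sr arrG) x y"
  unfolding opG_def by (rule hom_fullsub) (auto simp: fullsub_def)

text \<open>The general classification of tuples labels every variable with the output i. As the
  list is nonempty, i can be recovered from one label, and the rest is the multiset of
  variables.\<close>

lemma classifies_opG: "classifies opG op_type"
proof -
  let ?t = "\<lambda>fs. mset (map (\<lambda>(cs, y). ((hd cs, length cs), y)) fs) :: ((two \<times> nat) \<times> two) multiset"
  have "classifies opG ?t"
    using classifies_Sr[OF classifies_arrG groupoid_arrG] opG_hom unfolding classifies_def
    by (auto simp: Ob_opG Ob_Sr)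
  then show ?thesis
  proof (rule classifies_cong)
    fix x y assume x: "x \<in> Ob opG" and y: "y \<in> Ob opG"
    obtain i ks where X: "x = enc_op i ks" "ks \<in> posl" using enc_dec_op[OF x] by metis
    obtain j ls where Y: "y = enc_op j ls" "ls \<in> posl" using enc_dec_op[OF y] by metis
    have T: "?t (enc_op i ks) = image_mset (\<lambda>v. (v, i)) (mset ks)" if "ks \<in> posl" for i ks
    proof -
      have "map (\<lambda>(cs, y). ((hd cs, length cs), y)) (enc_op i ks) = map (\<lambda>v. (v, i)) ks"
        using that by (auto simp: enc_op_def posl_def)
      then show ?thesis by simp
    qed
    have "image_mset (\<lambda>v. (v, i)) (mset ks) = image_mset (\<lambda>v. (v, j)) (mset ls) \<longleftrightarrow> i = j \<and> mset ks = mset ls"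
    proof
      assume e: "image_mset (\<lambda>v. (v, i)) (mset ks) = image_mset (\<lambda>v. (v, j)) (mset ls)"
      from arg_cong[OF e, of "image_mset fst"] have "mset ks = mset ls" by (simp add: multiset.map_comp comp_def)
      moreover obtain v where "v \<in># mset ks" using X(2) by (cases ks) (auto simp: posl_def)
      then have "(v, i) \<in># image_mset (\<lambda>v. (v, j)) (mset ls)" using e by (metis image_eqI set_image_mset)
      then have "i = j" by auto
      ultimately show "i = j \<and> mset ks = mset ls" by simp
    qed simp
    then show "(?t x = ?t y) = (op_type x = op_type y)"
      using T[OF X(2)] T[OF Y(2)] by (simp only: X Y op_type_enc[OF X(2)] op_type_enc[OF Y(2)] prod.inject monl_eq_iff)
  qed
qed

lemma deg_opG:
  assumes ks: "ks \<in> posl"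
  shows "deg opG (enc_op i ks) = wt ks" "finite (outs opG (enc_op i ks))"
proof -
  let ?x = "enc_op i ks"
  have x: "?x \<in> Ob opG" by (rule enc_op_Ob[OF ks])
  then have ne: "?x \<noteq> []" and sub: "set ?x \<subseteq> Ob arrG" by (auto simp: Ob_opG)
  have s: "f \<in> set y \<Longrightarrow> snd f = i" if h: "hom (Sr arrG) ?x y \<noteq> {}" for f y
  proof -
    have xo: "?x \<in> Ob (Sr arrG)" using ne sub by (simp add: Ob_Sr)
    moreover have yo: "y \<in> Ob (Sr arrG)"
      by (rule hom_Ob(2)[OF groupoid_Sr[OF groupoid_arrG] h])
    ultimately have "mset (map (\<lambda>(cs, y). ((hd cs, length cs), y)) ?x) = mset (map (\<lambda>(cs, y). ((hd cs, length cs), y)) y)"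
      using classifiesD[OF classifies_Sr[OF classifies_arrG groupoid_arrG], of ?x y] h by simp
    from mset_eq_setD[OF this] have "(\<lambda>(cs, y). ((hd cs, length cs), y)) ` set ?x = (\<lambda>(cs, y). ((hd cs, length cs), y)) ` set y"
      by simp
    then have "snd ` (\<lambda>(cs, y). ((hd cs, length cs), y)) ` set ?x = snd ` (\<lambda>(cs, y). ((hd cs, length cs), y)) ` set y"
      by (rule arg_cong)
    then have "snd ` set ?x = snd ` set y" by (simp add: image_image case_prod_unfold)
    moreover have "snd ` set ?x \<subseteq> {i}" by (auto simp: enc_op_def)
    ultimately show "snd f = i" if "f \<in> set y" for f using that by blast
  qed
  have o: "outs opG ?x = outs (Sr arrG) ?x"
    unfolding opG_def
  proof (rule outs_fullsub)
    show "\<exists>c. \<forall>f\<in>set ?x. snd f = c" using x by (auto simp: Ob_opG)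
    show "\<exists>c. \<forall>f\<in>set y. snd f = c" if "hom (Sr arrG) ?x y \<noteq> {}" for y
      using s[OF that] by blast
  qed
  have M: "map (deg arrG) ?x = map (\<lambda>(c, k). fact k) ks"
  proof (rule nth_equalityI)
    fix j assume "j < length (map (deg arrG) ?x)"
    then have j: "j < length ks" by (simp add: enc_op_def)
    then have "?x ! j \<in> Ob arrG" using sub by (auto simp: enc_op_def)
    then show "map (deg arrG) ?x ! j = map (\<lambda>(c, k). fact k) ks ! j"
      using j deg_arrG(1)[of "?x ! j"] by (simp add: enc_op_def case_prod_unfold)
  qed (simp add: enc_op_def)
  have "deg (Sr arrG) ?x = wt ks"
    unfolding deg_Sr(1)[OF ne] M wt_def by (simp add: enc_op_def)
  then show "deg opG ?x = wt ks" by (simp add: deg_def o)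
  show "finite (outs opG ?x)" unfolding o
    using deg_Sr(2)[OF ne, of arrG] deg_arrG(2) sub by blast
qed

section \<open>Two-level trees as lists\<close>

text \<open>A pair \<open>((c, k), t)\<close> in the list is an arrow of the root operation, with \<open>k\<close> inputs of colour \<open>c\<close>,
  together with the operation grafted onto it.\<close>

type_synonym tree2 = "((two \<times> nat) \<times> (two \<times> nat) list) list"

definition post :: "tree2 set" where
  "post = {zs. zs \<noteq> [] \<and> (\<forall>((c, k), t)\<in>set zs. 0 < k \<and> t \<in> posl)}"

text \<open>The operation t takes its output colour c from the root arrow it is grafted onto, which
  is why a \<open>tree2\<close> does not store it separately.\<close>

definition enc_leaves :: "tree2 \<Rightarrow> lev list" where
  "enc_leaves zs = map (\<lambda>((c, k), t). Oper (enc_op c t)) zs"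

definition enc_tree :: "two \<Rightarrow> tree2 \<Rightarrow> lev" where
  "enc_tree i zs = Graft (enc_leaves zs, enc_op i (map fst zs))"

definition comp_tree :: "tree2 \<Rightarrow> (two \<times> nat) list" where
  "comp_tree zs = concat (map (\<lambda>((c, k), t). map (\<lambda>(e, j). (e, k * j)) t) zs)"

lemma post_root: "zs \<in> post \<Longrightarrow> map fst zs \<in> posl"
  by (auto simp: post_def posl_def)

lemma comp_tree_posl: "zs \<in> post \<Longrightarrow> comp_tree zs \<in> posl"
  by (cases zs) (fastforce simp: post_def posl_def comp_tree_def)+

lemma Ob_barG1: "Ob barG1 = Oper ` Ob opG"
  by (simp add: barG1_def relabel_def)

lemma outs_barG1: "outs barG1 (Oper x) = OperA ` outs opG x"
  unfolding barG1_def by (rule outs_relabel) simp_all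

lemma deg_barG1: "deg barG1 (Oper x) = deg opG x" "finite (outs barG1 (Oper x)) = finite (outs opG x)"
  by (simp_all add: deg_def outs_barG1 card_image finite_image_iff inj_on_def)

lemma prebarG2_Ob:
  "(xs, fs) \<in> Ob prebarG2 \<longleftrightarrow> xs \<in> Ob (Sr barG1) \<and> fs \<in> Ob opG \<and> map (onOb (root_out T2)) xs = map (onOb srcF) fs"
  by (simp add: prebarG2_def pullback_def Sr_map_def)

lemma enc_leaves_Ob: "zs \<in> post \<Longrightarrow> enc_leaves zs \<in> Ob (Sr barG1)"
  by (fastforce simp: Ob_Sr Ob_barG1 enc_leaves_def post_def intro: enc_op_Ob)

lemma root_enc_op: "ks \<in> posl \<Longrightarrow> onOb (root_out T2) (Oper (enc_op i ks)) = i"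
  by (cases ks) (auto simp: root_out_def T_op_Sym2 outF_def enc_op_def posl_def)

lemma src_enc_op: "ks \<in> posl \<Longrightarrow> map (onOb srcF) (enc_op i ks) = map fst ks"
  by (auto simp: srcF_def enc_op_def posl_def)

lemma enc_tree_Ob:
  assumes "zs \<in> post"
  shows "(enc_leaves zs, enc_op i (map fst zs)) \<in> Ob prebarG2"
proof -
  have "map (onOb (root_out T2)) (enc_leaves zs) = map (fst \<circ> fst) zs"
    using assms by (auto simp: enc_leaves_def post_def root_enc_op)
  then show ?thesis
    using enc_leaves_Ob[OF assms] post_root[OF assms] by (simp add: prebarG2_Ob enc_op_Ob src_enc_op)
qed

definition dec_tree :: "lev \<Rightarrow> two \<times> tree2" where
  "dec_tree x = (case un_Graft x of (xs, fs) \<Rightarrow>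
     (fst (dec_op fs), zip (snd (dec_op fs)) (map (\<lambda>y. snd (dec_op (un_Oper y))) xs)))"

lemma dec_enc_tree: "zs \<in> post \<Longrightarrow> dec_tree (enc_tree i zs) = (i, zs)"
proof -
  assume z: "zs \<in> post"
  have "map (\<lambda>y. snd (dec_op (un_Oper y))) (enc_leaves zs) = map snd zs"
    using z by (auto simp: enc_leaves_def post_def dec_enc_op)
  then show ?thesis using dec_enc_op[OF post_root[OF z]]
    by (simp add: dec_tree_def enc_tree_def zip_map_fst_snd)
qed

lemma Ob_barG2: "Ob barG2 = Graft ` Ob prebarG2"
  by (simp add: barG2_def relabel_def)

lemma enc_dec_tree:
  assumes "x \<in> Ob barG2"
  shows "enc_tree (fst (dec_tree x)) (snd (dec_tree x)) = x" "snd (dec_tree x) \<in> post"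
proof -
  obtain xs fs where x: "x = Graft (xs, fs)" and o: "(xs, fs) \<in> Ob prebarG2" using assms by (auto simp: Ob_barG2)
  then have xs: "xs \<noteq> []" "set xs \<subseteq> Oper ` Ob opG" and fs: "fs \<in> Ob opG"
    and m: "map (onOb (root_out T2)) xs = map (onOb srcF) fs" by (auto simp: prebarG2_Ob Ob_Sr Ob_barG1)
  define i where "i = fst (dec_op fs)"
  define ks where "ks = snd (dec_op fs)"
  have ks: "fs = enc_op i ks" "ks \<in> posl" using enc_dec_op[OF fs] by (simp_all add: i_def ks_def)
  define ts where "ts = map (\<lambda>y. snd (dec_op (un_Oper y))) xs"
  have l: "length xs = length ks" using arg_cong[OF m, of length] by (simp add: ks(1) enc_op_def)
  have d: "dec_tree x = (i, zip ks ts)" by (simp add: x dec_tree_def i_def ks_def ts_def)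
  \<comment> \<open>The pullback condition says that the outputs of the grafted operations are the
    input colours of the root arrows; hence the output decoded from entry j is the colour in
    \<open>ks ! j\<close>.\<close>
  have t: "ts ! j \<in> posl \<and> xs ! j = Oper (enc_op (fst (ks ! j)) (ts ! j))" if j: "j < length ks" for j
  proof -
    have "xs ! j \<in> set xs" using j l by simp
    then obtain q where q: "xs ! j = Oper q" "q \<in> Ob opG" using xs(2) by blast
    have "onOb (root_out T2) (xs ! j) = onOb srcF (fs ! j)"
      using arg_cong[OF m, of "\<lambda>l. l ! j"] j l by (simp add: ks(1) enc_op_def)
    also have "\<dots> = fst (ks ! j)"
      using arg_cong[OF src_enc_op[OF ks(2), of i], of "\<lambda>l. l ! j"] j by (simp add: ks(1) enc_op_def)
    finally have "fst (dec_op q) = fst (ks ! j)"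
      using root_enc_op[OF enc_dec_op(2)[OF q(2)], of "fst (dec_op q)"] enc_dec_op(1)[OF q(2)] q(1) by simp
    then show ?thesis using enc_dec_op[OF q(2)] q(1) j l by (simp add: ts_def)
  qed
  show "snd (dec_tree x) \<in> post"
    unfolding d post_def
  proof (clarsimp, intro conjI ballI)
    show "ks \<noteq> []" "ts \<noteq> []" using ks(2) xs(1) by (auto simp: posl_def ts_def)
    fix u assume "u \<in> set (zip ks ts)"
    then obtain j where j: "j < length ks" "u = (ks ! j, ts ! j)" by (auto simp: set_zip)
    have "0 < snd (ks ! j)" using ks(2) nth_mem[OF j(1)] by (auto simp: posl_def split_beta)
    then show "case u of (p, t) \<Rightarrow> (case p of (c, k) \<Rightarrow> \<lambda>t. 0 < k \<and> t \<in> posl) t"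
      using t[OF j(1)] j(2) by (simp add: split_beta)
  qed
  have "enc_leaves (zip ks ts) = xs"
    using t l by (intro nth_equalityI) (auto simp: enc_leaves_def ts_def case_prod_unfold)
  then show "enc_tree (fst (dec_tree x)) (snd (dec_tree x)) = x"
    unfolding d using l by (simp add: enc_tree_def x ks(1) ts_def)
qed

lemma bij_enc_tree: "bij_betw (\<lambda>(i, zs). enc_tree i zs) (UNIV \<times> post) (Ob barG2)"
proof (rule bij_betw_byWitness[where f' = dec_tree])
  show "dec_tree ` Ob barG2 \<subseteq> UNIV \<times> post" using enc_dec_tree(2) by (simp add: image_subset_iff mem_Times_iff)
  show "(\<lambda>(i, zs). enc_tree i zs) ` (UNIV \<times> post) \<subseteq> Ob barG2"
    using enc_tree_Ob by (auto simp: Ob_barG2 enc_tree_def)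
qed (use enc_dec_tree(1) in \<open>auto simp: dec_enc_tree split_beta\<close>)

text \<open>Over a discrete base, arrows out of a matching pair of tuples agree in the base as soon
  as their permutations do. The arrow in the second factor therefore fixes the permutation, and the
  first factor is left with independent choices of components.\<close>

lemma outs_pullback_Sr:
  assumes F: "is_functor A F (discrete K)" and H: "is_functor B H (discrete K)"
    and B': "subgrpd B' (Sr B)" and o: "(xs, ys) \<in> Ob (pullback (Sr A) (Sr_map F) B' (Sr_map H))"
  shows "bij_betw (\<lambda>(\<beta>, as). (map (\<lambda>p. (p, as ! p)) (map fst \<beta>), \<beta>))
    (outs B' ys \<times> {as. list_all2 (\<lambda>a x. a \<in> outs A x) as xs})
    (outs (pullback (Sr A) (Sr_map F) B' (Sr_map H)) (xs, ys))"
proof -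
  let ?P = "pullback (Sr A) (Sr_map F) B' (Sr_map H)" and ?L = "{as. list_all2 (\<lambda>a x. a \<in> outs A x) as xs}"
  let ?h = "\<lambda>(\<sigma>, as). map (\<lambda>p. (p, as ! p)) \<sigma>"
  from o have xs: "xs \<noteq> []" and m: "map (onOb F) xs = map (onOb H) ys"
    by (auto simp: pullback_def Ob_Sr Sr_map_def)
  have l: "length ys = length xs" using arg_cong[OF m, of length] by simp
  note b = outs_Sr[OF xs, of A]
  have colour: "onAr F a = onOb F (Dom A a)" if "a \<in> Ar A" for a
    using functorD(3)[OF F that] by (simp add: discrete_def)
  have colour': "onAr H a = onOb H (Dom B a)" if "a \<in> Ar B" for a
    using functorD(3)[OF H that] by (simp add: discrete_def)
  have beta: "\<beta> \<in> Ar (Sr B) \<and> Dom (Sr B) \<beta> = ys \<and> perm_ok \<beta> \<and> length \<beta> = length xs \<and> map fst \<beta> \<in> permutations_of_set {..<length xs}"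
    if "\<beta> \<in> outs B' ys" for \<beta>
  proof -
    have "\<beta> \<in> Ar (Sr B)" "Dom (Sr B) \<beta> = ys" using that B' by (auto simp: outs_def subgrpd_def)
    then show ?thesis using l by (auto simp: Ar_Sr perm_ok_def permutations_of_set_def)
  qed
  have match: "(map (apsnd (onAr F)) \<alpha> = map (apsnd (onAr H)) \<beta>) \<longleftrightarrow> map fst \<alpha> = map fst \<beta>"
    if \<alpha>: "\<alpha> \<in> outs (Sr A) xs" and \<beta>: "\<beta> \<in> outs B' ys" for \<alpha> \<beta>
  proof
    assume "map (apsnd (onAr F)) \<alpha> = map (apsnd (onAr H)) \<beta>"
    from arg_cong[OF this, of "map fst"] show "map fst \<alpha> = map fst \<beta>" by (simp add: comp_def)
  next
    assume e: "map fst \<alpha> = map fst \<beta>"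
    have a: "\<alpha> \<in> Ar (Sr A)" "Dom (Sr A) \<alpha> = xs" using \<alpha> by (auto simp: outs_def)
    have la: "length \<alpha> = length xs" "length \<beta> = length xs" using a beta[OF \<beta>] by auto
    show "map (apsnd (onAr F)) \<alpha> = map (apsnd (onAr H)) \<beta>"
    proof (rule nth_equalityI)
      fix i assume "i < length (map (apsnd (onAr F)) \<alpha>)"
      then have i: "i < length \<alpha>" "i < length \<beta>" using la by auto
      have f: "fst (\<alpha> ! i) = fst (\<beta> ! i)" using arg_cong[OF e, of "\<lambda>l. l ! i"] i by simp
      have p: "fst (\<alpha> ! i) < length xs" using a i la perm_ok_less[of \<alpha> i] by (simp add: Ar_Sr)
      have "Dom A (snd (\<alpha> ! i)) = xs ! fst (\<alpha> ! i)" "Dom B (snd (\<beta> ! i)) = ys ! fst (\<alpha> ! i)"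
        using nth_Dom_Sr[of \<alpha> i A] nth_Dom_Sr[of \<beta> i B] a beta[OF \<beta>] i f by (auto simp: Ar_Sr)
      moreover have "onOb F (xs ! fst (\<alpha> ! i)) = onOb H (ys ! fst (\<alpha> ! i))"
        using arg_cong[OF m, of "\<lambda>l. l ! fst (\<alpha> ! i)"] p l by simp
      ultimately have "onAr F (snd (\<alpha> ! i)) = onAr H (snd (\<beta> ! i))"
        using a beta[OF \<beta>] i colour colour' by (auto simp: Ar_Sr)
      then show "map (apsnd (onAr F)) \<alpha> ! i = map (apsnd (onAr H)) \<beta> ! i"
        using i f by (cases "\<alpha> ! i"; cases "\<beta> ! i") simp
    qed (use la in simp)
  qed
  have O: "(\<alpha>, \<beta>) \<in> outs ?P (xs, ys) \<longleftrightarrow> \<alpha> \<in> outs (Sr A) xs \<and> \<beta> \<in> outs B' ys \<and> map fst \<alpha> = map fst \<beta>" for \<alpha> \<beta>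
    using match[of \<alpha> \<beta>] by (auto simp: outs_def pullback_def prodG_def Sr_map_def)
  have fh: "map fst (?h (\<sigma>, as)) = \<sigma>" for \<sigma> and as :: "'b list" by (simp add: comp_def)
  show ?thesis unfolding bij_betw_def
  proof
    show "inj_on (\<lambda>(\<beta>, as). (map (\<lambda>p. (p, as ! p)) (map fst \<beta>), \<beta>)) (outs B' ys \<times> ?L)"
    proof (rule inj_onI)
      fix u v assume uv: "u \<in> outs B' ys \<times> ?L" "v \<in> outs B' ys \<times> ?L"
        and e: "(\<lambda>(\<beta>, as). (map (\<lambda>p. (p, as ! p)) (map fst \<beta>), \<beta>)) u = (\<lambda>(\<beta>, as). (map (\<lambda>p. (p, as ! p)) (map fst \<beta>), \<beta>)) v"
      obtain \<beta> as \<beta>' as' where u: "u = (\<beta>, as)" and v: "v = (\<beta>', as')" by (cases u; cases v)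
      have \<beta>: "\<beta>' = \<beta>" using e by (simp add: u v)
      have "?h (map fst \<beta>, as) = ?h (map fst \<beta>, as')" using e unfolding u v \<beta> by simp
      from inj_onD[OF bij_betw_imp_inj_on[OF b] this] show "u = v"
        using uv beta[of \<beta>] by (simp add: u v \<beta>)
    qed
    show "(\<lambda>(\<beta>, as). (map (\<lambda>p. (p, as ! p)) (map fst \<beta>), \<beta>)) ` (outs B' ys \<times> ?L) = outs ?P (xs, ys)"
    proof (intro set_eqI iffI)
      fix u assume "u \<in> (\<lambda>(\<beta>, as). (map (\<lambda>p. (p, as ! p)) (map fst \<beta>), \<beta>)) ` (outs B' ys \<times> ?L)"
      then obtain \<beta> as where u: "u = (?h (map fst \<beta>, as), \<beta>)" "\<beta> \<in> outs B' ys" "as \<in> ?L" by auto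
      then have "?h (map fst \<beta>, as) \<in> outs (Sr A) xs"
        using bij_betw_imp_surj_on[OF b] beta[OF u(2)] by blast
      then show "u \<in> outs ?P (xs, ys)" using u(2) fh[of "map fst \<beta>" as] unfolding u(1) O by simp
    next
      fix u assume u: "u \<in> outs ?P (xs, ys)"
      obtain \<alpha> \<beta> where ab: "u = (\<alpha>, \<beta>)" by (cases u)
      with u have \<alpha>: "\<alpha> \<in> outs (Sr A) xs" "\<beta> \<in> outs B' ys" "map fst \<alpha> = map fst \<beta>" using O by auto
      then obtain \<sigma> as where "\<alpha> = ?h (\<sigma>, as)" "as \<in> ?L"
        using bij_betw_imp_surj_on[OF b] by blast
      then have "\<alpha> = ?h (map fst \<beta>, as)" using \<alpha>(3) fh[of \<sigma> as] by simp
      then show "u \<in> (\<lambda>(\<beta>, as). (map (\<lambda>p. (p, as ! p)) (map fst \<beta>), \<beta>)) ` (outs B' ys \<times> ?L)"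
        using \<alpha>(2) \<open>as \<in> ?L\<close> by (auto simp: ab image_iff)
    qed
  qed
qed

text \<open>The grafted operations contribute no factorial for their order, because the root arrow
  already determines how they are permuted.\<close>

lemma deg_barG2:
  assumes z: "zs \<in> post"
  shows "deg barG2 (enc_tree i zs) = wt (map fst zs) * prod_list (map (wt \<circ> snd) zs)"
    and "finite (outs barG2 (enc_tree i zs))"
proof -
  let ?L = "{as. list_all2 (\<lambda>a x. a \<in> outs barG1 x) as (enc_leaves zs)}"
  have b: "bij_betw (\<lambda>(\<beta>, as). (map (\<lambda>p. (p, as ! p)) (map fst \<beta>), \<beta>))
    (outs opG (enc_op i (map fst zs)) \<times> ?L) (outs prebarG2 (enc_leaves zs, enc_op i (map fst zs)))"
    unfolding prebarG2_def
    using outs_pullback_Sr[OF functor_root[unfolded colG_def] functor_srcF[unfolded colG_def] subgrpd_opG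
        enc_tree_Ob[OF z, unfolded prebarG2_def]] .
  have o: "outs barG2 (enc_tree i zs) = GraftA ` outs prebarG2 (enc_leaves zs, enc_op i (map fst zs))"
    unfolding barG2_def enc_tree_def by (rule outs_relabel) simp_all
  have "map (deg barG1) (enc_leaves zs) = map (wt \<circ> snd) zs"
    using z by (auto simp: enc_leaves_def post_def deg_barG1(1) deg_opG(1))
  then have "card ?L = prod_list (map (wt \<circ> snd) zs)"
    unfolding card_list_all2 deg_def[symmetric] by simp
  then show "deg barG2 (enc_tree i zs) = wt (map fst zs) * prod_list (map (wt \<circ> snd) zs)"
    using bij_betw_same_card[OF b] deg_opG(1)[OF post_root[OF z], of i]
    by (simp add: deg_def o card_image inj_on_def card_cartesian_product)
  have "finite ?L"
    using z deg_opG(2) by (intro finite_list_all2) (auto simp: enc_leaves_def post_def deg_barG1(2))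
  then show "finite (outs barG2 (enc_tree i zs))"
    using bij_betw_finite[OF b] deg_opG(2)[OF post_root[OF z], of i] by (simp add: o)
qed

lemma face_comp_enc:
  assumes z: "zs \<in> post"
  shows "onOb (qface T2 2 1) (enc_tree i zs) = Oper (enc_op i (comp_tree zs))"
proof -
  \<comment> \<open>The origin of the multiplication of indices: k copies of a constant tuple of
    length j form one of length k * j.\<close>
  have c: "concat (replicate k (replicate j e)) = replicate (k * j) e" for j k and e :: two
    by (induction k) (simp_all add: replicate_add[symmetric])
  have g: "onOb graft_arr ((replicate k c, i), enc_op c' t) = enc_op i (map (\<lambda>(e, j). (e, k * j)) t)" for k c c' t
    by (auto simp: graft_arr_def arr_comp_def enc_op_def c)
  have "zip (map un_Oper (enc_leaves zs)) (enc_op i (map fst zs)) =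
      map (\<lambda>((c, k), t). (enc_op c t, (replicate k c, i))) zs"
    by (induction zs) (auto simp: enc_leaves_def enc_op_def)
  then have "onOb (opcomp T2) (map un_Oper (enc_leaves zs), enc_op i (map fst zs)) =
      concat (map (\<lambda>((c, k), t). enc_op i (map (\<lambda>(e, j). (e, k * j)) t)) zs)"
    by (simp add: opcomp_T_op_Sym2 comp_def case_prod_unfold g)
  also have "\<dots> = enc_op i (comp_tree zs)"
    by (simp add: comp_tree_def enc_op_def map_concat comp_def case_prod_unfold)
  finally show ?thesis by (simp add: numeral_2_eq_2 enc_tree_def)
qed

lemma face_root_enc: "onOb (qface T2 2 0) (enc_tree i zs) = Oper (enc_op i (map fst zs))"
  by (simp add: numeral_2_eq_2 enc_tree_def)

lemma cut_enc: "onOb (qcut T2 2) (enc_tree i zs) = enc_leaves zs"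
  by (simp add: numeral_2_eq_2 enc_tree_def)

lemma unit_enc: "onOb (qdegen T2 0 0) (Colour c) = Oper (enc_op c [(c, 1)])"
  by (simp add: T_op_Sym2 enc_op_def)

section \<open>Sums over lists with a prescribed multiset of types\<close>

lemma monl_Nil [simp]: "monl [] = 0"
  and monl_Cons: "monl (x # xs) = Poly_Mapping.single x 1 + monl xs"
  and monl_append: "monl (xs @ ys) = monl xs + monl ys"
  by (simp_all add: monl_def)

lemma keys_monl: "Poly_Mapping.keys (monl xs) = set xs"
  by (auto simp: in_keys_iff lookup_monl)

lemma monl_eq_0_iff [simp]: "monl xs = 0 \<longleftrightarrow> xs = []"
  by (metis keys_monl keys_eq_empty set_empty)

lemma monl_surj: "\<exists>xs. monl xs = m"
proof -
  have "finite {x. 0 < Poly_Mapping.lookup m x}" using finite_keys[of m] by (simp add: in_keys_iff[symmetric])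
  then obtain xs where "mset xs = Abs_multiset (Poly_Mapping.lookup m)" "count (mset xs) = Poly_Mapping.lookup m"
    by (metis count_Abs_multiset ex_mset)
  then have "monl xs = m" by (intro poly_mapping_eqI) (simp add: lookup_monl)
  then show ?thesis ..
qed

lemma prod_list_mset: "prod_list (map f xs) = prod_mset (image_mset f (mset xs))"
  for f :: "'a \<Rightarrow> 'b::comm_monoid_mult"
  unfolding mset_map[symmetric] prod_mset_prod_list ..

text \<open>Converts products over the exponents of a monomial, as in \<open>aut\<close>,
  \<open>plethysm\<close>, \<open>mon_eval\<close> and the comultiplication, into products along any
  word with that monomial.\<close>

lemma prod_keys_monl:
  "(\<Prod>v\<in>Poly_Mapping.keys (monl xs). f v ^ Poly_Mapping.lookup (monl xs) v) = prod_list (map f xs)"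
  for f :: "'a \<Rightarrow> 'b::comm_monoid_mult"
  by (simp add: keys_monl lookup_monl prod_list_mset image_prod_mset_multiplicity)

lemma length_monl: "monl xs = monl ys \<Longrightarrow> length xs = length ys"
  using mset_eq_length monl_eq_iff by blast

text \<open>The order of the stabiliser of a word with exponents m under permutations of its
  positions; \<open>card_perms\<close> is the orbit-stabiliser count.\<close>

definition pfact :: "('v \<Rightarrow>\<^sub>0 nat) \<Rightarrow> nat" where
  "pfact m = (\<Prod>v\<in>Poly_Mapping.keys m. fact (Poly_Mapping.lookup m v))"

lemma pfact_pos: "0 < pfact m"
  by (simp add: pfact_def)

lemma card_perms:
  "card (permutations_of_multiset (mset xs)) * pfact (monl xs) = fact (length xs)"
  using card_permutations_of_multiset_aux[of "mset xs"] by (simp add: pfact_def keys_monl lookup_monl)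

lemma card_perms_rat:
  "of_nat (card (permutations_of_multiset (mset xs))) / of_nat (fact (length xs)) = (1 / of_nat (pfact (monl xs)) :: rat)"
  using card_perms[of xs, THEN arg_cong[of _ _ "of_nat :: nat \<Rightarrow> rat"]] pfact_pos[of "monl xs"]
  by (simp add: field_simps)

lemma typed_lists_Cons:
  "{xs. set xs \<subseteq> S \<and> map ty xs = t # ts} =
    (\<lambda>(x, xs). x # xs) ` ({x. x \<in> S \<and> ty x = t} \<times> {xs. set xs \<subseteq> S \<and> map ty xs = ts})"
  by (auto simp: image_iff map_eq_Cons_conv)

lemma finite_typed_lists:
  "(\<And>t. t \<in> set ts \<Longrightarrow> finite {x. x \<in> S \<and> ty x = t}) \<Longrightarrow> finite {xs. set xs \<subseteq> S \<and> map ty xs = ts}"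
proof (induction ts)
  case (Cons t ts)
  then show ?case unfolding typed_lists_Cons by (intro finite_imageI finite_cartesian_product) auto
qed simp

text \<open>With the list of types fixed, the entries are chosen independently, so the distributive
  law applies.\<close>

lemma sum_typed_lists:
  fixes w :: "'a \<Rightarrow> 'b::comm_semiring_1"
  shows "(\<Sum>xs | set xs \<subseteq> S \<and> map ty xs = ts. prod_list (map w xs)) =
    prod_list (map (\<lambda>t. \<Sum>x | x \<in> S \<and> ty x = t. w x) ts)"
proof (induction ts)
  case Nil
  have "{xs. set xs \<subseteq> S \<and> map ty xs = []} = {[]}" by auto
  then show ?case by simp
next
  case (Cons t ts)
  have "inj_on (\<lambda>(x, xs). x # xs) ({x. x \<in> S \<and> ty x = t} \<times> {xs. set xs \<subseteq> S \<and> map ty xs = ts})"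
    by (auto simp: inj_on_def)
  then have "(\<Sum>xs | set xs \<subseteq> S \<and> map ty xs = t # ts. prod_list (map w xs)) =
      (\<Sum>(x, xs)\<in>{x. x \<in> S \<and> ty x = t} \<times> {xs. set xs \<subseteq> S \<and> map ty xs = ts}. w x * prod_list (map w xs))"
    unfolding typed_lists_Cons by (subst sum.reindex) (auto intro!: sum.cong)
  also have "\<dots> = (\<Sum>x | x \<in> S \<and> ty x = t. w x) * (\<Sum>xs | set xs \<subseteq> S \<and> map ty xs = ts. prod_list (map w xs))"
    by (simp add: sum_product sum.cartesian_product)
  finally show ?case using Cons.IH by simp
qed

lemma monl_typed_lists:
  "{xs. set xs \<subseteq> S \<and> monl (map ty xs) = monl gs} =
    (\<Union>ts\<in>permutations_of_multiset (mset gs). {xs. set xs \<subseteq> S \<and> map ty xs = ts})"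
  by (auto simp: monl_eq_iff permutations_of_multiset_def)

lemma finite_monl_lists:
  assumes "\<And>g. g \<in> set gs \<Longrightarrow> finite {x. x \<in> S \<and> ty x = g}"
  shows "finite {xs. set xs \<subseteq> S \<and> monl (map ty xs) = monl gs}"
  unfolding monl_typed_lists
proof (intro finite_UN_I finite_permutations_of_multiset finite_typed_lists)
  fix ts t assume "ts \<in> permutations_of_multiset (mset gs)" "t \<in> set ts"
  then have "t \<in> set gs" by (metis permutations_of_multisetD mset_eq_setD)
  then show "finite {x. x \<in> S \<and> ty x = t}" by (rule assms)
qed

text \<open>Group the lists by their list of types, which is a rearrangement of \<open>gs\<close>;
  by commutativity every rearrangement gives the same product. The values lie in a commutative
  semiring because the lemma is applied to rational weights and to elements of the tensor
  square.\<close>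

lemma sum_monl_lists:
  fixes w :: "'a \<Rightarrow> 'b::comm_semiring_1"
  assumes fin: "\<And>g. g \<in> set gs \<Longrightarrow> finite {x. x \<in> S \<and> ty x = g}"
  shows "(\<Sum>xs | set xs \<subseteq> S \<and> monl (map ty xs) = monl gs. prod_list (map w xs)) =
    of_nat (card (permutations_of_multiset (mset gs))) * prod_list (map (\<lambda>g. \<Sum>x | x \<in> S \<and> ty x = g. w x) gs)"
    (is "?l = _")
proof -
  let ?P = "permutations_of_multiset (mset gs)" and ?W = "\<lambda>g. \<Sum>x | x \<in> S \<and> ty x = g. w x"
  let ?A = "{xs. set xs \<subseteq> S \<and> monl (map ty xs) = monl gs}"
  have "?l = (\<Sum>ts\<in>?P. \<Sum>xs | xs \<in> ?A \<and> map ty xs = ts. prod_list (map w xs))"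
    by (rule sum.group[symmetric, OF finite_monl_lists[OF fin] finite_permutations_of_multiset])
      (auto simp: monl_eq_iff permutations_of_multiset_def)
  also have "\<dots> = (\<Sum>ts\<in>?P. prod_list (map ?W gs))"
  proof (rule sum.cong[OF refl])
    fix ts assume "ts \<in> ?P"
    then have ts: "mset ts = mset gs" by (rule permutations_of_multisetD)
    have "{xs. xs \<in> ?A \<and> map ty xs = ts} = {xs. set xs \<subseteq> S \<and> map ty xs = ts}"
      using ts by (auto simp: monl_eq_iff)
    then show "(\<Sum>xs | xs \<in> ?A \<and> map ty xs = ts. prod_list (map w xs)) = prod_list (map ?W gs)"
      using sum_typed_lists[where w = w and ty = ty and S = S and ts = ts] by (simp only: prod_list_mset ts)
  qed
  finally show ?thesis by simp
qed

section \<open>Exponents\<close>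

lemma Lambda2_iff: "l \<in> Lambda2 \<longleftrightarrow> (\<exists>ks\<in>posl. monl ks = l)"
proof
  assume l: "l \<in> Lambda2"
  obtain ks where ks: "monl ks = l" using monl_surj by blast
  have "ks \<noteq> []" using l ks by (auto simp: Lambda2_def)
  moreover have "0 < k" if "(c, k) \<in> set ks" for c k
  proof (rule ccontr)
    assume "\<not> 0 < k"
    then have "Poly_Mapping.lookup l (c, 0) \<noteq> 0" using that ks keys_monl[of ks] by (auto simp: in_keys_iff)
    then show False using l by (simp add: Lambda2_def)
  qed
  ultimately show "\<exists>ks\<in>posl. monl ks = l" using ks by (auto simp: posl_def)
next
  assume "\<exists>ks\<in>posl. monl ks = l"
  then obtain ks where ks: "ks \<in> posl" "monl ks = l" by blast
  have "(c, 0) \<notin> Poly_Mapping.keys l" for c using ks by (auto simp: posl_def keys_monl[of ks, unfolded ks(2)])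
  moreover have "l \<noteq> 0" using ks by (auto simp: posl_def)
  ultimately show "l \<in> Lambda2" by (simp add: Lambda2_def in_keys_iff)
qed

lemma monl_Lambda2: "ks \<in> posl \<Longrightarrow> monl ks \<in> Lambda2"
  by (auto simp: Lambda2_iff)

lemma posl_monl: "ks \<in> posl \<Longrightarrow> monl t = monl ks \<Longrightarrow> t \<in> posl"
  using mset_eq_setD[of t ks] by (auto simp: posl_def monl_eq_iff)

lemma finite_posl_monl: "finite {t. t \<in> posl \<and> monl t = l}"
proof -
  obtain ks where ks: "monl ks = l" using monl_surj by blast
  have "{t. t \<in> posl \<and> monl t = l} \<subseteq> permutations_of_multiset (mset ks)"
    by (auto simp: ks[symmetric] monl_eq_iff permutations_of_multiset_def)
  then show ?thesis by (rule finite_subset) simp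
qed

lemma aut_pos: "0 < aut l"
  by (auto simp: aut_def intro!: prod_pos)

lemma aut_eq: "aut (monl ks) = prod_list (map (\<lambda>(c, k). fact k) ks) * pfact (monl ks)"
proof -
  have "aut (monl ks) = (\<Prod>v\<in>Poly_Mapping.keys (monl ks). fact (snd v) ^ Poly_Mapping.lookup (monl ks) v) * pfact (monl ks)"
    by (simp add: aut_def pfact_def prod.distrib case_prod_unfold)
  then show ?thesis unfolding prod_keys_monl by (simp add: case_prod_unfold)
qed

lemma wt_pos: "0 < wt ks"
proof -
  have "0 < prod_list (map (\<lambda>(c, k). fact k :: nat) ks)" by (induction ks) (auto simp: case_prod_unfold)
  then show ?thesis by (simp add: wt_def)
qed

text \<open>Words with the same exponents have the same weight. Their number divided by the
  factorial of the length is 1 / \<open>pfact\<close>, and the remaining factorials in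
  \<open>wt\<close> complete this to \<open>aut\<close>.\<close>

lemma sum_inverse_wt:
  assumes "l \<in> Lambda2"
  shows "(\<Sum>t | t \<in> posl \<and> monl t = l. 1 / of_nat (wt t)) = (1 / of_nat (aut l) :: rat)"
proof -
  obtain ks where ks: "ks \<in> posl" "monl ks = l" using assms by (auto simp: Lambda2_iff)
  have T: "{t. t \<in> posl \<and> monl t = l} = permutations_of_multiset (mset ks)"
    using posl_monl[OF ks(1)] by (auto simp: ks(2)[symmetric] monl_eq_iff permutations_of_multiset_def)
  have w: "wt t = wt ks" if "t \<in> permutations_of_multiset (mset ks)" for t
    using permutations_of_multisetD[OF that] mset_eq_length[of t ks] by (simp add: wt_def prod_list_mset)
  have "(\<Sum>t | t \<in> posl \<and> monl t = l. 1 / of_nat (wt t)) =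
      of_nat (card (permutations_of_multiset (mset ks))) / of_nat (fact (length ks)) /
        (of_nat (prod_list (map (\<lambda>(c, k). fact k) ks)) :: rat)"
    unfolding T by (simp add: w) (simp add: wt_def)
  also have "\<dots> = 1 / of_nat (aut l)"
    unfolding card_perms_rat ks(2)[symmetric] aut_eq by simp
  finally show ?thesis .
qed

lemma lookup_dilate:
  assumes "0 < k"
  shows "Poly_Mapping.lookup (dilate k l) (c, m) = (if k dvd m then Poly_Mapping.lookup l (c, m div k) else 0)"
proof -
  have "Poly_Mapping.lookup (dilate k l) (c, m) =
      (\<Sum>x\<in>Poly_Mapping.keys l. Poly_Mapping.lookup l x when (fst x, k * snd x) = (c, m))"
    by (simp add: dilate_def lookup_sum case_prod_unfold lookup_single)
  also have "\<dots> = (if k dvd m then Poly_Mapping.lookup l (c, m div k) else 0)"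
  proof (cases "k dvd m")
    case True
    then have "(fst x, k * snd x) = (c, m) \<longleftrightarrow> x = (c, m div k)" for x :: "two \<times> nat"
      using assms by (cases x) auto
    then show ?thesis using True
      by (simp add: when_def sum.delta in_keys_iff)
  next
    case False
    then have "(fst x, k * snd x) \<noteq> (c, m)" for x :: "two \<times> nat" by auto
    then show ?thesis using False by simp
  qed
  finally show ?thesis .
qed

lemma dilate_add: "0 < k \<Longrightarrow> dilate k (a + b) = dilate k a + dilate k b"
  by (rule poly_mapping_eqI) (auto simp: lookup_dilate lookup_add)

lemma dilate_inj: "0 < k \<Longrightarrow> dilate k a = dilate k b \<Longrightarrow> a = b"
proof (rule poly_mapping_eqI)
  fix x :: "two \<times> nat" assume k: "0 < k" and e: "dilate k a = dilate k b"
  obtain c j where x: "x = (c, j)" by (cases x)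
  from arg_cong[OF e, of "\<lambda>m. Poly_Mapping.lookup m (c, k * j)"]
  show "Poly_Mapping.lookup a x = Poly_Mapping.lookup b x" using k by (simp add: lookup_dilate x)
qed

lemma dilate_monl: "0 < k \<Longrightarrow> dilate k (monl t) = monl (map (\<lambda>(e, j). (e, k * j)) t)"
proof (induction t)
  case Nil
  then show ?case by (simp add: dilate_def)
next
  case (Cons a t)
  obtain e j where a: "a = (e, j)" by (cases a)
  have "dilate k (Poly_Mapping.single a 1) = Poly_Mapping.single (e, k * j) 1" by (simp add: dilate_def a)
  then show ?case using Cons by (simp add: monl_Cons dilate_add a)
qed

section \<open>Trees with a given composite\<close>

definition tree_deg :: "tree2 \<Rightarrow> expo" where
  "tree_deg zs = monl (comp_tree zs)"

text \<open>Unlike \<open>post\<close> it contains the empty list, at which the induction along the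
  root word starts.\<close>

definition post_list :: "tree2 set" where
  "post_list = {zs. \<forall>((c, k), t)\<in>set zs. 0 < k \<and> t \<in> posl}"

lemma post_eq: "zs \<in> post \<longleftrightarrow> zs \<noteq> [] \<and> zs \<in> post_list"
  by (auto simp: post_def post_list_def)

lemma tree_deg_Cons: "0 < k \<Longrightarrow> tree_deg (((c, k), t) # zs) = dilate k (monl t) + tree_deg zs"
  by (simp add: tree_deg_def comp_tree_def monl_append dilate_monl)

lemma tree_deg_Nil: "tree_deg [] = 0"
  by (simp add: tree_deg_def comp_tree_def)

text \<open>An index in the composite is a product k * j of positive indices and so bounds both. No
  grafted word is empty, so the length of the composite bounds the number of grafted words and the
  length of each.\<close>

lemma finite_comp_tree: "finite {zs. zs \<in> post \<and> comp_tree zs = u}"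
proof -
  let ?L = "length u" and ?B = "Max (snd ` set u)"
  let ?V = "(UNIV :: two set) \<times> {..?B}"
  let ?T = "{t. set t \<subseteq> ?V \<and> length t \<le> ?L}"
  let ?E = "?V \<times> ?T"
  have fU: "finite (UNIV :: two set)" by (simp flip: UNIV_two)
  have fT: "finite ?T" using fU by (intro finite_lists_length_le) simp
  then have "finite {zs. set zs \<subseteq> ?E \<and> length zs \<le> ?L}" using fU by (intro finite_lists_length_le) simp
  moreover have "{zs. zs \<in> post \<and> comp_tree zs = u} \<subseteq> {zs. set zs \<subseteq> ?E \<and> length zs \<le> ?L}"
  proof (intro subsetI)
    fix zs assume "zs \<in> {zs. zs \<in> post \<and> comp_tree zs = u}"
    then have z: "zs \<in> post" and u: "u = comp_tree zs" by auto
    have el: "((c, k), t) \<in> ?E" if m: "((c, k), t) \<in> set zs" for c k t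
    proof -
      have kt: "0 < k" "t \<in> posl" using z m by (auto simp: post_def)
      have sub: "(e, k * j) \<in> set u" if "(e, j) \<in> set t" for e j
        using m that unfolding u comp_tree_def by force
      have b: "k * j \<le> ?B" if "(e, j) \<in> set t" for e j
        using sub[OF that] by (intro Max_ge) (auto simp: image_iff intro: bexI[of _ "(e, k * j)"])
      have jj: "j \<le> ?B \<and> k \<le> ?B" if "(e, j) \<in> set t" for e j
      proof -
        have "0 < j" using kt(2) that by (auto simp: posl_def)
        then have "j \<le> k * j" "k \<le> k * j" using kt(1) by simp_all
        then show ?thesis using b[OF that] by linarith
      qed
      have "t \<noteq> []" using kt(2) by (simp add: posl_def)
      then obtain e j where "(e, j) \<in> set t" by (cases t) auto
      then have "k \<le> ?B" using jj by blast
      moreover have "length t \<le> ?L"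
      proof -
        have "length (map (\<lambda>(e, j). (e, k * j)) t) \<in> set (map length (map (\<lambda>((c, k), t). map (\<lambda>(e, j). (e, k * j)) t) zs))"
          using m by force
        from member_le_sum_list[OF this] show ?thesis unfolding u comp_tree_def length_concat by simp
      qed
      ultimately show ?thesis using jj by auto
    qed
    have "length zs = sum_list (map (\<lambda>_. 1) zs)" by (simp add: sum_list_triv)
    also have "\<dots> \<le> sum_list (map (\<lambda>((c, k), t). length t) zs)"
      using z by (intro sum_list_mono) (auto simp: post_def posl_def Suc_le_eq)
    also have "\<dots> = length (comp_tree zs)" by (simp add: comp_tree_def length_concat comp_def case_prod_unfold)
    finally show "zs \<in> {zs. set zs \<subseteq> ?E \<and> length zs \<le> ?L}" using el unfolding u by auto
  qed
  ultimately show ?thesis by (rule finite_subset[rotated])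
qed

lemma finite_tree_deg: "finite {zs. zs \<in> post \<and> tree_deg zs = l}"
proof -
  obtain ks where ks: "monl ks = l" using monl_surj by blast
  have "{zs. zs \<in> post \<and> tree_deg zs = l} \<subseteq>
      (\<Union>u\<in>permutations_of_multiset (mset ks). {zs. zs \<in> post \<and> comp_tree zs = u})"
    by (auto simp: ks[symmetric] tree_deg_def monl_eq_iff permutations_of_multiset_def)
  moreover have "finite \<dots>" by (intro finite_UN_I finite_comp_tree) simp
  ultimately show ?thesis by (rule finite_subset)
qed

section \<open>The coefficients of a plethysm\<close>

lemma mcoeff_times: "mcoeff (f * g) \<nu> = (\<Sum>(\<alpha>, \<beta>) | \<alpha> + \<beta> = \<nu>. mcoeff f \<alpha> * mcoeff g \<beta>)"
  by (simp add: times_mser.rep_eq)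

lemma mcoeff_Mser [simp]: "mcoeff (Mser f) = f"
  by (simp add: Mser_inverse)

lemma mcoeff_eq_A_map: "mcoeff (F i) l = A_map i l F / of_nat (aut l)"
  using aut_pos[of l] by (simp add: A_map_def)

text \<open>Dilation by a positive k is injective, so at most one exponent l contributes to the
  coefficient. Its coefficient is then spread over the words with exponents l in proportion to their
  inverse weights (\<open>sum_inverse_wt\<close>).\<close>

lemma mcoeff_frob:
  assumes F: "F \<in> pairs" and k: "0 < k"
  shows "mcoeff (frob k (F c)) \<alpha> =
    (\<Sum>t | t \<in> posl \<and> dilate k (monl t) = \<alpha>. A_map c (monl t) F / of_nat (wt t))"
    and "finite {t. t \<in> posl \<and> dilate k (monl t) = \<alpha>}"
proof -
  let ?S = "{t. t \<in> posl \<and> dilate k (monl t) = \<alpha>}"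
  have "mcoeff (frob k (F c)) \<alpha> = (\<Sum>t\<in>?S. A_map c (monl t) F / of_nat (wt t)) \<and> finite ?S"
  proof (cases "\<exists>l. dilate k l = \<alpha>")
    case True
    then obtain l where l: "dilate k l = \<alpha>" by blast
    have iff: "dilate k l' = \<alpha> \<longleftrightarrow> l' = l" for l' using dilate_inj[OF k] l by blast
    have S: "?S = {t. t \<in> posl \<and> monl t = l}" by (simp add: iff)
    have "mcoeff (frob k (F c)) \<alpha> = mcoeff (F c) l" by (simp add: frob_def iff)
    also have "\<dots> = (\<Sum>t\<in>?S. A_map c (monl t) F / of_nat (wt t))"
    proof (cases "l \<in> Lambda2")
      case True
      have "(\<Sum>t\<in>?S. A_map c (monl t) F / of_nat (wt t)) = A_map c l F * (\<Sum>t\<in>?S. 1 / of_nat (wt t))"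
        unfolding S sum_distrib_left by (intro sum.cong) auto
      then show ?thesis using sum_inverse_wt[OF True] by (simp add: S mcoeff_eq_A_map)
    next
      case False
      then have "?S = {}" using monl_Lambda2 by (auto simp: S)
      moreover have "mcoeff (F c) l = 0" using F False by (auto simp: pairs_def)
      ultimately show ?thesis by (simp only: sum.empty)
    qed
    finally show ?thesis using finite_posl_monl by (simp add: S)
  next
    case False
    then have "?S = {}" by blast
    moreover have "mcoeff (frob k (F c)) \<alpha> = 0" using False by (simp add: frob_def)
    ultimately show ?thesis by (simp only: sum.empty finite.emptyI)
  qed
  then show "mcoeff (frob k (F c)) \<alpha> = (\<Sum>t\<in>?S. A_map c (monl t) F / of_nat (wt t))" "finite ?S" by blast+
qed

definition leaf_val :: "series2 \<Rightarrow> tree2 \<Rightarrow> rat" where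
  "leaf_val F zs = prod_list (map (\<lambda>((c, k), t). A_map c (monl t) F / of_nat (wt t)) zs)"

text \<open>Expanding a product of series chooses, for each letter of \<open>ks\<close>, a word to
  be grafted onto it. Finiteness is carried along in the induction because the summations are
  rearranged at each step.\<close>

lemma mcoeff_prod_frob:
  assumes F: "F \<in> pairs" and "\<forall>(c, k)\<in>set ks. 0 < k"
  shows "mcoeff (prod_list (map (\<lambda>(c, k). frob k (F c)) ks)) \<nu> =
      (\<Sum>zs | zs \<in> post_list \<and> map fst zs = ks \<and> tree_deg zs = \<nu>. leaf_val F zs) \<and>
    finite {zs. zs \<in> post_list \<and> map fst zs = ks \<and> tree_deg zs = \<nu>}"
  using assms(2)
proof (induction ks arbitrary: \<nu>)
  case Nil
  have "{zs. zs \<in> post_list \<and> map fst zs = [] \<and> tree_deg zs = \<nu>} = (if \<nu> = 0 then {[]} else {})"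
    by (auto simp: post_list_def tree_deg_Nil)
  then show ?case by (simp add: one_mser.rep_eq leaf_val_def)
next
  case (Cons v ks)
  obtain c k where v: "v = (c, k)" by (cases v)
  have k: "0 < k" using Cons.prems by (simp add: v)
  have ks: "\<forall>(c, k)\<in>set ks. 0 < k" using Cons.prems by simp
  let ?T = "\<lambda>\<alpha>. {t. t \<in> posl \<and> dilate k (monl t) = \<alpha>}"
  let ?Z = "\<lambda>ks \<nu>. {zs. zs \<in> post_list \<and> map fst zs = ks \<and> tree_deg zs = \<nu>}"
  let ?D = "{(\<alpha>, \<beta>). \<alpha> + \<beta> = \<nu>} :: (expo \<times> expo) set"
  let ?a = "\<lambda>t. A_map c (monl t) F / of_nat (wt t)"
  note IH = Cons.IH[OF ks]
  have fin: "finite (Sigma ?D (\<lambda>(\<alpha>, \<beta>). ?T \<alpha> \<times> ?Z ks \<beta>))"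
    using finite_add_decomp[of \<nu>] mcoeff_frob(2)[OF F k] IH by (intro finite_SigmaI) auto
  \<comment> \<open>The splitting of \<nu> is determined by the first grafted word and the remaining
    tree, so the map that forgets it is injective, as the reindexing below requires.\<close>
  have im: "?Z (v # ks) \<nu> = (\<lambda>(_, t, zs). (v, t) # zs) ` Sigma ?D (\<lambda>(\<alpha>, \<beta>). ?T \<alpha> \<times> ?Z ks \<beta>)" (is "?l = ?r")
  proof (intro set_eqI iffI)
    fix zs assume zs: "zs \<in> ?l"
    then obtain t ys where e: "zs = (v, t) # ys" "map fst ys = ks" by (auto simp: map_eq_Cons_conv)
    then have "t \<in> posl" "ys \<in> post_list" "dilate k (monl t) + tree_deg ys = \<nu>"
      using zs k by (auto simp: post_list_def v tree_deg_Cons)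
    then show "zs \<in> ?r" using e by (force simp: image_iff)
  next
    fix zs assume "zs \<in> ?r"
    then show "zs \<in> ?l" using k by (auto simp: post_list_def v tree_deg_Cons)
  qed
  have "mcoeff (prod_list (map (\<lambda>(c, k). frob k (F c)) (v # ks))) \<nu> =
      (\<Sum>(\<alpha>, \<beta>)\<in>?D. (\<Sum>t\<in>?T \<alpha>. ?a t) * (\<Sum>zs\<in>?Z ks \<beta>. leaf_val F zs))"
    using mcoeff_frob(1)[OF F k] IH by (simp add: v mcoeff_times)
  also have "\<dots> = (\<Sum>p\<in>?D. \<Sum>q\<in>?T (fst p) \<times> ?Z ks (snd p). ?a (fst q) * leaf_val F (snd q))"
    by (intro sum.cong) (auto simp: sum_product sum.cartesian_product case_prod_unfold)
  also have "\<dots> = (\<Sum>(p, q)\<in>Sigma ?D (\<lambda>(\<alpha>, \<beta>). ?T \<alpha> \<times> ?Z ks \<beta>). ?a (fst q) * leaf_val F (snd q))"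
    using finite_add_decomp[of \<nu>] mcoeff_frob(2)[OF F k] IH
    by (subst sum.Sigma) (auto simp: case_prod_unfold)
  also have "\<dots> = (\<Sum>zs\<in>?Z (v # ks) \<nu>. leaf_val F zs)"
    unfolding im
    by (subst sum.reindex) (auto simp: inj_on_def v leaf_val_def intro!: sum.cong)
  finally show ?case using im fin by simp
qed

definition tree_wt :: "tree2 \<Rightarrow> nat" where
  "tree_wt zs = wt (map fst zs) * prod_list (map (wt \<circ> snd) zs)"

definition leaf_mon :: "tree2 \<Rightarrow> mon" where
  "leaf_mon zs = monl (map (\<lambda>((c, k), t). (c, monl t)) zs)"

lemma mon_eval_monl: "mon_eval (monl gs) F = prod_list (map (\<lambda>(i, l). A_map i l F) gs)"
  unfolding mon_eval_def
  using prod_keys_monl[of "\<lambda>(i, l). A_map i l F" gs] by (simp add: case_prod_unfold)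

lemma leaf_val_eq: "leaf_val F zs = mon_eval (leaf_mon zs) F / of_nat (prod_list (map (wt \<circ> snd) zs))"
  unfolding leaf_mon_def mon_eval_monl leaf_val_def
  by (induction zs) (auto simp: case_prod_unfold)

text \<open>The coefficient of G at l is spread over the root words with exponents l, and for each
  of them \<open>mcoeff_prod_frob\<close> expands the product of the substituted series. Root word
  and grafted words together form a tree.\<close>

lemma mcoeff_plethysm:
  assumes F: "F \<in> pairs" and G: "G \<in> pairs"
  shows "mcoeff (plethysm G F i) \<nu> = (\<Sum>zs | zs \<in> post \<and> tree_deg zs = \<nu>.
    mon_eval (leaf_mon zs) F * A_map i (monl (map fst zs)) G / of_nat (tree_wt zs))"
proof -
  let ?Z = "{zs. zs \<in> post \<and> tree_deg zs = \<nu>}" and ?r = "\<lambda>zs :: tree2. monl (map fst zs)"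
  let ?P = "\<lambda>l. mcoeff (\<Prod>(c, k)\<in>Poly_Mapping.keys l. frob k (F c) ^ Poly_Mapping.lookup l (c, k)) \<nu>"
  let ?v = "\<lambda>zs. A_map i (?r zs) G / of_nat (wt (map fst zs)) * leaf_val F zs"
  note fZ = finite_tree_deg[of \<nu>]
  have term_eq: "mcoeff (G i) l * ?P l = (\<Sum>zs | zs \<in> ?Z \<and> ?r zs = l. ?v zs)" for l
  proof (cases "l \<in> Lambda2")
    case False
    then have "{zs. zs \<in> ?Z \<and> ?r zs = l} = {}" using post_root monl_Lambda2 by blast
    moreover have "mcoeff (G i) l = 0" using G False by (auto simp: pairs_def)
    ultimately show ?thesis by (simp only: sum.empty mult_zero_left)
  next
    case True
    let ?K = "{ks. ks \<in> posl \<and> monl ks = l}"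
    have P: "?P l = (\<Sum>zs | zs \<in> post_list \<and> map fst zs = ks \<and> tree_deg zs = \<nu>. leaf_val F zs)" if ks: "ks \<in> ?K" for ks
    proof -
      have "(\<Prod>(c, k)\<in>Poly_Mapping.keys l. frob k (F c) ^ Poly_Mapping.lookup l (c, k)) =
          prod_list (map (\<lambda>(c, k). frob k (F c)) ks)"
        using prod_keys_monl[of "\<lambda>(c, k). frob k (F c)" ks] ks by (simp add: case_prod_unfold)
      moreover have "\<forall>(c, k)\<in>set ks. 0 < k" using ks by (simp add: posl_def)
      ultimately show ?thesis using mcoeff_prod_frob[OF F, of ks \<nu>] by simp
    qed
    have "mcoeff (G i) l * ?P l = A_map i l G * (\<Sum>ks\<in>?K. 1 / of_nat (wt ks)) * ?P l"
      using sum_inverse_wt[OF True] by (simp add: mcoeff_eq_A_map)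
    also have "\<dots> = (\<Sum>ks\<in>?K. A_map i l G / of_nat (wt ks) * ?P l)"
      by (simp add: sum_distrib_left sum_distrib_right)
    also have "\<dots> = (\<Sum>ks\<in>?K. \<Sum>zs | zs \<in> {zs. zs \<in> ?Z \<and> ?r zs = l} \<and> map fst zs = ks. ?v zs)"
    proof (rule sum.cong[OF refl])
      fix ks assume ks: "ks \<in> ?K"
      have "{zs. zs \<in> {zs. zs \<in> ?Z \<and> ?r zs = l} \<and> map fst zs = ks} =
          {zs. zs \<in> post_list \<and> map fst zs = ks \<and> tree_deg zs = \<nu>}"
        using ks by (auto simp: post_eq posl_def)
      then show "A_map i l G / of_nat (wt ks) * ?P l =
          (\<Sum>zs | zs \<in> {zs. zs \<in> ?Z \<and> ?r zs = l} \<and> map fst zs = ks. ?v zs)"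
        unfolding P[OF ks] sum_distrib_left using ks by (intro sum.cong) auto
    qed
    also have "\<dots> = (\<Sum>zs | zs \<in> ?Z \<and> ?r zs = l. ?v zs)"
      by (rule sum.group[OF finite_subset[OF _ fZ] finite_posl_monl]) (auto simp: post_root)
    finally show ?thesis .
  qed
  have "mcoeff (plethysm G F i) \<nu> = Sum_any (\<lambda>l. mcoeff (G i) l * ?P l)"
    by (simp add: plethysm_def)
  also have "\<dots> = (\<Sum>l\<in>?r ` ?Z. mcoeff (G i) l * ?P l)"
  proof (rule Sum_any.expand_superset)
    \<comment> \<open>Exponents that belong to no root of a tree of degree \<nu> contribute an empty
      sum by \<open>term_eq\<close>, so the infinite sum has finite support.\<close>
    show "{l. mcoeff (G i) l * ?P l \<noteq> 0} \<subseteq> ?r ` ?Z"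
    proof (clarify, rule ccontr)
      fix l assume "mcoeff (G i) l * ?P l \<noteq> 0" "l \<notin> ?r ` ?Z"
      moreover from this(2) have "{zs. zs \<in> ?Z \<and> ?r zs = l} = {}" by blast
      then have "mcoeff (G i) l * ?P l = 0" unfolding term_eq by (simp only: sum.empty)
      ultimately show False by (elim notE)
    qed
  qed (use fZ in simp)
  also have "\<dots> = (\<Sum>zs\<in>?Z. ?v zs)"
    unfolding term_eq using fZ by (intro sum.group) auto
  also have "\<dots> = (\<Sum>zs\<in>?Z. mon_eval (leaf_mon zs) F * A_map i (?r zs) G / of_nat (tree_wt zs))"
    by (intro sum.cong refl) (simp add: leaf_val_eq tree_wt_def)
  finally show ?thesis .
qed

section \<open>The comultiplication of the plethystic bialgebra\<close>

text \<open>The grafted operations form the left factor and the root the right one, matching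
  evaluation at the inner and outer series. The factor \<open>aut\<close> turns the coefficient of
  the plethysm into the value of \<open>A_map\<close>.\<close>

definition comult_tree :: "gen \<Rightarrow> (mon \<times> mon \<Rightarrow>\<^sub>0 rat)" where
  "comult_tree g = (\<Sum>zs | zs \<in> post \<and> tree_deg zs = snd g.
     Poly_Mapping.single (leaf_mon zs, Poly_Mapping.single (fst g, monl (map fst zs)) 1)
       (of_nat (aut (snd g)) / of_nat (tree_wt zs)))"

lemma tens_eval_superset:
  assumes "finite S" "Poly_Mapping.keys T \<subseteq> S"
  shows "tens_eval T F G = (\<Sum>p\<in>S. Poly_Mapping.lookup T p * (mon_eval (fst p) F * mon_eval (snd p) G))"
  unfolding tens_eval_def case_prod_unfold
  using assms by (simp, intro sum.mono_neutral_left) (auto simp: in_keys_iff)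

lemma tens_eval_add: "tens_eval (T + T') F G = tens_eval T F G + tens_eval T' F G"
proof -
  let ?S = "Poly_Mapping.keys T \<union> Poly_Mapping.keys T'"
  have "Poly_Mapping.keys (T + T') \<subseteq> ?S" by (rule Poly_Mapping.keys_add)
  then show ?thesis
    by (simp add: tens_eval_superset[of ?S] lookup_add distrib_right sum.distrib)
qed

lemma tens_eval_sum: "tens_eval (sum T A) F G = (\<Sum>x\<in>A. tens_eval (T x) F G)"
proof (induction A rule: infinite_finite_induct)
  case (insert x A)
  then show ?case by (simp add: tens_eval_add)
qed (simp_all add: tens_eval_def)

lemma tens_eval_single: "tens_eval (Poly_Mapping.single (m, n) c) F G = c * (mon_eval m F * mon_eval n G)"
  by (simp add: tens_eval_def)

lemma mon_eval_single: "mon_eval (Poly_Mapping.single g (Suc 0)) F = A_map (fst g) (snd g) F"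
  by (simp add: mon_eval_def case_prod_unfold)

lemma tens_eval_comult_tree:
  assumes "F \<in> pairs" "G \<in> pairs"
  shows "tens_eval (comult_tree g) F G = A_map (fst g) (snd g) (plethysm G F)"
proof -
  have "A_map (fst g) (snd g) (plethysm G F) =
      (\<Sum>zs | zs \<in> post \<and> tree_deg zs = snd g. of_nat (aut (snd g)) *
        (mon_eval (leaf_mon zs) F * A_map (fst g) (monl (map fst zs)) G / of_nat (tree_wt zs)))"
    by (simp add: A_map_def[of _ _ "plethysm G F"] mcoeff_plethysm[OF assms] sum_distrib_left)
  then show ?thesis
    by (simp add: comult_tree_def tens_eval_sum tens_eval_single mon_eval_single)
qed

lemma leaf_mon_P2: "zs \<in> post \<Longrightarrow> leaf_mon zs \<in> P2_monomials"
  by (fastforce simp: P2_monomials_def leaf_mon_def keys_monl post_def intro: monl_Lambda2)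

lemma root_mon_P2: "zs \<in> post \<Longrightarrow> Poly_Mapping.single (i, monl (map fst zs)) 1 \<in> P2_monomials"
  by (auto simp: P2_monomials_def intro: monl_Lambda2 post_root)

lemma keys_comult_tree: "Poly_Mapping.keys (comult_tree g) \<subseteq> P2_monomials \<times> P2_monomials"
proof -
  have "Poly_Mapping.keys (comult_tree g) \<subseteq> (\<Union>zs\<in>{zs. zs \<in> post \<and> tree_deg zs = snd g}.
     Poly_Mapping.keys (Poly_Mapping.single (leaf_mon zs, Poly_Mapping.single (fst g, monl (map fst zs)) 1 :: mon)
       (of_nat (aut (snd g)) / of_nat (tree_wt zs) :: rat)))"
    unfolding comult_tree_def by (rule keys_sum)
  also have "\<dots> \<subseteq> P2_monomials \<times> P2_monomials"
    using leaf_mon_P2 root_mon_P2 by (auto split: if_splits)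
  finally show ?thesis .
qed

section \<open>Separation of tensors by their values\<close>

lemma vandermonde:
  fixes c v :: "'a \<Rightarrow> rat"
  assumes fin: "finite D" and inj: "inj_on v D" and eq: "\<And>t. (\<Sum>x\<in>D. c x * v x ^ t) = 0" and y: "y \<in> D"
  shows "c y = 0"
proof -
  \<comment> \<open>The power sums vanish, so the same combination of values of any polynomial
    vanishes. This polynomial has its roots at all nodes except the one of y, which isolates
    \<open>c y\<close>.\<close>
  define p where "p = (\<Prod>x\<in>D - {y}. [:- v x, 1:])"
  have p: "poly p z = (\<Prod>x\<in>D - {y}. z - v x)" for z by (simp add: p_def poly_prod)
  have "(\<Sum>x\<in>D. c x * poly p (v x)) = (\<Sum>x\<in>D. \<Sum>t\<le>degree p. coeff p t * (c x * v x ^ t))"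
    by (simp add: poly_altdef sum_distrib_left mult_ac)
  also have "\<dots> = (\<Sum>t\<le>degree p. coeff p t * (\<Sum>x\<in>D. c x * v x ^ t))"
    by (subst sum.swap) (simp add: sum_distrib_left)
  also have "\<dots> = 0" by (simp add: eq)
  finally have "(\<Sum>x\<in>D. c x * poly p (v x)) = 0" .
  moreover have "(\<Sum>x\<in>D. c x * poly p (v x)) = c y * poly p (v y)"
  proof -
    have "poly p (v x) = 0" if "x \<in> D - {y}" for x
      unfolding p using fin that by (intro prod_zero) auto
    then show ?thesis using fin y by (subst sum.remove[OF fin y]) simp
  qed
  moreover have "poly p (v y) \<noteq> 0"
    unfolding p using fin inj y by (auto simp: inj_on_def)
  ultimately show ?thesis by simp
qed

lemma obtain_primes:
  assumes "finite V"
  obtains f :: "'a \<Rightarrow> nat" where "inj_on f V" "\<And>v. v \<in> V \<Longrightarrow> prime (f v)"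
proof -
  obtain B where B: "finite B" "card B = card V" "B \<subseteq> {p :: nat. prime p}"
    using infinite_arbitrarily_large[OF primes_infinite, of "card V"] by blast
  then obtain f where "bij_betw f V B" using finite_same_card_bij[OF assms B(1)] by metis
  then show ?thesis using that[of f] B(3) by (auto simp: bij_betw_def)
qed

text \<open>Unique factorisation: each exponent is recovered as the multiplicity of its
  prime.\<close>

lemma prime_powers_inj:
  fixes f :: "'a \<Rightarrow> nat"
  assumes fin: "finite V" and inj: "inj_on f V" and pr: "\<And>v. v \<in> V \<Longrightarrow> prime (f v)"
    and eq: "(\<Prod>v\<in>V. f v ^ d v) = (\<Prod>v\<in>V. f v ^ e v)" and v: "v \<in> V"
  shows "d v = e v"
proof -
  have m: "multiplicity (f v) (\<Prod>v\<in>V. f v ^ d v) = d v" for d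
  proof -
    have "(\<Prod>v\<in>V. f v ^ d v) = (\<Prod>p\<in>f ` V. p ^ d (inv_into V f p))"
      using inj by (subst prod.reindex) auto
    then show ?thesis
      using multiplicity_prod_prime_powers[of "f ` V" "f v" "\<lambda>p. d (inv_into V f p)"] fin pr v inj by auto
  qed
  show ?thesis using m[of d] m[of e] eq by simp
qed

text \<open>Two elements of the tensor square with the same values at all pairs are equal: at pairs whose
  coefficients are \<open>t\<close>-th powers of distinct primes, the value of a monomial is the \<open>t\<close>-th power of
  an integer which determines the monomial.\<close>

lemma tens_eval_inject:
  assumes keys: "Poly_Mapping.keys T \<subseteq> P2_monomials \<times> P2_monomials"
    and zero: "\<And>F G. F \<in> pairs \<Longrightarrow> G \<in> pairs \<Longrightarrow> tens_eval T F G = 0"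
  shows "T = 0"
proof -
  let ?D = "Poly_Mapping.keys T"
  define A where "A = (\<Union>(m, n)\<in>?D. Poly_Mapping.keys m \<union> Poly_Mapping.keys n)"
  have fA: "finite A" by (auto simp: A_def)
  have sub: "Poly_Mapping.keys m \<subseteq> A" "Poly_Mapping.keys n \<subseteq> A" if "(m, n) \<in> ?D" for m n
    using that by (auto simp: A_def)
  \<comment> \<open>The disjoint sum supplies separate primes for the first series
    (\<open>Inl\<close>) and the second (\<open>Inr\<close>), so the value also tells the two tensor
    factors apart.\<close>
  obtain f :: "gen + gen \<Rightarrow> nat" where f: "inj_on f (A <+> A)" "\<And>v. v \<in> A <+> A \<Longrightarrow> prime (f v)"
    using obtain_primes[of "A <+> A"] fA by auto
  define V where "V = (\<lambda>s (m :: mon). \<Prod>g\<in>A. f (s g) ^ Poly_Mapping.lookup m g)"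
  define val where "val = (\<lambda>(m, n). V Inl m * V Inr n)"
  have inj: "inj_on val ?D"
  proof (rule inj_onI, clarify)
    fix m n m' n' assume D: "(m, n) \<in> ?D" "(m', n') \<in> ?D" and e: "val (m, n) = val (m', n')"
    have v: "val (m, n) = (\<Prod>v\<in>A <+> A. f v ^ (case v of Inl g \<Rightarrow> Poly_Mapping.lookup m g | Inr g \<Rightarrow> Poly_Mapping.lookup n g))" for m n
      using fA by (simp add: val_def V_def prod.Plus)
    have E: "(case v of Inl g \<Rightarrow> Poly_Mapping.lookup m g | Inr g \<Rightarrow> Poly_Mapping.lookup n g) =
        (case v of Inl g \<Rightarrow> Poly_Mapping.lookup m' g | Inr g \<Rightarrow> Poly_Mapping.lookup n' g)" if "v \<in> A <+> A" for v
      using prime_powers_inj[OF _ f e[unfolded v] that] fA by simp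
    have "Poly_Mapping.lookup m g = Poly_Mapping.lookup m' g \<and> Poly_Mapping.lookup n g = Poly_Mapping.lookup n' g" for g
    proof (cases "g \<in> A")
      case True
      then show ?thesis using E[of "Inl g"] E[of "Inr g"] by auto
    next
      case False
      then show ?thesis using sub[OF D(1)] sub[OF D(2)] by (auto simp: in_keys_iff) (metis in_keys_iff subsetD)+
    qed
    then show "m = m' \<and> n = n'" by (auto intro: poly_mapping_eqI)
  qed
  define Ft :: "(gen \<Rightarrow> gen + gen) \<Rightarrow> nat \<Rightarrow> series2" where
    "Ft = (\<lambda>s t i. Mser (\<lambda>l. if l \<in> Lambda2 then of_nat (f (s (i, l)) ^ t) / of_nat (aut l) else 0))"
  have Ft: "Ft s t \<in> pairs" for s t by (auto simp: pairs_def Ft_def)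
  have A_Ft: "A_map i l (Ft s t) = of_nat (f (s (i, l)) ^ t)" if "l \<in> Lambda2" for i l s t
    using that aut_pos[of l] by (simp add: A_map_def Ft_def)
  have eval: "mon_eval m (Ft s t) = of_nat (V s m) ^ t" if m: "m \<in> P2_monomials" "Poly_Mapping.keys m \<subseteq> A" for m s t
  proof -
    have "mon_eval m (Ft s t) = (\<Prod>g\<in>Poly_Mapping.keys m. of_nat (f (s g)) ^ (t * Poly_Mapping.lookup m g))"
      unfolding mon_eval_def using m(1) by (intro prod.cong) (auto simp: P2_monomials_def A_Ft power_mult)
    also have "\<dots> = (\<Prod>g\<in>A. of_nat (f (s g)) ^ (t * Poly_Mapping.lookup m g))"
      using fA m(2) by (intro prod.mono_neutral_left) (auto simp: in_keys_iff)
    also have "\<dots> = (\<Prod>g\<in>A. (of_nat (f (s g)) ^ Poly_Mapping.lookup m g) ^ t)"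
      by (simp only: power_mult[symmetric] mult.commute)
    finally show ?thesis by (simp add: V_def prod_power_distrib)
  qed
  have "(\<Sum>p\<in>?D. Poly_Mapping.lookup T p * of_nat (val p) ^ t) = 0" for t
  proof -
    have "(\<Sum>p\<in>?D. Poly_Mapping.lookup T p * of_nat (val p) ^ t) = tens_eval T (Ft Inl t) (Ft Inr t)"
      unfolding tens_eval_def
    proof (rule sum.cong[OF refl], clarify)
      fix m n assume D: "(m, n) \<in> ?D"
      then have "m \<in> P2_monomials" "n \<in> P2_monomials" using keys by auto
      then show "Poly_Mapping.lookup T (m, n) * of_nat (val (m, n)) ^ t =
          Poly_Mapping.lookup T (m, n) * (mon_eval m (Ft Inl t) * mon_eval n (Ft Inr t))"
        using sub[OF D] by (simp add: eval val_def power_mult_distrib)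
    qed
    then show ?thesis using zero[OF Ft Ft] by simp
  qed
  moreover have "inj_on (\<lambda>p. of_nat (val p) :: rat) ?D"
    using inj by (auto simp: inj_on_def)
  ultimately have "Poly_Mapping.lookup T p = 0" if "p \<in> ?D" for p
    using vandermonde[of ?D "\<lambda>p. of_nat (val p)" "Poly_Mapping.lookup T" p] that by simp
  then have "?D = {}" by (metis all_not_in_conv in_keys_iff)
  then show ?thesis by simp
qed

text \<open>Two solutions of the defining condition differ by an element that vanishes at all pairs
  of series, which is 0 by \<open>tens_eval_inject\<close>.\<close>

lemma comult_gen_eq: "comult_gen g = comult_tree g"
  unfolding comult_gen_def
proof (rule the_equality)
  show "Poly_Mapping.keys (comult_tree g) \<subseteq> P2_monomials \<times> P2_monomials \<and>
     (\<forall>F\<in>pairs. \<forall>G\<in>pairs. tens_eval (comult_tree g) F G = A_map (fst g) (snd g) (plethysm G F))"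
    using keys_comult_tree tens_eval_comult_tree by blast
next
  fix T assume T: "Poly_Mapping.keys T \<subseteq> P2_monomials \<times> P2_monomials \<and>
     (\<forall>F\<in>pairs. \<forall>G\<in>pairs. tens_eval T F G = A_map (fst g) (snd g) (plethysm G F))"
  let ?U = "T - comult_tree g"
  have "?U = 0"
  proof (rule tens_eval_inject)
    show "Poly_Mapping.keys ?U \<subseteq> P2_monomials \<times> P2_monomials"
      using keys_diff[of T "comult_tree g"] T keys_comult_tree[of g] by blast
    fix F G assume FG: "F \<in> pairs" "G \<in> pairs"
    have "tens_eval T F G = tens_eval ?U F G + tens_eval (comult_tree g) F G"
      using tens_eval_add[of ?U "comult_tree g" F G] by simp
    then show "tens_eval ?U F G = 0" using T FG tens_eval_comult_tree by simp
  qed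
  then show "T = comult_tree g" by simp
qed

section \<open>Linear extension of maps on a basis\<close>

lemma lookup_scale [simp]: "Poly_Mapping.lookup (scale c x) k = c * Poly_Mapping.lookup x k"
  by (simp add: scale_def map.rep_eq when_def)

lemma scale_0 [simp]: "scale 0 x = 0"
  and scale_zero [simp]: "scale c 0 = 0"
  and scale_1 [simp]: "scale 1 x = x"
  and scale_add_right: "scale c (x + y) = scale c x + scale c y"
  and scale_add_left: "scale (c + d) x = scale c x + scale d x"
  and scale_scale: "scale c (scale d x) = scale (c * d) x"
  by (auto intro!: poly_mapping_eqI simp: lookup_add distrib_left distrib_right)

lemma scale_sum: "scale c (sum f A) = (\<Sum>x\<in>A. scale c (f x))"
  by (induction A rule: infinite_finite_induct) (simp_all add: scale_add_right)

lemma scale_single [simp]: "scale c (Poly_Mapping.single k d) = Poly_Mapping.single k (c * d)"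
  by (rule poly_mapping_eqI) (simp add: lookup_single when_def)

lemma lin_superset:
  assumes "finite S" "Poly_Mapping.keys x \<subseteq> S"
  shows "lin h x = (\<Sum>b\<in>S. scale (Poly_Mapping.lookup x b) (h b))"
  unfolding lin_def using assms by (intro sum.mono_neutral_left) (auto simp: in_keys_iff)

lemma lin_add: "lin h (x + y) = lin h x + lin h y"
proof -
  let ?S = "Poly_Mapping.keys x \<union> Poly_Mapping.keys y"
  have "Poly_Mapping.keys (x + y) \<subseteq> ?S" by (rule Poly_Mapping.keys_add)
  then show ?thesis by (simp add: lin_superset[of ?S] lookup_add scale_add_left sum.distrib)
qed

lemma lin_scale: "lin h (scale c x) = scale c (lin h x)"
proof -
  have "Poly_Mapping.keys (scale c x) \<subseteq> Poly_Mapping.keys x" by (auto simp: in_keys_iff)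
  then show ?thesis
    by (simp add: lin_superset[of "Poly_Mapping.keys x"] scale_sum scale_scale)
qed

lemma lin_sum: "lin h (sum f A) = (\<Sum>x\<in>A. lin h (f x))"
proof (induction A rule: infinite_finite_induct)
  case (insert x A)
  then show ?case by (simp add: lin_add)
qed (simp_all add: lin_def)

lemma lin_single: "lin h (Poly_Mapping.single k c) = scale c (h k)"
  by (simp add: lin_def)

lemma lin_lin: "lin H (lin h x) = lin (\<lambda>b. lin H (h b)) x"
  unfolding lin_def[of h] lin_def[of "\<lambda>b. lin H (h b)"] lin_sum lin_scale ..

lemma lin_cong: "(\<And>b. b \<in> Poly_Mapping.keys x \<Longrightarrow> h b = h' b) \<Longrightarrow> lin h x = lin h' x"
  unfolding lin_def by (rule sum.cong) auto

text \<open>The isomorphism of bialgebras will have this form, with \<gamma> a bijection between the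
  two bases.\<close>

definition rename :: "('b \<Rightarrow> 'c) \<Rightarrow> ('b \<Rightarrow>\<^sub>0 rat) \<Rightarrow> ('c \<Rightarrow>\<^sub>0 rat)" where
  "rename \<gamma> = lin (\<lambda>b. Poly_Mapping.single (\<gamma> b) 1)"

lemma lookup_rename:
  assumes "inj_on \<gamma> S" "Poly_Mapping.keys x \<subseteq> S" "b \<in> S"
  shows "Poly_Mapping.lookup (rename \<gamma> x) (\<gamma> b) = Poly_Mapping.lookup x b"
proof -
  have "Poly_Mapping.lookup (rename \<gamma> x) (\<gamma> b) =
      (\<Sum>a\<in>Poly_Mapping.keys x. Poly_Mapping.lookup x a when \<gamma> a = \<gamma> b)"
    by (simp add: rename_def lin_def lookup_sum lookup_single when_def if_distrib)
  also have "\<dots> = (\<Sum>a\<in>Poly_Mapping.keys x. Poly_Mapping.lookup x a when a = b)"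
    using assms by (intro sum.cong refl when_cong) (auto dest: inj_onD)
  also have "\<dots> = Poly_Mapping.lookup x b"
    by (simp add: when_def sum.delta' in_keys_iff)
  finally show ?thesis .
qed

lemma lookup_rename_outside:
  assumes "v \<notin> \<gamma> ` Poly_Mapping.keys x"
  shows "Poly_Mapping.lookup (rename \<gamma> x) v = 0"
  using assms by (auto simp: rename_def lin_def lookup_sum lookup_single when_def intro!: sum.neutral)

lemma keys_rename:
  assumes "inj_on \<gamma> S" "Poly_Mapping.keys x \<subseteq> S"
  shows "Poly_Mapping.keys (rename \<gamma> x) = \<gamma> ` Poly_Mapping.keys x"
proof (intro set_eqI iffI)
  fix v assume "v \<in> Poly_Mapping.keys (rename \<gamma> x)"
  then show "v \<in> \<gamma> ` Poly_Mapping.keys x" using lookup_rename_outside[of v \<gamma> x] by (auto simp: in_keys_iff)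
next
  fix v assume "v \<in> \<gamma> ` Poly_Mapping.keys x"
  then show "v \<in> Poly_Mapping.keys (rename \<gamma> x)"
    using lookup_rename[OF assms] assms(2) by (auto simp: in_keys_iff subset_iff)
qed

lemma bij_betw_rename:
  fixes \<gamma> :: "'b \<Rightarrow> 'c"
  assumes b: "bij_betw \<gamma> S S'"
  shows "bij_betw (rename \<gamma>) {x :: 'b \<Rightarrow>\<^sub>0 rat. Poly_Mapping.keys x \<subseteq> S} {y :: 'c \<Rightarrow>\<^sub>0 rat. Poly_Mapping.keys y \<subseteq> S'}"
proof -
  have inj: "inj_on \<gamma> S" and im: "\<gamma> ` S = S'" using b by (auto simp: bij_betw_def)
  let ?\<delta> = "inv_into S \<gamma>"
  have inj': "inj_on ?\<delta> S'" using bij_betw_inv_into[OF b] by (simp add: bij_betw_def)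
  have \<delta>: "?\<delta> (\<gamma> a) = a" if "a \<in> S" for a using inj that by simp
  have \<gamma>: "\<gamma> (?\<delta> v) = v" "?\<delta> v \<in> S" if "v \<in> S'" for v using that im by (auto simp: f_inv_into_f inv_into_into)
  have k: "Poly_Mapping.keys (rename \<gamma> x) \<subseteq> S'" if "Poly_Mapping.keys x \<subseteq> S" for x :: "'b \<Rightarrow>\<^sub>0 rat"
    using keys_rename[OF inj that] that im by auto
  have k': "Poly_Mapping.keys (rename ?\<delta> y) \<subseteq> S" if "Poly_Mapping.keys y \<subseteq> S'" for y :: "'c \<Rightarrow>\<^sub>0 rat"
    using keys_rename[OF inj' that] that \<gamma>(2) by auto
  show ?thesis
  proof (rule bij_betw_byWitness[where f' = "rename ?\<delta>"])
    show "\<forall>x\<in>{x :: 'b \<Rightarrow>\<^sub>0 rat. Poly_Mapping.keys x \<subseteq> S}. rename ?\<delta> (rename \<gamma> x) = x"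
    proof (intro ballI poly_mapping_eqI)
      fix x :: "'b \<Rightarrow>\<^sub>0 rat" and a assume "x \<in> {x. Poly_Mapping.keys x \<subseteq> S}"
      then have x: "Poly_Mapping.keys x \<subseteq> S" by simp
      show "Poly_Mapping.lookup (rename ?\<delta> (rename \<gamma> x)) a = Poly_Mapping.lookup x a"
      proof (cases "a \<in> S")
        case True
        then have "\<gamma> a \<in> S'" using im by blast
        from lookup_rename[OF inj' k[OF x] this] lookup_rename[OF inj x True] \<delta>[OF True] show ?thesis by simp
      next
        case False
        then show ?thesis using k'[OF k[OF x]] x by (metis in_keys_iff subsetD)
      qed
    qed
    show "\<forall>y\<in>{y :: 'c \<Rightarrow>\<^sub>0 rat. Poly_Mapping.keys y \<subseteq> S'}. rename \<gamma> (rename ?\<delta> y) = y"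
    proof (intro ballI poly_mapping_eqI)
      fix y :: "'c \<Rightarrow>\<^sub>0 rat" and v assume "y \<in> {y. Poly_Mapping.keys y \<subseteq> S'}"
      then have y: "Poly_Mapping.keys y \<subseteq> S'" by simp
      show "Poly_Mapping.lookup (rename \<gamma> (rename ?\<delta> y)) v = Poly_Mapping.lookup y v"
      proof (cases "v \<in> S'")
        case True
        from lookup_rename[OF inj k'[OF y] \<gamma>(2)[OF True]] lookup_rename[OF inj' y True] \<gamma>(1)[OF True]
        show ?thesis by simp
      next
        case False
        then show ?thesis using k[OF k'[OF y]] y by (metis in_keys_iff subsetD)
      qed
    qed
  qed (use k k' in auto)
qed

lemma sum_keys_rename:
  assumes "inj_on \<gamma> S" "Poly_Mapping.keys x \<subseteq> S"
  shows "(\<Sum>v\<in>Poly_Mapping.keys (rename \<gamma> x). h v (Poly_Mapping.lookup (rename \<gamma> x) v)) =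
    (\<Sum>a\<in>Poly_Mapping.keys x. h (\<gamma> a) (Poly_Mapping.lookup x a))"
proof -
  have "inj_on \<gamma> (Poly_Mapping.keys x)" using assms by (rule inj_on_subset)
  then have "(\<Sum>v\<in>\<gamma> ` Poly_Mapping.keys x. h v (Poly_Mapping.lookup (rename \<gamma> x) v)) =
      (\<Sum>a\<in>Poly_Mapping.keys x. h (\<gamma> a) (Poly_Mapping.lookup (rename \<gamma> x) (\<gamma> a)))"
    by (simp add: sum.reindex)
  also have "\<dots> = (\<Sum>a\<in>Poly_Mapping.keys x. h (\<gamma> a) (Poly_Mapping.lookup x a))"
    using lookup_rename[OF assms] assms(2) by (intro sum.cong refl) (simp add: subset_iff)
  finally show ?thesis unfolding keys_rename[OF assms] .
qed

lemma poly_mapping_times_sum: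
  fixes x y :: "'b::monoid_add \<Rightarrow>\<^sub>0 rat"
  shows "x * y = (\<Sum>a\<in>Poly_Mapping.keys x. \<Sum>b\<in>Poly_Mapping.keys y.
     Poly_Mapping.single (a + b) (Poly_Mapping.lookup x a * Poly_Mapping.lookup y b))"
proof -
  have "x = (\<Sum>a\<in>Poly_Mapping.keys x. Poly_Mapping.single a (Poly_Mapping.lookup x a))"
    "y = (\<Sum>b\<in>Poly_Mapping.keys y. Poly_Mapping.single b (Poly_Mapping.lookup y b))"
    by (rule poly_mapping_eqI; simp add: lookup_sum lookup_single when_def in_keys_iff)+
  then have "x * y = (\<Sum>a\<in>Poly_Mapping.keys x. Poly_Mapping.single a (Poly_Mapping.lookup x a)) *
      (\<Sum>b\<in>Poly_Mapping.keys y. Poly_Mapping.single b (Poly_Mapping.lookup y b))" by simp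
  then show ?thesis by (simp only: sum_product mult_single)
qed

lemma tens_single: "tens (Poly_Mapping.single a c) (Poly_Mapping.single b d) = Poly_Mapping.single (a, b) (c * d)"
  by (auto simp: tens_def)

lemma lookup_of_nat_times:
  "Poly_Mapping.lookup (of_nat n * x) k = of_nat n * Poly_Mapping.lookup x k"
  for x :: "'b::monoid_add \<Rightarrow>\<^sub>0 rat"
  by (induction n) (simp_all add: lookup_add distrib_right)

lemma prod_list_single:
  "prod_list (map (\<lambda>x. Poly_Mapping.single (k x) (c x)) xs) =
    Poly_Mapping.single (sum_list (map k xs)) (prod_list (map c xs))"
  for k :: "'a \<Rightarrow> 'b::monoid_add" and c :: "'a \<Rightarrow> rat"
  by (induction xs) (simp_all add: mult_single)

section \<open>The simplicial groupoid\<close>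

abbreviation barX :: "(lev list, (nat \<times> lar) list) sgrpd" where
  "barX \<equiv> bar T2"

text \<open>Level 1 is recorded in two forms because the simplifier rewrites 1 to
  \<open>Suc 0\<close>.\<close>

lemma barX_lev: "simp_lev barX 0 = Sr barG0" "simp_lev barX 1 = Sr barG1" "simp_lev barX 2 = Sr barG2"
  "simp_lev barX (Suc 0) = Sr barG1"
  by (simp_all add: bar_def barQ_T2 del: barQ.simps)

lemma barX_face: "face barX 2 1 = Sr_map (qface T2 2 1)" "face barX 2 0 = Sr_map (qface T2 2 0)"
  "face barX 2 2 = fcomp Sr_mu (Sr_map (qcut T2 2))" "degen barX 0 0 = Sr_map (qdegen T2 0 0)"
  "face barX 2 (Suc 0) = Sr_map (qface T2 2 (Suc 0))"
  by (simp_all add: bar_def)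

lemma groupoid_X: "groupoid (Sr barG0)" "groupoid (Sr barG1)" "groupoid (Sr barG2)"
  by (intro groupoid_Sr groupoid_barG0 groupoid_barG1 groupoid_barG2)+

lemma functor_X: "is_functor (Sr barG2) (face barX 2 1) (Sr barG1)"
  "is_functor (Sr barG2) (face barX 2 0) (Sr barG1)"
  "is_functor (Sr barG2) (face barX 2 2) (Sr barG1)"
  "is_functor (Sr barG0) (degen barX 0 0) (Sr barG1)"
  unfolding barX_face
  by (intro functor_Sr_map functor_face_comp functor_face_root functor_unit
      functor_fcomp[OF functor_Sr_map[OF functor_cut] functor_Sr_mu])+

lemma Ob_barG0: "Ob barG0 = Colour ` UNIV"
  by (simp add: barG0_def relabel_def colG_def discrete_def)

lemma deg_barG0: "deg barG0 (Colour c) = 1" "finite (outs barG0 (Colour c))"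
proof -
  have "outs barG0 (Colour c) = ColourA ` outs colG c"
    unfolding barG0_def by (rule outs_relabel) simp_all
  then show "deg barG0 (Colour c) = 1" "finite (outs barG0 (Colour c))"
    by (simp_all add: deg_def colG_def outs_discrete)
qed

lemma onOb_X:
  "onOb (face barX 2 1) x = map (onOb (qface T2 2 1)) x"
  "onOb (face barX 2 0) x = map (onOb (qface T2 2 0)) x"
  "onOb (face barX 2 2) x = concat (map (onOb (qcut T2 2)) x)"
  "onOb (degen barX 0 0) y = map (onOb (qdegen T2 0 0)) y"
  unfolding barX_face by (simp_all add: Sr_map_def Sr_mu_def fcomp_def)

lemma barG1_cases:
  assumes "y \<in> Ob barG1"
  obtains i ks where "y = Oper (enc_op i ks)" "ks \<in> posl"
  using assms enc_dec_op by (auto simp: Ob_barG1) metis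

lemma barG2_cases:
  assumes "x \<in> Ob barG2"
  obtains i zs where "x = enc_tree i zs" "zs \<in> post"
  using assms enc_dec_tree by metis

lemma finite_outs_X:
  "x \<in> Ob (Sr barG0) \<Longrightarrow> finite (outs (Sr barG0) x)"
  "y \<in> Ob (Sr barG1) \<Longrightarrow> finite (outs (Sr barG1) y)"
  "z \<in> Ob (Sr barG2) \<Longrightarrow> finite (outs (Sr barG2) z)"
proof -
  show "finite (outs (Sr barG0) x)" if "x \<in> Ob (Sr barG0)"
    using that deg_barG0 by (intro deg_Sr(2)) (auto simp: Ob_Sr Ob_barG0)
  show "finite (outs (Sr barG1) y)" if "y \<in> Ob (Sr barG1)"
  proof (rule deg_Sr(2))
    fix u assume "u \<in> set y"
    then have "u \<in> Ob barG1" using that by (auto simp: Ob_Sr)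
    then show "finite (outs barG1 u)" by (rule barG1_cases) (simp add: deg_barG1 deg_opG)
  qed (use that in \<open>auto simp: Ob_Sr\<close>)
  show "finite (outs (Sr barG2) z)" if "z \<in> Ob (Sr barG2)"
  proof (rule deg_Sr(2))
    fix u assume "u \<in> set z"
    then have "u \<in> Ob barG2" using that by (auto simp: Ob_Sr)
    then show "finite (outs barG2 u)" by (rule barG2_cases) (simp add: deg_barG2)
  qed (use that in \<open>auto simp: Ob_Sr\<close>)
qed

definition lev_type :: "lev \<Rightarrow> gen" where
  "lev_type y = op_type (un_Oper y)"

lemma lev_type_enc: "ks \<in> posl \<Longrightarrow> lev_type (Oper (enc_op i ks)) = (i, monl ks)"
  by (simp add: lev_type_def op_type_enc)

text \<open>A tuple of operations becomes the product of the generators of its entries, so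
  juxtaposition of tuples becomes multiplication of monomials.\<close>

definition obj_mon :: "lev list \<Rightarrow> mon" where
  "obj_mon xs = monl (map lev_type xs)"

lemma classifies_barG1: "classifies barG1 lev_type"
proof -
  have "hom barG1 (Oper x) (Oper y) = OperA ` hom opG x y" for x y
    unfolding barG1_def by (rule hom_relabel) simp_all
  then show ?thesis using classifies_opG by (auto simp: classifies_def Ob_barG1 lev_type_def)
qed

lemma classifies_X1: "classifies (Sr barG1) obj_mon"
  using classifies_Sr[OF classifies_barG1 groupoid_barG1]
  by (rule classifies_cong) (simp add: obj_mon_def monl_eq_iff)

lemma hom_X1: "x \<in> Ob (Sr barG1) \<Longrightarrow> y \<in> Ob (Sr barG1) \<Longrightarrow> hom (Sr barG1) x y \<noteq> {} \<longleftrightarrow> obj_mon x = obj_mon y"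
  by (rule classifiesD[OF classifies_X1])

text \<open>The face acts entrywise, so it suffices to bound the preimages of one operation; its
  output determines that of the tree, and \<open>finite_comp_tree\<close> bounds the rest.\<close>

lemma finite_fibre_comp:
  assumes "z \<in> Ob (Sr barG1)"
  shows "finite {x \<in> Ob (Sr barG2). onOb (face barX 2 1) x = z}"
proof -
  have "finite {xs. set xs \<subseteq> Ob barG2 \<and> map (onOb (qface T2 2 1)) xs = z}"
  proof (rule finite_typed_lists)
    fix t assume "t \<in> set z"
    then have "t \<in> Ob barG1" using assms by (auto simp: Ob_Sr)
    then obtain i u where t: "t = Oper (enc_op i u)" "u \<in> posl" by (rule barG1_cases)
    have "{x. x \<in> Ob barG2 \<and> onOb (qface T2 2 1) x = t} \<subseteq> enc_tree i ` {zs. zs \<in> post \<and> comp_tree zs = u}"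
    proof clarify
      fix x assume x: "x \<in> Ob barG2" and e: "t = onOb (qface T2 2 1) x"
      obtain j zs where z: "x = enc_tree j zs" "zs \<in> post" using x by (rule barG2_cases)
      have "enc_op i u = enc_op j (comp_tree zs)" using e t face_comp_enc[OF z(2), of j] z(1) by simp
      then have "dec_op (enc_op i u) = dec_op (enc_op j (comp_tree zs))" by (rule arg_cong)
      then have "(i, u) = (j, comp_tree zs)"
        by (simp only: dec_enc_op[OF t(2)] dec_enc_op[OF comp_tree_posl[OF z(2)]])
      then show "x \<in> enc_tree i ` {zs. zs \<in> post \<and> comp_tree zs = u}" using z by auto
    qed
    then show "finite {x. x \<in> Ob barG2 \<and> onOb (qface T2 2 1) x = t}"
      by (rule finite_subset) (intro finite_imageI finite_comp_tree)
  qed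
  then show ?thesis unfolding onOb_X Ob_Sr by (rule finite_subset[rotated]) blast
qed

lemma finite_fibre_unit:
  assumes "z \<in> Ob (Sr barG1)"
  shows "finite {x \<in> Ob (Sr barG0). onOb (degen barX 0 0) x = z}"
proof -
  have f: "finite (Ob barG0)" unfolding Ob_barG0 UNIV_two[symmetric] by simp
  have "finite {xs. set xs \<subseteq> Ob barG0 \<and> map (onOb (qdegen T2 0 0)) xs = z}"
    by (rule finite_typed_lists) (rule finite_subset[OF _ f], auto)
  then show ?thesis unfolding onOb_X Ob_Sr by (rule finite_subset[rotated]) blast
qed

lemma locally_finite_barX: "locally_finite barX"
  unfolding locally_finite_def barX_lev
proof (intro ballI conjI)
  fix f assume f: "f \<in> Ob (Sr barG1)"
  show "finite (Aut (Sr barG1) f)" by (rule finite_subset[OF Aut_subset_outs finite_outs_X(2)[OF f]])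
  show "finite_grpd (hfib (Sr barG2) (face barX 2 1) (Sr barG1) f)"
    by (rule finite_grpd_hfib(1)[OF groupoid_X(3,2) functor_X(1) f finite_outs_X(3,2) finite_fibre_comp])
  show "finite_grpd (hfib (Sr barG0) (degen barX 0 0) (Sr barG1) f)"
    by (rule finite_grpd_hfib(1)[OF groupoid_X(1,2) functor_X(4) f finite_outs_X(1,2) finite_fibre_unit])
qed

section \<open>Structure constants\<close>

lemma mult_Aut_prodG: "card (Aut (prodG G H) (a, b)) = card (Aut G a) * card (Aut H b)"
  by (simp add: Aut_eq_hom hom_prodG card_cartesian_product)

text \<open>The homotopy fibre contributes the automorphisms of f, a and b. Those of a and b cancel
  against the denominator in the definition of the coefficient.\<close>

lemma comult_coeff_eq:
  assumes f: "f \<in> Ob (Sr barG1)" and a: "a \<in> Ob (Sr barG1)" and b: "b \<in> Ob (Sr barG1)"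
  shows "comult_coeff barX f a b = of_nat (card (Aut (Sr barG1) f)) *
    (\<Sum>x | x \<in> Ob (Sr barG2) \<and> obj_mon (onOb (face barX 2 1) x) = obj_mon f \<and>
       obj_mon (onOb (face barX 2 2) x) = obj_mon a \<and> obj_mon (onOb (face barX 2 0) x) = obj_mon b.
       1 / of_nat (deg (Sr barG2) x))"
proof -
  let ?X1 = "Sr barG1" and ?X2 = "Sr barG2"
  let ?L = "prodG ?X1 ?X1"
  have fL: "finite (outs ?L u)" if "u \<in> Ob ?L" for u
    using that finite_outs_X(2) unfolding outs_prodG by (auto simp: prodG_def)
  have ab: "(a, b) \<in> Ob ?L" using a b by (simp add: prodG_def)
  have "gcard (Phi barX f a b) = of_nat (card (Aut ?X1 f)) * of_nat (card (Aut ?L (a, b))) *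
      (\<Sum>x | x \<in> Ob ?X2 \<and> hom ?X1 (onOb (face barX 2 1) x) f \<noteq> {} \<and>
        hom ?L (onOb (fpair (face barX 2 2) (face barX 2 0)) x) (a, b) \<noteq> {}. 1 / of_nat (deg ?X2 x))"
    unfolding Phi_def barX_lev
    by (rule gcard_double_hfib[OF groupoid_X(3,2) groupoid_prodG[OF groupoid_X(2) groupoid_X(2)] functor_X(1)
          functor_fpair[OF functor_X(3,2)] f ab finite_outs_X(3,2) fL finite_fibre_comp])
  also have "{x. x \<in> Ob ?X2 \<and> hom ?X1 (onOb (face barX 2 1) x) f \<noteq> {} \<and>
        hom ?L (onOb (fpair (face barX 2 2) (face barX 2 0)) x) (a, b) \<noteq> {}} =
      {x. x \<in> Ob ?X2 \<and> obj_mon (onOb (face barX 2 1) x) = obj_mon f \<and>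
       obj_mon (onOb (face barX 2 2) x) = obj_mon a \<and> obj_mon (onOb (face barX 2 0) x) = obj_mon b}"
    using functorD(1)[OF functor_X(1)] functorD(1)[OF functor_X(2)] functorD(1)[OF functor_X(3)] f a b
    by (intro Collect_cong conj_cong refl) (auto simp: hom_prodG fpair_def hom_X1[simplified])
  finally show ?thesis
    using deg_eq(4)[OF groupoid_X(2) a finite_outs_X(2)[OF a]] deg_eq(4)[OF groupoid_X(2) b finite_outs_X(2)[OF b]]
    by (simp add: comult_coeff_def barX_lev mult_Aut_prodG)
qed

lemma sum_barG1:
  assumes "l \<in> Lambda2"
  shows "(\<Sum>y | y \<in> Ob barG1 \<and> lev_type y = (i, l). 1 / of_nat (deg barG1 y)) = (1 / of_nat (aut l) :: rat)"
    and "finite {y. y \<in> Ob barG1 \<and> lev_type y = (i, l)}"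
proof -
  have S: "{y. y \<in> Ob barG1 \<and> lev_type y = (i, l)} = (\<lambda>ks. Oper (enc_op i ks)) ` {t. t \<in> posl \<and> monl t = l}" (is "?l = ?r")
  proof (intro set_eqI iffI)
    fix y assume y: "y \<in> ?l"
    then have "y \<in> Ob barG1" by simp
    then obtain j ks where "y = Oper (enc_op j ks)" "ks \<in> posl" by (rule barG1_cases)
    then show "y \<in> ?r" using y by (auto simp: lev_type_enc)
  qed (auto simp: Ob_barG1 lev_type_enc enc_op_Ob)
  show "finite ?l" unfolding S using finite_posl_monl by simp
  have "inj_on (\<lambda>ks. Oper (enc_op i ks) :: lev) {t. t \<in> posl \<and> monl t = l}"
    using dec_enc_op by (auto simp: inj_on_def) (metis prod.inject)
  then have "(\<Sum>y\<in>?l. 1 / of_nat (deg barG1 y)) = (\<Sum>t | t \<in> posl \<and> monl t = l. 1 / of_nat (wt t) :: rat)"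
    unfolding S by (subst sum.reindex) (auto simp: deg_barG1 deg_opG intro!: sum.cong)
  then show "(\<Sum>y\<in>?l. 1 / of_nat (deg barG1 y)) = (1 / of_nat (aut l) :: rat)"
    using sum_inverse_wt[OF assms] by simp
qed

lemma prod_list_inverse: "prod_list (map (\<lambda>x. 1 / of_nat (f x)) xs) = (1 / of_nat (prod_list (map f xs)) :: rat)"
  by (induction xs) simp_all

lemma deg_Sr_rat:
  "xs \<noteq> [] \<Longrightarrow> 1 / (of_nat (deg (Sr G) xs) :: rat) =
    prod_list (map (\<lambda>x. 1 / of_nat (deg G x)) xs) / of_nat (fact (length xs))"
  by (simp add: deg_Sr prod_list_inverse)

lemma lev_type_Lambda2: "y \<in> Ob barG1 \<Longrightarrow> snd (lev_type y) \<in> Lambda2"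
  by (erule barG1_cases) (simp add: lev_type_enc monl_Lambda2)

text \<open>\<open>sum_over_classes\<close> is read backwards: the inverse order of the group is a
  weighted count of the class, and \<open>sum_monl_lists\<close> evaluates that count. This avoids
  describing the group itself, in which entries of equal type may be interchanged.\<close>

lemma card_Aut_X1:
  assumes f: "f \<in> Ob (Sr barG1)"
  shows "card (Aut (Sr barG1) f) = pfact (obj_mon f) * prod_list (map (\<lambda>y. aut (snd (lev_type y))) f)"
proof -
  let ?X = "Sr barG1" and ?gs = "map lev_type f"
  let ?c = "iso_class ?X f"
  have fne: "f \<noteq> []" "set f \<subseteq> Ob barG1" using f by (auto simp: Ob_Sr)
  have gL: "snd g \<in> Lambda2" if "g \<in> set ?gs" for g using that fne lev_type_Lambda2 by auto
  have fin: "finite {y. y \<in> Ob barG1 \<and> lev_type y = g}"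
    and val: "(\<Sum>y | y \<in> Ob barG1 \<and> lev_type y = g. 1 / of_nat (deg barG1 y)) = (1 / of_nat (aut (snd g)) :: rat)"
    if "g \<in> set ?gs" for g
    using sum_barG1[OF gL[OF that], of "fst g"] by simp_all
  have c: "?c \<in> pi0 ?X" by (rule iso_class_in_pi0[OF f])
  have "hom ?X (rep ?c) f \<noteq> {}"
    using rep_iso_class[OF groupoid_X(2) f] hom_sym[OF groupoid_X(2)] by (simp add: iso_class_iff)
  then have "card (Aut ?X (rep ?c)) = card (Aut ?X f)" using card_hom_eq(1,2)[OF groupoid_X(2)] by metis
  then have "(1 / of_nat (card (Aut ?X f)) :: rat) = (\<Sum>x | x \<in> Ob ?X \<and> iso_class ?X x = ?c. 1 / of_nat (deg ?X x))"
    using sum_over_classes[OF groupoid_X(2) finite_outs_X(2) c] by simp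
  also have "{x. x \<in> Ob ?X \<and> iso_class ?X x = ?c} = {xs. set xs \<subseteq> Ob barG1 \<and> monl (map lev_type xs) = monl ?gs}"
  proof -
    have "x \<in> Ob ?X \<and> iso_class ?X x = ?c \<longleftrightarrow> x \<in> Ob ?X \<and> obj_mon x = obj_mon f" for x
    proof (cases "x \<in> Ob ?X")
      case True
      have "iso_class ?X x = ?c \<longleftrightarrow> x \<in> ?c" using mem_pi0_class[OF groupoid_X(2) c True] by simp
      also have "\<dots> \<longleftrightarrow> obj_mon x = obj_mon f" using True hom_X1[OF f True] by (auto simp: iso_class_iff)
      finally show ?thesis using True by simp
    qed simp
    moreover have "x \<noteq> []" if "obj_mon x = obj_mon f" for x
      using that fne(1) by (auto simp: obj_mon_def)
    ultimately show ?thesis by (auto simp: obj_mon_def Ob_Sr)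
  qed
  also have "(\<Sum>xs\<in>\<dots>. 1 / of_nat (deg ?X xs)) =
      (\<Sum>xs\<in>{xs. set xs \<subseteq> Ob barG1 \<and> monl (map lev_type xs) = monl ?gs}.
        prod_list (map (\<lambda>y. 1 / of_nat (deg barG1 y)) xs)) / (of_nat (fact (length f)) :: rat)"
    unfolding sum_divide_distrib
  proof (rule sum.cong[OF refl])
    fix xs assume "xs \<in> {xs. set xs \<subseteq> Ob barG1 \<and> monl (map lev_type xs) = monl ?gs}"
    then have "monl (map lev_type xs) = monl ?gs" by simp
    from length_monl[OF this] have l: "length xs = length f" by simp
    then have "xs \<noteq> []" using fne(1) by auto
    from deg_Sr_rat[OF this] show "1 / of_nat (deg ?X xs) =
        prod_list (map (\<lambda>y. 1 / of_nat (deg barG1 y)) xs) / (of_nat (fact (length f)) :: rat)" by (simp add: l)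
  qed
  also have "\<dots> = of_nat (card (permutations_of_multiset (mset ?gs))) *
      prod_list (map (\<lambda>g. \<Sum>y | y \<in> Ob barG1 \<and> lev_type y = g. 1 / of_nat (deg barG1 y)) ?gs) / of_nat (fact (length f))"
    by (simp only: sum_monl_lists[OF fin])
  also have "map (\<lambda>g. \<Sum>y | y \<in> Ob barG1 \<and> lev_type y = g. 1 / of_nat (deg barG1 y)) ?gs =
      map (\<lambda>g. 1 / (of_nat (aut (snd g)) :: rat)) ?gs"
    using val by (intro map_cong refl) blast
  also have "of_nat (card (permutations_of_multiset (mset ?gs))) *
      prod_list (map (\<lambda>g. 1 / (of_nat (aut (snd g)) :: rat)) ?gs) / of_nat (fact (length f)) =
      of_nat (card (permutations_of_multiset (mset ?gs))) / of_nat (fact (length ?gs)) *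
      prod_list (map (\<lambda>g. 1 / (of_nat (aut (snd g)) :: rat)) ?gs)" by simp
  also have "\<dots> = 1 / of_nat (pfact (obj_mon f) * prod_list (map (\<lambda>y. aut (snd (lev_type y))) f))"
    unfolding card_perms_rat prod_list_inverse by (simp add: obj_mon_def comp_def)
  finally have "of_nat (card (Aut ?X f)) = (of_nat (pfact (obj_mon f) * prod_list (map (\<lambda>y. aut (snd (lev_type y))) f)) :: rat)"
    by (simp only: divide_eq_eq_1 inverse_eq_divide[symmetric] inverse_eq_iff_eq)
  then show ?thesis by (simp only: of_nat_eq_iff)
qed

section \<open>Products of comultiplications as sums over tuples of trees\<close>

definition tree_type :: "lev \<Rightarrow> gen" where
  "tree_type x = lev_type (onOb (qface T2 2 1) x)"

text \<open>One summand of \<open>comult_tree\<close>, written as a function of an object of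
  \<open>barG2\<close>. The terms of all trees of type g add up to \<open>comult_tree g\<close>, and
  products of terms describe tuples of trees.\<close>

definition tree_term :: "lev \<Rightarrow> (mon \<times> mon \<Rightarrow>\<^sub>0 rat)" where
  "tree_term x = Poly_Mapping.single
     (obj_mon (onOb (qcut T2 2) x), Poly_Mapping.single (lev_type (onOb (qface T2 2 0) x)) 1)
     (of_nat (aut (snd (tree_type x))) / of_nat (deg barG2 x))"

lemma tree_type_enc: "zs \<in> post \<Longrightarrow> tree_type (enc_tree i zs) = (i, tree_deg zs)"
  unfolding tree_type_def face_comp_enc
  by (simp add: lev_type_enc comp_tree_posl tree_deg_def)

lemma obj_mon_leaves: "zs \<in> post \<Longrightarrow> obj_mon (enc_leaves zs) = leaf_mon zs"
proof -
  assume "zs \<in> post"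
  then have "map lev_type (enc_leaves zs) = map (\<lambda>((c, k), t). (c, monl t)) zs"
    by (auto simp: enc_leaves_def post_def lev_type_enc)
  then show ?thesis by (simp only: obj_mon_def leaf_mon_def)
qed

lemma tree_fibre: "{x. x \<in> Ob barG2 \<and> tree_type x = g} = enc_tree (fst g) ` {zs. zs \<in> post \<and> tree_deg zs = snd g}"
  (is "?l = ?r")
proof (intro set_eqI iffI)
  fix x assume x: "x \<in> ?l"
  then have "x \<in> Ob barG2" by simp
  then obtain i zs where "x = enc_tree i zs" "zs \<in> post" by (rule barG2_cases)
  then show "x \<in> ?r" using x by (auto simp: tree_type_enc)
next
  fix x assume "x \<in> ?r"
  then show "x \<in> ?l" using bij_betwE[OF bij_enc_tree] by (auto simp: tree_type_enc)
qed

lemma finite_tree_fibre: "finite {x. x \<in> Ob barG2 \<and> tree_type x = g}"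
  unfolding tree_fibre using finite_tree_deg by simp

lemma sum_tree_term: "(\<Sum>x | x \<in> Ob barG2 \<and> tree_type x = g. tree_term x) = comult_tree g"
proof -
  have "inj_on (enc_tree (fst g)) {zs. zs \<in> post \<and> tree_deg zs = snd g}"
    by (rule inj_onI) (metis (mono_tags, lifting) dec_enc_tree mem_Collect_eq prod.inject)
  then show ?thesis unfolding tree_fibre comult_tree_def
    by (subst sum.reindex)
      (auto simp: tree_term_def tree_type_enc cut_enc face_root_enc obj_mon_leaves lev_type_enc post_root
        deg_barG2 tree_wt_def intro!: sum.cong)
qed

text \<open>Under convolution, single terms multiply by adding their indices, and the monomials of
  the two outer faces of a tuple of trees add up along its entries.\<close>

lemma prod_list_tree_term:
  "prod_list (map tree_term xs) = Poly_Mapping.single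
     (obj_mon (onOb (face barX 2 2) xs), obj_mon (onOb (face barX 2 0) xs))
     (of_nat (prod_list (map (\<lambda>g. aut (snd g)) (map tree_type xs))) * prod_list (map (\<lambda>x. 1 / of_nat (deg barG2 x)) xs))"
proof -
  have "sum_list (map (\<lambda>x. (obj_mon (onOb (qcut T2 2) x), Poly_Mapping.single (lev_type (onOb (qface T2 2 0) x)) 1)) xs) =
      (obj_mon (onOb (face barX 2 2) xs), obj_mon (onOb (face barX 2 0) xs))"
    unfolding onOb_X by (induction xs) (simp_all add: obj_mon_def monl_append monl_Cons zero_prod_def)
  moreover have "prod_list (map (\<lambda>x. of_nat (aut (snd (tree_type x))) / of_nat (deg barG2 x)) xs) =
      (of_nat (prod_list (map (\<lambda>g. aut (snd g)) (map tree_type xs))) * prod_list (map (\<lambda>x. 1 / of_nat (deg barG2 x)) xs) :: rat)"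
    by (induction xs) simp_all
  ultimately show ?thesis unfolding tree_term_def prod_list_single by simp
qed

text \<open>\<open>sum_monl_lists\<close>, applied in the tensor square to \<open>tree_term\<close>,
  turns the product of comultiplications into a sum over all tuples of trees whose composites have
  the types of f. Comparing coefficients at (m, n) selects the tuples with the prescribed outer
  faces.\<close>

lemma lookup_prod_comult_tree:
  assumes f: "f \<in> Ob (Sr barG1)"
  shows "Poly_Mapping.lookup (prod_list (map comult_tree (map lev_type f))) (m, n) =
    of_nat (card (Aut (Sr barG1) f)) *
    (\<Sum>x | x \<in> Ob (Sr barG2) \<and> obj_mon (onOb (face barX 2 1) x) = obj_mon f \<and>
       obj_mon (onOb (face barX 2 2) x) = m \<and> obj_mon (onOb (face barX 2 0) x) = n.
       1 / of_nat (deg (Sr barG2) x))"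
proof -
  let ?gs = "map lev_type f"
  let ?A = "{xs. set xs \<subseteq> Ob barG2 \<and> monl (map tree_type xs) = monl ?gs}"
  let ?C = "\<lambda>xs. obj_mon (onOb (face barX 2 2) xs) = m \<and> obj_mon (onOb (face barX 2 0) xs) = n"
  let ?p = "of_nat (card (permutations_of_multiset (mset ?gs))) :: rat"
  let ?a = "of_nat (prod_list (map (\<lambda>g. aut (snd g)) ?gs)) :: rat"
  let ?d = "\<lambda>xs. 1 / of_nat (deg (Sr barG2) xs) :: rat"
  have fne: "f \<noteq> []" using f by (simp add: Ob_Sr)
  have fA: "finite ?A" by (rule finite_monl_lists) (rule finite_tree_fibre)
  have S: "{xs. xs \<in> ?A \<and> ?C xs} = {x. x \<in> Ob (Sr barG2) \<and> obj_mon (onOb (face barX 2 1) x) = obj_mon f \<and> ?C x}"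
  proof -
    have "monl (map tree_type xs) = monl ?gs \<longleftrightarrow> obj_mon (onOb (face barX 2 1) xs) = obj_mon f" for xs
      by (simp only: onOb_X obj_mon_def tree_type_def[abs_def] map_map comp_def)
    moreover have "xs \<noteq> []" if "monl (map tree_type xs) = monl ?gs" for xs
      using length_monl[OF that] fne by auto
    ultimately show ?thesis unfolding Ob_Sr by blast
  qed
  have w: "Poly_Mapping.lookup (prod_list (map tree_term xs)) (m, n) = (if ?C xs then ?a * of_nat (fact (length f)) * ?d xs else 0)"
    if "xs \<in> ?A" for xs
  proof -
    have e: "monl (map tree_type xs) = monl ?gs" using that by simp
    have l: "length xs = length f" using length_monl[OF e] by simp
    then have "xs \<noteq> []" using fne by auto
    then have "?d xs = prod_list (map (\<lambda>x. 1 / of_nat (deg barG2 x)) xs) / of_nat (fact (length f))"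
      by (simp only: deg_Sr_rat l not_False_eq_True)
    then have "prod_list (map (\<lambda>x. 1 / of_nat (deg barG2 x)) xs) = of_nat (fact (length f)) * ?d xs" by simp
    moreover have "prod_list (map (\<lambda>g. aut (snd g)) (map tree_type xs)) = prod_list (map (\<lambda>g. aut (snd g)) ?gs)"
      using e unfolding monl_eq_iff prod_list_mset by (simp only:)
    ultimately show ?thesis unfolding prod_list_tree_term lookup_single when_def by (simp only: prod.inject mult.assoc)
  qed
  have "?p * Poly_Mapping.lookup (prod_list (map comult_tree ?gs)) (m, n) =
      Poly_Mapping.lookup (of_nat (card (permutations_of_multiset (mset ?gs))) * prod_list (map comult_tree ?gs)) (m, n)"
    by (rule lookup_of_nat_times[symmetric])
  also have "of_nat (card (permutations_of_multiset (mset ?gs))) * prod_list (map comult_tree ?gs) =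
      (\<Sum>xs\<in>?A. prod_list (map tree_term xs))"
    by (simp only: sum_monl_lists[OF finite_tree_fibre] sum_tree_term)
  also have "Poly_Mapping.lookup \<dots> (m, n) = (\<Sum>xs\<in>?A. if ?C xs then ?a * of_nat (fact (length f)) * ?d xs else 0)"
    unfolding lookup_sum by (intro sum.cong refl w)
  also have "\<dots> = ?a * of_nat (fact (length f)) * (\<Sum>xs | xs \<in> ?A \<and> ?C xs. ?d xs)"
    unfolding sum_distrib_left using fA by (intro sum.inter_filter[symmetric])
  \<comment> \<open>The factorial comes from the degree of a tuple. Splitting off the number ?p of
    orders of the types cancels the factor on the left and leaves \<open>pfact\<close>, which
    together with ?a is the number of automorphisms of f.\<close>
  also have "of_nat (fact (length f)) = ?p * of_nat (pfact (obj_mon f))"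
    using card_perms[of ?gs] unfolding of_nat_mult[symmetric] obj_mon_def by simp
  finally have eq: "?p * Poly_Mapping.lookup (prod_list (map comult_tree ?gs)) (m, n) =
      ?p * (of_nat (pfact (obj_mon f)) * ?a * (\<Sum>xs | xs \<in> ?A \<and> ?C xs. ?d xs))"
    by (simp only: mult_ac)
  have "?p \<noteq> 0"
    using card_perms[of ?gs] by (metis fact_nonzero mult_zero_left of_nat_eq_0_iff)
  from mult_left_cancel[OF this, THEN iffD1, OF eq]
  have "Poly_Mapping.lookup (prod_list (map comult_tree ?gs)) (m, n) =
      of_nat (pfact (obj_mon f)) * ?a * (\<Sum>xs | xs \<in> ?A \<and> ?C xs. ?d xs)" .
  then show ?thesis unfolding S card_Aut_X1[OF f] by (simp add: comp_def)
qed

section \<open>The counit\<close>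

definition unit_type :: "lev \<Rightarrow> gen" where
  "unit_type x = lev_type (onOb (qdegen T2 0 0) x)"

lemma unit_type_Colour: "unit_type (Colour c) = (c, Poly_Mapping.single (c, 1) 1)"
proof -
  have "[(c, 1)] \<in> posl" by (simp add: posl_def)
  then show ?thesis unfolding unit_type_def unit_enc by (simp only: lev_type_enc) (simp add: monl_Cons)
qed

lemma A_map_pair_id: "A_map i l pair_id = of_nat (aut l) * (if l = Poly_Mapping.single (i, 1) 1 then 1 else 0)"
  by (simp add: A_map_def pair_id_def)

lemma unit_fibre: "{x. x \<in> Ob barG0 \<and> unit_type x = g} =
    (if snd g = Poly_Mapping.single (fst g, 1) 1 then {Colour (fst g)} else {})"
  by (cases g) (auto simp: Ob_barG0 unit_type_Colour)

text \<open>Both sides vanish unless every entry of f is isomorphic to a unit. The left side counts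
  tuples of colours by the same method as for trees, their degree being just the factorial of the
  length.\<close>

lemma counit_coeff_eq:
  assumes f: "f \<in> Ob (Sr barG1)"
  shows "counit_coeff barX f = mon_eval (obj_mon f) pair_id"
proof -
  let ?gs = "map lev_type f"
  let ?A = "{xs. set xs \<subseteq> Ob barG0 \<and> monl (map unit_type xs) = monl ?gs}"
  let ?p = "of_nat (card (permutations_of_multiset (mset ?gs))) :: rat"
  have fne: "f \<noteq> []" using f by (simp add: Ob_Sr)
  have S: "{x. x \<in> Ob (Sr barG0) \<and> hom (Sr barG1) (onOb (degen barX 0 0) x) f \<noteq> {}} = ?A"
  proof -
    have "hom (Sr barG1) (onOb (degen barX 0 0) x) f \<noteq> {} \<longleftrightarrow> monl (map unit_type x) = monl ?gs"
      if "x \<in> Ob (Sr barG0)" for x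
      unfolding hom_X1[OF functorD(1)[OF functor_X(4) that] f]
      by (simp only: onOb_X obj_mon_def unit_type_def[abs_def] map_map comp_def)
    moreover have "x \<noteq> []" if "monl (map unit_type x) = monl ?gs" for x
      using length_monl[OF that] fne by auto
    ultimately show ?thesis unfolding Ob_Sr by blast
  qed
  have d: "deg (Sr barG0) xs = fact (length f)" if "xs \<in> ?A" for xs
  proof -
    have l: "length xs = length f" using length_monl[of "map unit_type xs" ?gs] that by simp
    then have "xs \<noteq> []" using fne by auto
    moreover have "prod_list (map (deg barG0) xs) = 1"
      using that by (intro prod_list_one) (auto simp: Ob_barG0 deg_barG0)
    ultimately show ?thesis by (simp add: deg_Sr l)
  qed
  \<comment> \<open>Counting is summation of the constant weight 1, and each type is that of at most
    one unit.\<close>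
  have cA: "of_nat (card ?A) = ?p * prod_list (map (\<lambda>g. if snd g = Poly_Mapping.single (fst g, 1) 1 then 1 else 0) ?gs)"
  proof -
    have "prod_list (map (\<lambda>_. 1 :: rat) xs) = 1" for xs :: "lev list" by (induction xs) simp_all
    then have "of_nat (card ?A) = (\<Sum>xs\<in>?A. prod_list (map (\<lambda>_. 1 :: rat) xs))" by simp
    also have "\<dots> = ?p * prod_list (map (\<lambda>g. \<Sum>x | x \<in> Ob barG0 \<and> unit_type x = g. 1) ?gs)"
      by (rule sum_monl_lists) (simp add: unit_fibre)
    also have "map (\<lambda>g. \<Sum>x | x \<in> Ob barG0 \<and> unit_type x = g. 1 :: rat) ?gs =
        map (\<lambda>g. if snd g = Poly_Mapping.single (fst g, 1) 1 then 1 else 0) ?gs"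
      by (simp add: unit_fibre)
    finally show ?thesis .
  qed
  have pf: "of_nat (pfact (obj_mon f)) * ?p = of_nat (fact (length f))"
    using card_perms[of ?gs] unfolding of_nat_mult[symmetric] obj_mon_def by (simp add: mult.commute)
  have "counit_coeff barX f = (\<Sum>x\<in>?A. of_nat (card (Aut (Sr barG1) f)) / of_nat (deg (Sr barG0) x))"
    unfolding counit_coeff_def barX_lev S[symmetric]
    by (rule finite_grpd_hfib(2)[OF groupoid_X(1,2) functor_X(4) f finite_outs_X(1,2) finite_fibre_unit])
  also have "\<dots> = (\<Sum>x\<in>?A. of_nat (card (Aut (Sr barG1) f)) / of_nat (fact (length f)))"
    using d by (intro sum.cong refl) (simp only:)
  also have "\<dots> = of_nat (card (Aut (Sr barG1) f)) * of_nat (card ?A) / of_nat (fact (length f))"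
    by simp
  also have "\<dots> = of_nat (prod_list (map (\<lambda>g. aut (snd g)) ?gs)) *
      prod_list (map (\<lambda>g. if snd g = Poly_Mapping.single (fst g, 1) 1 then 1 else 0) ?gs) *
      (of_nat (pfact (obj_mon f)) * ?p) / of_nat (fact (length f))"
    unfolding cA card_Aut_X1[OF f] by (simp add: comp_def mult_ac)
  also have "\<dots> = of_nat (prod_list (map (\<lambda>g. aut (snd g)) ?gs)) *
      prod_list (map (\<lambda>g. if snd g = Poly_Mapping.single (fst g, 1) 1 then 1 else 0) ?gs)"
    unfolding pf by simp
  also have "\<dots> = prod_list (map (\<lambda>(i, l). A_map i l pair_id) ?gs)"
    unfolding A_map_pair_id by (induction f) (simp_all add: case_prod_unfold)
  finally show ?thesis unfolding obj_mon_def mon_eval_monl .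
qed

section \<open>The isomorphism\<close>

definition mon_class :: "mon \<Rightarrow> lev list set" where
  "mon_class m = {x \<in> Ob (Sr barG1). obj_mon x = m}"

text \<open>The exponent 0 is the monomial 1. Since tuples are nonempty, no object represents it and
  it goes to the adjoined unit.\<close>

definition mon_basis :: "mon \<Rightarrow> lev list set option" where
  "mon_basis m = (if m = 0 then None else Some (mon_class m))"

lemma obj_mon_P2:
  assumes "x \<in> Ob (Sr barG1)"
  shows "obj_mon x \<in> P2_monomials" "obj_mon x \<noteq> 0"
proof -
  have "x \<noteq> []" "set x \<subseteq> Ob barG1" using assms by (auto simp: Ob_Sr)
  then show "obj_mon x \<in> P2_monomials" "obj_mon x \<noteq> 0"
    using lev_type_Lambda2 unfolding obj_mon_def P2_monomials_def mem_Collect_eq keys_monl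
    by (simp_all add: image_subset_iff mem_Times_iff subsetD)
qed

lemma ex_obj_mon:
  assumes "m \<in> P2_monomials" "m \<noteq> 0"
  shows "\<exists>x\<in>Ob (Sr barG1). obj_mon x = m"
proof -
  obtain gs where gs: "monl gs = m" using monl_surj by blast
  have L: "snd g \<in> Lambda2" if "g \<in> set gs" for g
    using assms(1) that by (auto simp: P2_monomials_def gs[symmetric] keys_monl)
  have "\<forall>g\<in>set gs. \<exists>y\<in>Ob barG1. lev_type y = g"
  proof
    fix g assume "g \<in> set gs"
    then obtain ks where "ks \<in> posl" "monl ks = snd g" using L Lambda2_iff by blast
    then show "\<exists>y\<in>Ob barG1. lev_type y = g"
      by (intro bexI[of _ "Oper (enc_op (fst g) ks)"]) (auto simp: lev_type_enc Ob_barG1 enc_op_Ob)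
  qed
  then obtain y where y: "\<And>g. g \<in> set gs \<Longrightarrow> y g \<in> Ob barG1 \<and> lev_type (y g) = g" by metis
  have "map lev_type (map y gs) = gs" using y by (simp add: map_idI)
  then have "obj_mon (map y gs) = m" unfolding obj_mon_def using gs by simp
  moreover have "map y gs \<in> Ob (Sr barG1)" using y gs assms(2) by (auto simp: Ob_Sr)
  ultimately show ?thesis by blast
qed

lemma iso_class_eq_mon_class: "x \<in> Ob (Sr barG1) \<Longrightarrow> iso_class (Sr barG1) x = mon_class (obj_mon x)"
proof (rule set_eqI)
  fix y assume x: "x \<in> Ob (Sr barG1)"
  show "y \<in> iso_class (Sr barG1) x \<longleftrightarrow> y \<in> mon_class (obj_mon x)"
    unfolding iso_class_iff mon_class_def mem_Collect_eq using hom_X1[OF x, of y] by metis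
qed

lemma rep_mon_class:
  assumes "m \<in> P2_monomials" "m \<noteq> 0"
  shows "rep (mon_class m) \<in> Ob (Sr barG1)" "obj_mon (rep (mon_class m)) = m"
proof -
  obtain x where "x \<in> mon_class m" using ex_obj_mon[OF assms] by (auto simp: mon_class_def)
  then have "rep (mon_class m) \<in> mon_class m" unfolding rep_def by (rule someI)
  then show "rep (mon_class m) \<in> Ob (Sr barG1)" "obj_mon (rep (mon_class m)) = m"
    by (simp_all add: mon_class_def)
qed

lemma pi0_X1: "pi0 (Sr barG1) = mon_class ` (P2_monomials - {0})"
proof (intro set_eqI iffI)
  fix c assume "c \<in> pi0 (Sr barG1)"
  then show "c \<in> mon_class ` (P2_monomials - {0})"
    using iso_class_eq_mon_class obj_mon_P2 by (auto simp: pi0_def)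
next
  fix c assume "c \<in> mon_class ` (P2_monomials - {0})"
  then obtain m where m: "m \<in> P2_monomials" "m \<noteq> 0" "c = mon_class m" by blast
  then show "c \<in> pi0 (Sr barG1)"
    using iso_class_in_pi0[OF rep_mon_class(1)[OF m(1,2)]]
    by (simp only: iso_class_eq_mon_class rep_mon_class[OF m(1,2)] m(3))
qed

lemma basis_incidence: "basis (incidence barX) = insert None (Some ` pi0 (Sr barG1))"
  by (simp add: incidence_def barX_lev)

lemma zero_P2: "0 \<in> P2_monomials"
  by (simp add: P2_monomials_def)

lemma bij_mon_basis: "bij_betw mon_basis P2_monomials (basis (incidence barX))"
  unfolding bij_betw_def
proof
  show "inj_on mon_basis P2_monomials"
  proof (rule inj_onI)
    fix m n assume mn: "m \<in> P2_monomials" "n \<in> P2_monomials" and e: "mon_basis m = mon_basis n"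
    show "m = n"
    proof (cases "m = 0 \<or> n = 0")
      case True
      then show ?thesis using e by (auto simp: mon_basis_def split: if_splits)
    next
      case False
      then have "mon_class m = mon_class n" using e by (simp add: mon_basis_def)
      then show ?thesis using rep_mon_class(2)[OF mn(1)] rep_mon_class(2)[OF mn(2)] False by metis
    qed
  qed
  have "mon_basis ` P2_monomials = mon_basis ` insert 0 (P2_monomials - {0})"
    using zero_P2 by (simp only: insert_Diff)
  also have "\<dots> = insert None (mon_basis ` (P2_monomials - {0}))"
    unfolding image_insert by (simp add: mon_basis_def)
  also have "mon_basis ` (P2_monomials - {0}) = Some ` mon_class ` (P2_monomials - {0})"
    by (auto simp: mon_basis_def image_iff)
  finally show "mon_basis ` P2_monomials = basis (incidence barX)"
    by (simp add: basis_incidence pi0_X1)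
qed

lemma inj_mon_basis: "inj_on mon_basis P2_monomials"
  using bij_mon_basis by (simp add: bij_betw_def)

lemma juxtapose_mon_basis:
  assumes a: "a \<in> P2_monomials" and b: "b \<in> P2_monomials"
  shows "juxtapose barX (mon_basis a) (mon_basis b) = mon_basis (a + b)"
proof (cases "a = 0 \<or> b = 0")
  case True
  then show ?thesis by (cases "a = 0"; cases "b = 0") (simp_all add: mon_basis_def)
next
  case False
  let ?x = "rep (mon_class a)" and ?y = "rep (mon_class b)"
  have x: "?x \<in> Ob (Sr barG1)" "obj_mon ?x = a" and y: "?y \<in> Ob (Sr barG1)" "obj_mon ?y = b"
    using rep_mon_class a b False by auto
  have xy: "?x @ ?y \<in> Ob (Sr barG1)" using x y by (auto simp: Ob_Sr)
  have m: "obj_mon (?x @ ?y) = a + b" using x y by (simp add: obj_mon_def monl_append)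
  then have "a + b \<noteq> 0" using obj_mon_P2(2)[OF xy] by simp
  then show ?thesis using False iso_class_eq_mon_class[OF xy] m
    by (simp add: mon_basis_def barX_lev[simplified])
qed

text \<open>A renaming sends basis vectors to basis vectors, so its tensor square is again a
  renaming.\<close>

lemma tens_map_rename: "tens_map (rename \<gamma>) T = rename (map_prod \<gamma> \<gamma>) T"
  by (simp add: tens_map_def rename_def lin_single tens_single case_prod_unfold map_prod_def)

text \<open>On the left multiplicativity is built in, and \<open>lookup_prod_comult_tree\<close>
  evaluates the product as a sum over tuples of trees. By \<open>comult_coeff_eq\<close> the
  coefficients on the right are the same sums.\<close>

lemma comult_mon_eq:
  assumes "m \<in> P2_monomials"
  shows "rename (map_prod mon_basis mon_basis) (\<Prod>g\<in>Poly_Mapping.keys m. comult_gen g ^ Poly_Mapping.lookup m g) =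
    comult_basis barX (mon_basis m)"
proof (cases "m = 0")
  case True
  have "rename (map_prod mon_basis mon_basis) (1 :: mon \<times> mon \<Rightarrow>\<^sub>0 rat) = Poly_Mapping.single (None, None) 1"
    unfolding single_one[symmetric] rename_def lin_single zero_prod_def by (simp add: mon_basis_def)
  then show ?thesis using True by (simp add: mon_basis_def comult_basis_def)
next
  case False
  let ?T = "\<Prod>g\<in>Poly_Mapping.keys m. comult_gen g ^ Poly_Mapping.lookup m g"
  let ?R = "rename (map_prod mon_basis mon_basis) ?T"
  let ?f = "rep (mon_class m)"
  have f: "?f \<in> Ob (Sr barG1)" "obj_mon ?f = m" using rep_mon_class[OF assms False] by auto
  have T: "?T = prod_list (map comult_tree (map lev_type ?f))"
    using prod_keys_monl[of comult_tree "map lev_type ?f"] f(2) by (simp add: comult_gen_eq obj_mon_def)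
  \<comment> \<open>The outer faces of a tuple of trees are themselves nonempty tuples, so the
    monomial 1 occurs in neither factor. This matches the value 0 that \<open>comult_basis\<close>
    assigns to pairs involving \<open>None\<close>.\<close>
  have keysT: "Poly_Mapping.keys ?T \<subseteq> (P2_monomials - {0}) \<times> (P2_monomials - {0})"
  proof
    fix p assume "p \<in> Poly_Mapping.keys ?T"
    then have "Poly_Mapping.lookup ?T (fst p, snd p) \<noteq> 0" by (simp add: in_keys_iff)
    then have "{x. x \<in> Ob (Sr barG2) \<and> obj_mon (onOb (face barX 2 1) x) = obj_mon ?f \<and>
       obj_mon (onOb (face barX 2 2) x) = fst p \<and> obj_mon (onOb (face barX 2 0) x) = snd p} \<noteq> {}"
      unfolding T lookup_prod_comult_tree[OF f(1)] by (metis (no_types, lifting) mult_zero_right sum.empty)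
    then obtain x where x: "x \<in> Ob (Sr barG2)" "obj_mon (onOb (face barX 2 2) x) = fst p" "obj_mon (onOb (face barX 2 0) x) = snd p"
      by blast
    then show "p \<in> (P2_monomials - {0}) \<times> (P2_monomials - {0})"
      using obj_mon_P2[OF functorD(1)[OF functor_X(3) x(1)]] obj_mon_P2[OF functorD(1)[OF functor_X(2) x(1)]]
      by (cases p) simp
  qed
  have inj: "inj_on (map_prod mon_basis mon_basis) (P2_monomials \<times> P2_monomials)"
    using inj_mon_basis by (rule map_prod_inj_on[OF _ inj_mon_basis])
  have sub: "Poly_Mapping.keys ?T \<subseteq> P2_monomials \<times> P2_monomials" using keysT by blast
  have out: "Poly_Mapping.lookup ?R v = 0"
    if "v \<notin> (\<lambda>(a, b). (Some (mon_class a), Some (mon_class b))) ` ((P2_monomials - {0}) \<times> (P2_monomials - {0}))" for v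
  proof (rule lookup_rename_outside)
    show "v \<notin> map_prod mon_basis mon_basis ` Poly_Mapping.keys ?T"
    proof
      assume "v \<in> map_prod mon_basis mon_basis ` Poly_Mapping.keys ?T"
      then obtain a b where ab: "(a, b) \<in> Poly_Mapping.keys ?T" "v = (mon_basis a, mon_basis b)" by auto
      then have "a \<in> P2_monomials - {0}" "b \<in> P2_monomials - {0}" using keysT by auto
      then show False using that ab(2) by (auto simp: mon_basis_def)
    qed
  qed
  have val: "Poly_Mapping.lookup ?R (Some (mon_class a), Some (mon_class b)) =
      comult_coeff barX ?f (rep (mon_class a)) (rep (mon_class b))"
    if a: "a \<in> P2_monomials" "a \<noteq> 0" and b: "b \<in> P2_monomials" "b \<noteq> 0" for a b
  proof -
    have "Poly_Mapping.lookup ?R (map_prod mon_basis mon_basis (a, b)) = Poly_Mapping.lookup ?T (a, b)"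
      using a b by (intro lookup_rename[OF inj sub]) simp
    then show ?thesis
      using a(2) b(2)
      unfolding T lookup_prod_comult_tree[OF f(1)] comult_coeff_eq[OF f(1) rep_mon_class(1)[OF a] rep_mon_class(1)[OF b]]
        rep_mon_class(2)[OF a] rep_mon_class(2)[OF b]
      by (simp only: map_prod_simp mon_basis_def if_False)
  qed
  \<comment> \<open>Identifying this function with the coefficients of an existing element also
    shows that it has finite support, without which \<open>Abs_poly_mapping\<close> would say
    nothing.\<close>
  have "(\<lambda>v. case v of
           (Some a, Some b) \<Rightarrow>
             if a \<in> pi0 (simp_lev barX 1) \<and> b \<in> pi0 (simp_lev barX 1)
             then comult_coeff barX ?f (rep a) (rep b) else 0
         | _ \<Rightarrow> 0) = Poly_Mapping.lookup ?R"
  proof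
    fix v
    show "(case v of
           (Some a, Some b) \<Rightarrow>
             if a \<in> pi0 (simp_lev barX 1) \<and> b \<in> pi0 (simp_lev barX 1)
             then comult_coeff barX ?f (rep a) (rep b) else 0
         | _ \<Rightarrow> 0) = Poly_Mapping.lookup ?R v"
    proof (cases "v \<in> (\<lambda>(a, b). (Some (mon_class a), Some (mon_class b))) ` ((P2_monomials - {0}) \<times> (P2_monomials - {0}))")
      case True
      then obtain a b where v: "v = (Some (mon_class a), Some (mon_class b))"
        "a \<in> P2_monomials" "a \<noteq> 0" "b \<in> P2_monomials" "b \<noteq> 0" by auto
      then show ?thesis using val[OF v(2-5)] by (simp add: barX_lev(2)[simplified] pi0_X1)
    next
      case False
      then have "Poly_Mapping.lookup ?R v = 0" by (rule out)
      moreover have "\<not> (a \<in> pi0 (simp_lev barX 1) \<and> b \<in> pi0 (simp_lev barX 1))" if "v = (Some a, Some b)" for a b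
        using False that unfolding barX_lev pi0_X1 by (auto simp: image_iff)
      ultimately show ?thesis by (auto split: option.split prod.split)
    qed
  qed
  then have "comult_basis barX (mon_basis m) = Abs_poly_mapping (Poly_Mapping.lookup ?R)"
    using False by (simp add: comult_basis_def mon_basis_def)
  then show ?thesis by (simp add: lookup_inverse)
qed

lemma space_P2: "x \<in> space P2 \<longleftrightarrow> Poly_Mapping.keys x \<subseteq> P2_monomials"
  by (simp add: space_def P2_def)

lemma rename_mult:
  assumes x: "Poly_Mapping.keys x \<subseteq> P2_monomials" and y: "Poly_Mapping.keys y \<subseteq> P2_monomials"
  shows "rename mon_basis (x * y) = bmult (incidence barX) (rename mon_basis x) (rename mon_basis y)"
proof -
  let ?X = "rename mon_basis x" and ?Y = "rename mon_basis y"
  let ?l = Poly_Mapping.lookup and ?k = Poly_Mapping.keys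
  have "bmult (incidence barX) ?X ?Y =
      (\<Sum>u\<in>?k ?X. \<Sum>v\<in>?k ?Y. Poly_Mapping.single (juxtapose barX u v) (?l ?X u * ?l ?Y v))"
    by (simp add: incidence_def tens_def lin_sum lin_single)
  also have "\<dots> = (\<Sum>a\<in>?k x. \<Sum>v\<in>?k ?Y. Poly_Mapping.single (juxtapose barX (mon_basis a) v) (?l x a * ?l ?Y v))"
    by (rule sum_keys_rename[OF inj_mon_basis x])
  also have "\<dots> = (\<Sum>a\<in>?k x. \<Sum>b\<in>?k y. Poly_Mapping.single (juxtapose barX (mon_basis a) (mon_basis b)) (?l x a * ?l y b))"
    by (intro sum.cong refl sum_keys_rename[OF inj_mon_basis y])
  also have "\<dots> = (\<Sum>a\<in>?k x. \<Sum>b\<in>?k y. Poly_Mapping.single (mon_basis (a + b)) (?l x a * ?l y b))"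
    using x y by (intro sum.cong refl arg_cong2[where f = Poly_Mapping.single] juxtapose_mon_basis) auto
  also have "\<dots> = rename mon_basis (x * y)"
    unfolding poly_mapping_times_sum[of x y] rename_def lin_sum lin_single by simp
  finally show ?thesis by simp
qed

lemma bialg_iso_rename: "bialg_iso P2 (incidence barX) (rename mon_basis)"
  unfolding bialg_iso_def space_P2
proof (intro conjI ballI allI)
  show "bij_betw (rename mon_basis) (space P2) (space (incidence barX))"
    using bij_betw_rename[OF bij_mon_basis] by (simp add: space_def P2_def)
  show "rename mon_basis (x + y) = rename mon_basis x + rename mon_basis y" for x y
    by (simp add: rename_def lin_add)
  show "rename mon_basis (scale c x) = scale c (rename mon_basis x)" for c x
    by (simp add: rename_def lin_scale)
  show "rename mon_basis (bone P2) = bone (incidence barX)"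
    by (simp add: P2_def incidence_def rename_def lin_single mon_basis_def flip: single_one)
  show "rename mon_basis (bmult P2 x y) = bmult (incidence barX) (rename mon_basis x) (rename mon_basis y)"
    if "x \<in> space P2" "y \<in> space P2" for x y
    using rename_mult[of x y] that by (simp add: space_P2 P2_def[THEN arg_cong[of _ _ bmult]])
  show "tens_map (rename mon_basis) (bcomult P2 x) = bcomult (incidence barX) (rename mon_basis x)"
    if "x \<in> space P2" for x
  proof -
    let ?c = "\<lambda>m. \<Prod>g\<in>Poly_Mapping.keys m. comult_gen g ^ Poly_Mapping.lookup m g"
    have "bcomult P2 x = lin ?c x" by (simp add: P2_def)
    then have "tens_map (rename mon_basis) (bcomult P2 x) = rename (map_prod mon_basis mon_basis) (lin ?c x)"
      by (simp only: tens_map_rename)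
    also have "\<dots> = lin (\<lambda>m. rename (map_prod mon_basis mon_basis) (?c m)) x"
      unfolding rename_def lin_lin ..
    also have "\<dots> = lin (\<lambda>m. comult_basis barX (mon_basis m)) x"
      using that by (intro lin_cong comult_mon_eq) (auto simp: space_P2)
    also have "\<dots> = bcomult (incidence barX) (rename mon_basis x)"
      by (simp add: incidence_def rename_def lin_lin lin_single)
    finally show ?thesis .
  qed
  show "bcounit P2 x = bcounit (incidence barX) (rename mon_basis x)" if "x \<in> space P2" for x
  proof -
    have x: "Poly_Mapping.keys x \<subseteq> P2_monomials" using that by (simp add: space_P2)
    have c: "counit_basis barX (mon_basis m) = mon_eval m pair_id" if "m \<in> P2_monomials" for m
    proof (cases "m = 0")
      case True
      then show ?thesis by (simp add: counit_basis_def mon_basis_def mon_eval_def)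
    next
      case False
      then show ?thesis using rep_mon_class[OF that False] counit_coeff_eq
        by (simp add: counit_basis_def mon_basis_def)
    qed
    have "bcounit (incidence barX) (rename mon_basis x) =
        (\<Sum>a\<in>Poly_Mapping.keys x. Poly_Mapping.lookup x a * counit_basis barX (mon_basis a))"
      unfolding incidence_def using sum_keys_rename[OF inj_mon_basis x, of "\<lambda>u d. d * counit_basis barX u"] by simp
    also have "\<dots> = (\<Sum>a\<in>Poly_Mapping.keys x. Poly_Mapping.lookup x a * mon_eval a pair_id)"
      using x c by (intro sum.cong refl) (auto simp: subset_iff)
    finally show ?thesis by (simp add: P2_def)
  qed
qed

theorem theorem5p8:
  shows "locally_finite (bar (T_op Sym2)) \<and> bialg_isomorphic P2 (incidence (bar (T_op Sym2)))"
  using locally_finite_barX bialg_iso_rename unfolding bialg_isomorphic_def by blast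

end
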